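(* Let $N_0=\max\{2.67\times 9^{17},\ 10.2\times 2^{tl-3}+2\}$. \begin{description} \item[(i)] If $t=1$, $l\ge 6$, $N=\max\{N_0,\ \tfrac{625}{32}\lfloor \tfrac{l-3}{3}\rfloor^2+2\}$ and $n\ge N+\tfrac{3}{2}\sqrt{2N-6}$, then the extremal graph to $\mathrm{spex}_{\mathcal{P}}(n,tP_l)$ is $K_2\vee H_{\mathcal{P}}(l-3-2\lfloor \tfrac{l-3}{3}\rfloor,\lfloor \tfrac{l-3}{3}\rfloor)$. \item[(ii)] If $t=2$, $l\ge 4$, $N=\max\{N_0,\ \tfrac{625}{32}\lfloor \tfrac{l-2}{2}\rfloor^2+2\}$ and $n\ge N+\tfrac{3}{2}\sqrt{2N-6}$, then the extremal graph to $\mathrm{spex}_{\mathcal{P}}(n,tP_l)$ is $K_2\vee H_{\mathcal{P}}(l-1,\lceil \tfrac{l-2}{2}\rceil,\lfloor \tfrac{l-2}{2}\rfloor)$. \item[(iii)] If $t\ge 3$, $l\ge 3$, $N=\max\{N_0,\ \tfrac{625}{32}(\lfloor \tfrac{l-2}{2}\rfloor+1)^2+2\}$ and $n\ge N+\tfrac{3}{2}\sqrt{2N-6}$, then the extremal graph to $\mathrm{spex}_{\mathcal{P}}(n,tP_l)$ is $K_2\vee H_{\mathcal{P}}(tl-2l-1,\,l-1)$. \end{description} Here "the extremal graph to $\mathrm{spex}_{\mathcal{P}}(n,F)$ is $X$" means that $X$ is an $n$-vertex $F$-free planar graph and every $n$-vertex $F$-free planar graph of maximum spectral radius is isomorphic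 to $X$.
   Context: All graphs are finite and simple. The spectral radius of a graph is the largest eigenvalue of its adjacency matrix. A graph is $F$-free if it contains no subgraph isomorphic to $F$. $\mathrm{spex}_{\mathcal{P}}(n,F)$ denotes the maximum spectral radius over all $n$-vertex $F$-free planar graphs. $P_l$ denotes the path on $l$ vertices, $tP_l$ the disjoint union of $t$ vertex-disjoint copies of $P_l$, $K_2$ a single edge, and $G_1\vee G_2$ the join (disjoint union plus all edges between $G_1$ and $G_2$); $kP_m$ denotes $k$ vertex-disjoint copies of $P_m$. For positive integers $n,n_1,n_2$ with $n\ge n_1\ge n_2\ge 1$, $H_{\mathcal{P}}(n_1,n_2)$ (depending on $n$) is the disjoint union of paths on $n-2$ vertices: $P_{n_1}\cup \frac{n-2-n_1}{n_2}P_{n_2}$ if $n_2\mid (n-2-n_1)$, and otherwise $P_{n_1}\cup \lfloor \frac{n-2-n_1}{n_2}\rfloor P_{n_2}\cup P_{\,n-2-n_1-\lfloor \frac{n-2-n_1}{n_2}\rfloor n_2}$. For positive integers $n,n_1,n_2,n_3$ with $n\ge n_1\ge n_2\ge n_3\ge 1$, $H_{\mathcal{P}}(n_1,n_2,n_3)$ (depending on $n$) is the disjoint union of paths on $n-2$ vertices: $P_{n_1}\cup P_{n_2}\cup \frac{n-2-n_1-n_2}{n_3}P_{n_3}$ if $n_3\mid (n-2-n_1-n_2)$, and otherwise $P_{n_1}\cup P_{n_2}\cup \lfloor \frac{n-2-n_1-n_2}{n_3}\rfloor P_{n_3}\cup P_{\,n-2-n_1-n_2-\lfloor \frac{n-2-n_1-n_2}{n_3}\rfloor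 n_3}$. *)

theory Defs
  imports "HOL-Analysis.Analysis"
begin

type_synonym graph = "nat set \<times> nat set set"

definition verts :: "graph \<Rightarrow> nat set" where "verts G = fst G"
definition edges :: "graph \<Rightarrow> nat set set" where "edges G = snd G"

definition simple_graph :: "graph \<Rightarrow> bool" where
  "simple_graph G \<longleftrightarrow> finite (verts G) \<and>
     edges G \<subseteq> {{u, v} | u v. u \<in> verts G \<and> v \<in> verts G \<and> u \<noteq> v}"

definition contains_subgraph :: "graph \<Rightarrow> graph \<Rightarrow> bool" where
  "contains_subgraph G F \<longleftrightarrow> (\<exists>f. inj_on f (verts F) \<and> f ` verts F \<subseteq> verts G \<and>
      (\<forall>e\<in>edges F. f ` e \<in> edges G))"

definition F_free :: "graph \<Rightarrow> graph \<Rightarrow> bool" where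
  "F_free F G \<longleftrightarrow> \<not> contains_subgraph G F"

definition isomorphic :: "graph \<Rightarrow> graph \<Rightarrow> bool" where
  "isomorphic G H \<longleftrightarrow> (\<exists>f. bij_betw f (verts G) (verts H) \<and>
      (\<forall>u\<in>verts G. \<forall>v\<in>verts G. {u, v} \<in> edges G \<longleftrightarrow> {f u, f v} \<in> edges H))"

definition planar :: "graph \<Rightarrow> bool" where
  "planar G \<longleftrightarrow> (\<exists>(p :: nat \<Rightarrow> complex) (\<gamma> :: nat set \<Rightarrow> real \<Rightarrow> complex).
      inj_on p (verts G) \<and>
      (\<forall>e\<in>edges G. \<exists>u v. e = {u, v} \<and> arc (\<gamma> e) \<and> pathstart (\<gamma> e) = p u \<and>
          pathfinish (\<gamma> e) = p v \<and> path_image (\<gamma> e) \<inter> p ` verts G = {p u, p v}) \<and>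
      (\<forall>e\<in>edges G. \<forall>e'\<in>edges G. e \<noteq> e' \<longrightarrow>
          path_image (\<gamma> e) \<inter> path_image (\<gamma> e') \<subseteq> p ` (e \<inter> e')))"

definition adj :: "graph \<Rightarrow> nat \<Rightarrow> nat \<Rightarrow> real" where
  "adj G u v = (if {u, v} \<in> edges G then 1 else 0)"

definition is_eigenvalue :: "graph \<Rightarrow> real \<Rightarrow> bool" where
  "is_eigenvalue G mu \<longleftrightarrow> (\<exists>x :: nat \<Rightarrow> real. (\<exists>v\<in>verts G. x v \<noteq> 0) \<and>
      (\<forall>u\<in>verts G. (\<Sum>w\<in>verts G. adj G u w * x w) = mu * x u))"

definition spectral_radius :: "graph \<Rightarrow> real" where
  "spectral_radius G = Max {mu. is_eigenvalue G mu}"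

text \<open>Disjoint union of paths with the given numbers of vertices, on vertices
  0..<sum; consecutive blocks of vertices form the paths.\<close>
definition paths_graph :: "nat list \<Rightarrow> graph" where
  "paths_graph ls = ({0..<sum_list ls},
     {{i, Suc i} | i. Suc i < sum_list ls \<and>
        Suc i \<notin> {sum_list (take k ls) | k. k \<le> length ls}})"

definition tP :: "nat \<Rightarrow> nat \<Rightarrow> graph" where
  "tP t l = paths_graph (replicate t l)"

definition K2_join_paths :: "nat list \<Rightarrow> graph" where
  "K2_join_paths ls = (let s = sum_list ls in
     ({0..<s + 2}, edges (paths_graph ls) \<union> {{s, s + 1}} \<union>
        {{s, v} | v. v < s} \<union> {{s + 1, v} | v. v < s}))"

text \<open>Path-length lists of H_P(n1,n2) and H_P(n1,n2,n3) (depending on n).\<close>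
definition HP2 :: "nat \<Rightarrow> nat \<Rightarrow> nat \<Rightarrow> nat list" where
  "HP2 n n1 n2 = (let r = n - 2 - n1 in
     [n1] @ replicate (r div n2) n2 @ (if r mod n2 = 0 then [] else [r mod n2]))"

definition HP3 :: "nat \<Rightarrow> nat \<Rightarrow> nat \<Rightarrow> nat \<Rightarrow> nat list" where
  "HP3 n n1 n2 n3 = (let r = n - 2 - n1 - n2 in
     [n1, n2] @ replicate (r div n3) n3 @ (if r mod n3 = 0 then [] else [r mod n3]))"

definition extremal_planar :: "nat \<Rightarrow> graph \<Rightarrow> graph \<Rightarrow> bool" where
  "extremal_planar n F X \<longleftrightarrow>
     (simple_graph X \<and> card (verts X) = n \<and> planar X \<and> F_free F X) \<and>
     (\<forall>G. simple_graph G \<and> card (verts G) = n \<and> planar G \<and> F_free F G \<and>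
        (\<forall>G'. simple_graph G' \<and> card (verts G') = n \<and> planar G' \<and> F_free F G' \<longrightarrow>
           spectral_radius G' \<le> spectral_radius G)
        \<longrightarrow> isomorphic G X)"

end

theory Submission
  imports Defs
begin

text \<open>The join of two adjacent vertices with a disjoint union of paths has spectral radius at least
  \<open>sqrt (2 * (n - 2))\<close>. Conversely, let \<open>G\<close> be an extremal graph. It has no path on \<open>t * l\<close> vertices,
  so a depth-first search forest has bounded depth, and planarity enters only through the absence of
  \<open>K\<^sub>3\<^sub>,\<^sub>3\<close> and of a cycle with three common neighbours. An eigenvector estimate yields two vertices
  adjacent to almost all others. Making them adjacent to everything, and deleting the other edges
  at the exceptional vertices, does not decrease the spectral radius, and what remains besides the
  two hubs is a linear forest.

  With \<open>z + 1 / z\<close> the spectral radius, solving the eigenvector recurrence on each path makes the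
  spectral radius a monotone function of a sum over the paths of a strictly convex function of
  their lengths, so that it suffices to compare path lengths in the majorization order. The bounds on
  \<open>\<Sum>a. (a - c)\<close> needed for this follow from the paths that the two hubs create out of the longest
  components.\<close>

section \<open>Planar drawings\<close>

text \<open>The forest takes the place of an edge count. Directing every edge towards the ancestor
  gives out-degrees at most \<open>h\<close>, so by AM-GM a set with degrees at most
  \<open>D\<close> has spectral radius at most 2 * sqrt (h * D), which is small against sqrt n
  unless \<open>D\<close> is of order n / h. Hence only O(h) heavy vertices matter, and 1.414 * sqrt
  n is reached only if two of them see almost everything.

  The graph with completed hubs may contain the forbidden paths. It is only an upper bound for the
  spectral radius of \<open>G\<close>: the component lengths are restricted by paths found in
  \<open>G\<close> itself, and exceptional vertices count as paths with one vertex. It is compared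
  with the packed graph at a single \<open>z\<close>, its own, where its eigenvalue equation is
  exact and a test vector on the packed graph turns an inequality between weights into one between
  spectral radii. If few components reach the bulk length, the majorization bounds may fail, but
  then there are too many components and the graph loses for that reason.

  The estimates consume n \<ge> 10^13 * h^2 and n \<ge> 5 * 10^9 * h^4, and \<open>N0\<close>
  supplies both.\<close>

lemma jordan_sides:
  fixes c :: "real \<Rightarrow> complex"
  assumes "simple_path c" "pathfinish c = pathstart c" "q \<notin> path_image c"
  obtains S F where "S \<union> F = - path_image c" "S \<inter> F = {}" "connected S" "connected F" "q \<in> S" "F \<noteq> {}"
    "frontier S = path_image c" "frontier F = path_image c" "open S" "open F"
proof -
  \<comment> \<open>Later arguments use only that both sides have the whole curve as frontier, never
    which side is bounded, so the side of \<open>q\<close> is simply called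
    \<open>S\<close>.\<close>
  note J = Jordan_inside_outside[OF assms(1,2)]
  from J assms(3) have "q \<in> inside (path_image c) \<or> q \<in> outside (path_image c)" by blast
  then show ?thesis
  proof
    assume "q \<in> inside (path_image c)"
    then show ?thesis using J by (metis that)
  next
    assume "q \<in> outside (path_image c)"
    then show ?thesis using J by (metis that Un_commute Int_commute)
  qed
qed

lemma connected_in_side:
  fixes S F :: "complex set"
  assumes "S \<union> F = - J" "S \<inter> F = {}" "open S" "open F" "connected K" "K \<inter> J = {}" "K \<inter> S \<noteq> {}"
  shows "K \<subseteq> S"
proof (rule ccontr)
  assume "\<not> K \<subseteq> S"
  then have "K \<inter> F \<noteq> {}" using assms(1,6) by blast
  moreover have "K \<subseteq> S \<union> F" using assms(1,6) by blast
  ultimately show False using assms connectedD[OF assms(5,3,4)] by blast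
qed

section \<open>Theta curves\<close>

definition theta_arcs :: "(nat \<Rightarrow> real \<Rightarrow> complex) \<Rightarrow> complex \<Rightarrow> complex \<Rightarrow> bool" where
  "theta_arcs \<alpha> x y \<longleftrightarrow> (\<forall>i<3. arc (\<alpha> i) \<and> pathstart (\<alpha> i) = x \<and> pathfinish (\<alpha> i) = y) \<and>
     (\<forall>i<3. \<forall>j<3. i \<noteq> j \<longrightarrow> path_image (\<alpha> i) \<inter> path_image (\<alpha> j) = {x, y})"

lemma theta_sides:
  assumes th: "theta_arcs \<alpha> x y" and i: "i < 3" "j < 3" "i \<noteq> j"
    and q: "q \<notin> path_image (\<alpha> i) \<union> path_image (\<alpha> j)"
  obtains S F where "S \<union> F = - (path_image (\<alpha> i) \<union> path_image (\<alpha> j))" "S \<inter> F = {}"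
    "connected S" "connected F" "q \<in> S" "F \<noteq> {}"
    "frontier F = path_image (\<alpha> i) \<union> path_image (\<alpha> j)" "open S" "open F"
proof -
  let ?c = "\<alpha> i +++ reversepath (\<alpha> j)"
  have a: "arc (\<alpha> i)" "arc (\<alpha> j)" "pathstart (\<alpha> i) = x" "pathfinish (\<alpha> i) = y"
     "pathstart (\<alpha> j) = x" "pathfinish (\<alpha> j) = y" "path_image (\<alpha> i) \<inter> path_image (\<alpha> j) = {x, y}"
    using th i unfolding theta_arcs_def by auto
  have sp: "simple_path ?c"
    by (rule simple_path_join_loop) (use a in \<open>auto simp: arc_reversepath\<close>)
  have im: "path_image ?c = path_image (\<alpha> i) \<union> path_image (\<alpha> j)"
    using a by (subst path_image_join) auto
  have cl: "pathfinish ?c = pathstart ?c" using a by simp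
  show ?thesis
    using jordan_sides[OF sp cl, of q, unfolded im, OF q] that by metis
qed

text \<open>The region of the complement of a theta curve that avoids one arc has the other two arcs as
  its frontier, so the point \<open>q\<close>, which sees all three arcs, would lie in a fourth region; this
  contradicts Janiszewski's theorem.\<close>
lemma theta_no_common_point:
  assumes th: "theta_arcs \<alpha> x y"
    and K: "\<And>i. i < 3 \<Longrightarrow> connected (K i) \<and> q \<in> K i \<and> b i \<in> K i \<and>
        K i \<inter> (\<Union>j<3. path_image (\<alpha> j)) = {b i}"
    and b: "\<And>i. i < 3 \<Longrightarrow> b i \<in> path_image (\<alpha> i) - {x, y}"
    and q: "q \<notin> (\<Union>j<3. path_image (\<alpha> j))"
  shows False
proof -
  let ?A = "\<lambda>i. path_image (\<alpha> i)"
  have disj: "?A i \<inter> ?A j = {x, y}" if "i < 3" "j < 3" "i \<noteq> j" for i j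
    using th that unfolding theta_arcs_def by blast
  have xy: "x \<in> ?A i" "y \<in> ?A i" if "i < 3" for i
    using th that unfolding theta_arcs_def by (metis pathstart_in_path_image pathfinish_in_path_image)+
  have arcconn: "connected (?A k - {x, y})" if "k < 3" for k
  proof -
    have "simple_path (\<alpha> k)" "pathstart (\<alpha> k) = x" "pathfinish (\<alpha> k) = y"
      using th that arc_imp_simple_path unfolding theta_arcs_def by auto
    then show ?thesis using connected_simple_path_endless[of "\<alpha> k"] by simp
  qed
  \<comment> \<open>The point \<open>q\<close> reaches arc \<open>k\<close> through
    \<open>K k\<close>, and arc \<open>k\<close> without its ends is connected, so both lie on the
    same side of the closed curve of arcs \<open>i\<close> and \<open>j\<close>. The opposite region
    \<open>F\<close> therefore misses arc \<open>k\<close> as well.\<close>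
  have region: "\<exists>S F. S \<union> F = - (?A i \<union> ?A j) \<and> S \<inter> F = {} \<and> connected S \<and> connected F \<and> q \<in> S \<and> F \<noteq> {}
      \<and> frontier F = ?A i \<union> ?A j \<and> open S \<and> open F \<and> F \<inter> ?A k = {}"
    if ijk: "i < 3" "j < 3" "i \<noteq> j" "k < 3" "k \<noteq> i" "k \<noteq> j" for i j k
  proof -
    have "q \<notin> ?A i \<union> ?A j" using q ijk by blast
    from theta_sides[OF th ijk(1-3) this] obtain S F where
      SF: "S \<union> F = - (?A i \<union> ?A j)" "S \<inter> F = {}" "connected S" "connected F" "q \<in> S" "F \<noteq> {}"
      "frontier F = ?A i \<union> ?A j" "open S" "open F" by metis
    have "K k \<inter> (?A i \<union> ?A j) = {}"
    proof -
      have "K k \<inter> (?A i \<union> ?A j) \<subseteq> {b k}" using K[OF ijk(4)] ijk(1,2) by blast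
      moreover have "b k \<notin> ?A i \<union> ?A j" using b[OF ijk(4)] disj[OF ijk(4) ijk(1)] disj[OF ijk(4) ijk(2)] ijk by blast
      ultimately show ?thesis by blast
    qed
    then have "K k \<subseteq> S" using connected_in_side[OF SF(1,2,8,9)] K[OF ijk(4)] SF(5) by blast
    then have "b k \<in> S" using K[OF ijk(4)] by blast
    moreover have "(?A k - {x, y}) \<inter> (?A i \<union> ?A j) = {}" using disj[OF ijk(4) ijk(1)] disj[OF ijk(4) ijk(2)] ijk by blast
    ultimately have "?A k - {x, y} \<subseteq> S"
      using connected_in_side[OF SF(1,2,8,9) arcconn[OF ijk(4)]] b[OF ijk(4)] by blast
    moreover have "x \<notin> F" "y \<notin> F" using SF(1) xy[OF ijk(1)] by blast+
    ultimately have "F \<inter> ?A k = {}" using SF(2) by blast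
    with SF show ?thesis by blast
  qed
  from region[of 0 1 2] obtain S3 F3 where R3: "S3 \<union> F3 = - (?A 0 \<union> ?A 1)" "S3 \<inter> F3 = {}" "connected S3" "connected F3" "q \<in> S3" "F3 \<noteq> {}"
      "frontier F3 = ?A 0 \<union> ?A 1" "open S3" "open F3" "F3 \<inter> ?A 2 = {}" by auto
  from region[of 0 2 1] obtain S2 F2 where R2: "S2 \<union> F2 = - (?A 0 \<union> ?A 2)" "S2 \<inter> F2 = {}" "connected S2" "connected F2" "q \<in> S2" "F2 \<noteq> {}"
      "frontier F2 = ?A 0 \<union> ?A 2" "open S2" "open F2" "F2 \<inter> ?A 1 = {}" by auto
  from region[of 1 2 0] obtain S1 F1 where R1: "S1 \<union> F1 = - (?A 1 \<union> ?A 2)" "S1 \<inter> F1 = {}" "connected S1" "connected F1" "q \<in> S1" "F1 \<noteq> {}"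
      "frontier F1 = ?A 1 \<union> ?A 2" "open S1" "open F1" "F1 \<inter> ?A 0 = {}" by auto
  \<comment> \<open>The point \<open>b 0\<close> lies on arc 0 only, which tells the frontier of
    \<open>F1\<close> from those of \<open>F2\<close> and \<open>F3\<close>.\<close>
  have ne: "?A 0 \<union> ?A 1 \<noteq> ?A 1 \<union> ?A 2" "?A 0 \<union> ?A 2 \<noteq> ?A 1 \<union> ?A 2"
    using b[of 0] disj[of 0 1] disj[of 0 2] by auto
  \<comment> \<open>Two such regions that meet contain each other, since each is connected and
    avoids the boundary of the other; then their frontiers would agree.\<close>
  have d13: "F1 \<inter> F3 = {}"
  proof (rule ccontr)
    assume n: "F1 \<inter> F3 \<noteq> {}"
    have "F1 \<subseteq> F3"
      using connected_in_side[of F3 S3 "?A 0 \<union> ?A 1" F1] R3(1,2,8,9) R1(1,4,10) n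
      by (simp add: Un_commute Int_commute) blast
    moreover have "F3 \<subseteq> F1"
      using connected_in_side[of F1 S1 "?A 1 \<union> ?A 2" F3] R1(1,2,8,9) R3(1,4,10) n
      by (simp add: Un_commute Int_commute) blast
    ultimately show False using R1(7) R3(7) ne by auto
  qed
  have d12: "F1 \<inter> F2 = {}"
  proof (rule ccontr)
    assume n: "F1 \<inter> F2 \<noteq> {}"
    have "F1 \<subseteq> F2"
      using connected_in_side[of F2 S2 "?A 0 \<union> ?A 2" F1] R2(1,2,8,9) R1(1,4,10) n
      by (simp add: Un_commute Int_commute) blast
    moreover have "F2 \<subseteq> F1"
      using connected_in_side[of F1 S1 "?A 1 \<union> ?A 2" F2] R1(1,2,8,9) R2(1,4,10) n
      by (simp add: Un_commute Int_commute) blast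
    ultimately show False using R1(7) R2(7) ne by auto
  qed
  \<comment> \<open>A point of \<open>F1\<close> is on the side of \<open>q\<close> for both other
    curves. These two curves meet in arc 0, which is connected, so Janiszewski's theorem joins
    \<open>q\<close> to \<open>r\<close> off all three arcs, although the curve of arcs 1 and 2
    separates them.\<close>
  obtain r where r: "r \<in> F1" using R1 by blast
  have r3: "r \<in> S3" using r d13 R3(1) R1(1,10) by blast
  have r2: "r \<in> S2" using r d12 R2(1) R1(1,10) by blast
  have cp: "compact (?A i)" if "i < 3" for i
    using th that unfolding theta_arcs_def by (simp add: compact_arc_image)
  have cn: "connected (?A i)" if "i < 3" for i
    using th that unfolding theta_arcs_def by (simp add: connected_arc_image)
  have int: "(?A 0 \<union> ?A 1) \<inter> (?A 0 \<union> ?A 2) = ?A 0"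
    using disj[of 1 2] xy[of 0] by auto
  have "connected_component (- ((?A 0 \<union> ?A 1) \<union> (?A 0 \<union> ?A 2))) q r"
  proof (rule Janiszewski)
    show "compact (?A 0 \<union> ?A 1)" "closed (?A 0 \<union> ?A 2)"
      using cp by (simp_all add: compact_Un closed_Un compact_imp_closed)
    show "connected ((?A 0 \<union> ?A 1) \<inter> (?A 0 \<union> ?A 2))" unfolding int by (simp add: cn)
    show "connected_component (- (?A 0 \<union> ?A 1)) q r"
      unfolding connected_component_def using R3(1,3,5) r3 by (intro exI[of _ S3]) auto
    show "connected_component (- (?A 0 \<union> ?A 2)) q r"
      unfolding connected_component_def using R2(1,3,5) r2 by (intro exI[of _ S2]) auto
  qed
  then obtain C where C: "connected C" "C \<subseteq> - ((?A 0 \<union> ?A 1) \<union> (?A 0 \<union> ?A 2))" "q \<in> C" "r \<in> C"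
    unfolding connected_component_def by blast
  have "C \<subseteq> S1" 
    using connected_in_side[OF R1(1,2,8,9) C(1)] C(2,3) R1(5) by blast
  then show False using C(4) r R1(2) by blast
qed

lemma connected_arc_minus_finish:
  fixes h :: "real \<Rightarrow> complex"
  assumes "arc h"
  shows "connected (path_image h - {pathfinish h})"
proof -
  have inj: "inj_on h {0..1}" and c: "continuous_on {0..1} h"
    using assms by (auto simp: arc_def path_def)
  have "path_image h - {pathfinish h} = h ` {0..<1}"
    unfolding path_image_def pathfinish_def
  proof (intro set_eqI iffI)
    fix z assume "z \<in> h ` {0..1} - {h 1}"
    then obtain t where "t \<in> {0..1}" "z = h t" "t \<noteq> 1" by blast
    then show "z \<in> h ` {0..<1}" by (intro image_eqI[of _ _ t]) auto
  next
    fix z assume "z \<in> h ` {0..<1}"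
    then obtain t where "t \<in> {0..<1}" "z = h t" by blast
    then have t: "t \<in> {0..1}" "z = h t" "t \<noteq> 1" by auto
    then have "h t \<noteq> h 1" using inj_onD[OF inj, of t 1] by auto
    then show "z \<in> h ` {0..1} - {h 1}" using t by (intro DiffI image_eqI[of _ _ t]) auto
  qed
  moreover have "connected (h ` {0..<1})"
    by (intro connected_continuous_image continuous_on_subset[OF c]) auto
  ultimately show ?thesis by simp
qed

text \<open>Arcs are indexed by ordered pairs, so that \<open>g a b\<close> runs from
  \<open>p a\<close> to \<open>p b\<close> and arcs can be concatenated along paths; in
  \<open>planar\<close> an arc belongs to an unordered edge and has an arbitrary direction.\<close>

locale drawing =
  fixes V :: "nat set" and E :: "nat set set" and p :: "nat \<Rightarrow> complex"
    and g :: "nat \<Rightarrow> nat \<Rightarrow> real \<Rightarrow> complex"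
  assumes inj: "inj_on p V"
    and edge: "{a, b} \<in> E \<Longrightarrow> a \<in> V \<and> b \<in> V \<and> a \<noteq> b"
    and arc: "{a, b} \<in> E \<Longrightarrow> arc (g a b) \<and> pathstart (g a b) = p a \<and> pathfinish (g a b) = p b"
    and vert: "{a, b} \<in> E \<Longrightarrow> path_image (g a b) \<inter> p ` V = {p a, p b}"
    and cross: "{a, b} \<in> E \<Longrightarrow> {c, d} \<in> E \<Longrightarrow> {a, b} \<noteq> {c, d} \<Longrightarrow>
      path_image (g a b) \<inter> path_image (g c d) \<subseteq> p ` ({a, b} \<inter> {c, d})"
begin

lemma p_eq: "a \<in> V \<Longrightarrow> b \<in> V \<Longrightarrow> p a = p b \<longleftrightarrow> a = b"
  using inj by (auto dest: inj_onD)

lemma ends: "{a, b} \<in> E \<Longrightarrow> p a \<in> path_image (g a b)" "{a, b} \<in> E \<Longrightarrow> p b \<in> path_image (g a b)"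
  using vert by blast+

lemma vertD: "{a, b} \<in> E \<Longrightarrow> p c \<in> path_image (g a b) \<Longrightarrow> c \<in> V \<Longrightarrow> c = a \<or> c = b"
  using vert[of a b] edge[of a b] p_eq[of c a] p_eq[of c b] by blast

lemma arc_via:
  assumes "{u, b} \<in> E" "{b, v} \<in> E" "u \<noteq> v"
  shows "arc (g u b +++ g b v)" "pathstart (g u b +++ g b v) = p u" "pathfinish (g u b +++ g b v) = p v"
    "path_image (g u b +++ g b v) = path_image (g u b) \<union> path_image (g b v)"
proof -
  have e: "{u, b} \<inter> {b, v} = {b}" using edge[OF assms(1)] edge[OF assms(2)] assms(3) by auto
  have "{u, b} \<noteq> {b, v}" using edge[OF assms(1)] edge[OF assms(2)] assms(3) by (auto simp: doubleton_eq_iff)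
  then have c: "path_image (g u b) \<inter> path_image (g b v) \<subseteq> {p b}"
    using cross[OF assms(1,2)] e by auto
  show "arc (g u b +++ g b v)"
    by (rule arc_join) (use arc[OF assms(1)] arc[OF assms(2)] c in auto)
  show "path_image (g u b +++ g b v) = path_image (g u b) \<union> path_image (g b v)"
    using arc[OF assms(1)] arc[OF assms(2)] by (intro path_image_join) auto
qed (use arc[OF assms(1)] arc[OF assms(2)] in auto)

lemma theta_via:
  fixes b :: "nat \<Rightarrow> nat"
  assumes uv: "u \<noteq> v" and b: "\<And>i. i < 3 \<Longrightarrow> {u, b i} \<in> E \<and> {b i, v} \<in> E" and bi: "inj_on b {..<3}"
  shows "theta_arcs (\<lambda>i. g u (b i) +++ g (b i) v) (p u) (p v)"
  unfolding theta_arcs_def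
proof (intro conjI allI impI)
  fix i j :: nat assume ij: "i < 3" "j < 3" "i \<noteq> j"
  have ne: "b i \<noteq> b j" using bi ij by (auto dest: inj_onD)
  have d: "u \<noteq> b i" "u \<noteq> b j" "v \<noteq> b i" "v \<noteq> b j" using b ij edge by blast+
  have 1: "path_image (g u (b i)) \<inter> path_image (g u (b j)) \<subseteq> {p u}"
    using cross[of u "b i" u "b j"] b ij ne d by (auto simp: doubleton_eq_iff)
  have 2: "path_image (g u (b i)) \<inter> path_image (g (b j) v) \<subseteq> {}"
    using cross[of u "b i" "b j" v] b ij ne d uv by (auto simp: doubleton_eq_iff)
  have 3: "path_image (g (b i) v) \<inter> path_image (g u (b j)) \<subseteq> {}"
    using cross[of "b i" v u "b j"] b ij ne d uv by (auto simp: doubleton_eq_iff)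
  have 4: "path_image (g (b i) v) \<inter> path_image (g (b j) v) \<subseteq> {p v}"
    using cross[of "b i" v "b j" v] b ij ne d by (auto simp: doubleton_eq_iff)
  have im: "path_image (g u (b k) +++ g (b k) v) = path_image (g u (b k)) \<union> path_image (g (b k) v)" if "k < 3" for k
    using arc_via(4) b that uv by blast
  have e: "p u \<in> path_image (g u (b k))" "p v \<in> path_image (g (b k) v)" if "k < 3" for k
    using ends b that by blast+
  show "path_image (g u (b i) +++ g (b i) v) \<inter> path_image (g u (b j) +++ g (b j) v) = {p u, p v}"
    unfolding im[OF ij(1)] im[OF ij(2)] using 1 2 3 4 e[OF ij(1)] e[OF ij(2)] by blast
next
  fix i :: nat assume i: "i < 3"
  show "arc (g u (b i) +++ g (b i) v)" "pathstart (g u (b i) +++ g (b i) v) = p u"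
    "pathfinish (g u (b i) +++ g (b i) v) = p v"
    using arc_via(1-3)[of u "b i" v] b[OF i] uv by auto
qed

text \<open>The paths from \<open>u\<close> to \<open>v\<close> through the three vertices
  \<open>b i\<close> form a theta curve, and the edges at \<open>w\<close> lead from
  \<open>p w\<close> to an inner point of each of its arcs, which
  \<open>theta_no_common_point\<close> forbids.\<close>

lemma no_K33:
  fixes b :: "nat \<Rightarrow> nat"
  assumes uv: "u \<noteq> v" "w \<noteq> u" "w \<noteq> v"
    and b: "\<And>i. i < 3 \<Longrightarrow> {u, b i} \<in> E \<and> {b i, v} \<in> E \<and> {w, b i} \<in> E" and bi: "inj_on b {..<3}"
  shows False
proof -
  let ?\<alpha> = "\<lambda>i. g u (b i) +++ g (b i) v"
  let ?K = "\<lambda>i. path_image (g w (b i))"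
  have th: "theta_arcs ?\<alpha> (p u) (p v)" using theta_via b bi uv by blast
  have im: "path_image (?\<alpha> k) = path_image (g u (b k)) \<union> path_image (g (b k) v)" if "k < 3" for k
    using arc_via(4) b that uv by blast
  have V: "u \<in> V" "v \<in> V" "w \<in> V" using b[of 0] edge by auto
  have bV: "b i \<in> V" "b i \<noteq> u" "b i \<noteq> v" "b i \<noteq> w" if "i < 3" for i using b[OF that] edge by blast+
  show False
  proof (rule theta_no_common_point[OF th, of ?K "p w" "\<lambda>i. p (b i)"])
    fix i :: nat assume i: "i < 3"
    have "?K i \<inter> path_image (?\<alpha> j) \<subseteq> {p (b i)}" if j: "j < 3" for j
    proof -
      have "?K i \<inter> path_image (g u (b j)) \<subseteq> p ` ({w, b i} \<inter> {u, b j})"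
        by (rule cross) (use b i j bV[OF i] bV[OF j] uv in \<open>auto simp: doubleton_eq_iff\<close>)
      moreover have "?K i \<inter> path_image (g (b j) v) \<subseteq> p ` ({w, b i} \<inter> {b j, v})"
        by (rule cross) (use b i j bV[OF i] bV[OF j] uv in \<open>auto simp: doubleton_eq_iff\<close>)
      moreover have "p ` ({w, b i} \<inter> {u, b j}) \<subseteq> {p (b i)}" "p ` ({w, b i} \<inter> {b j, v}) \<subseteq> {p (b i)}"
        using bV[OF j] uv by auto
      ultimately show ?thesis unfolding im[OF j] Int_Un_distrib by (meson Un_least order_trans)
    qed
    moreover have "p (b i) \<in> ?K i" "p (b i) \<in> path_image (?\<alpha> i)" "p w \<in> ?K i"
      using ends b[OF i] im[OF i] by blast+
    ultimately show "connected (?K i) \<and> p w \<in> ?K i \<and> p (b i) \<in> ?K i \<and>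
        ?K i \<inter> (\<Union>j<3. path_image (?\<alpha> j)) = {p (b i)}"
      using i arc b[OF i] by (auto simp: connected_arc_image)
    show "p (b i) \<in> path_image (?\<alpha> i) - {p u, p v}"
      using \<open>p (b i) \<in> path_image (?\<alpha> i)\<close> bV[OF i] V p_eq by auto
  next
    have "p w \<notin> path_image (?\<alpha> i)" if "i < 3" for i
      using vertD[of u "b i" w] vertD[of "b i" v w] b[OF that] bV[OF that] uv V im[OF that] by blast
    then show "p w \<notin> (\<Union>j<3. path_image (?\<alpha> j))" by blast
  qed
qed

lemma path_arc:
  assumes "distinct cs" "length cs \<ge> 2" "\<And>i. Suc i < length cs \<Longrightarrow> {cs ! i, cs ! Suc i} \<in> E"
  shows "\<exists>\<beta>. arc \<beta> \<and> pathstart \<beta> = p (hd cs) \<and> pathfinish \<beta> = p (last cs) \<and>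
    path_image \<beta> = (\<Union>i\<in>{i. Suc i < length cs}. path_image (g (cs ! i) (cs ! Suc i)))"
  using assms
proof (induction cs rule: rev_induct)
  case Nil then show ?case by simp
next
  case (snoc c cs)
  show ?case
  proof (cases "length cs \<ge> 2")
    case False
    then have "length cs = 1" using snoc.prems(2) by simp
    then obtain a where cs: "cs = [a]" by (auto simp: length_Suc_conv)
    have "{a, c} \<in> E" using snoc.prems(3)[of 0] cs by simp
    then show ?thesis using arc cs by (intro exI[of _ "g a c"]) (auto simp: less_Suc_eq)
  next
    case True
    let ?n = "length cs"
    have e: "{cs ! i, cs ! Suc i} \<in> E" if "Suc i < ?n" for i
      using snoc.prems(3)[of i] that by (simp add: nth_append)
    from snoc.IH[OF _ True e] snoc.prems(1) obtain \<beta> where \<beta>: "arc \<beta>" "pathstart \<beta> = p (hd cs)" "pathfinish \<beta> = p (last cs)"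
      "path_image \<beta> = (\<Union>i\<in>{i. Suc i < ?n}. path_image (g (cs ! i) (cs ! Suc i)))" by auto
    have ne: "cs \<noteq> []" using True by auto
    have le: "{last cs, c} \<in> E" using snoc.prems(3)[of "?n - 1"] True ne by (simp add: nth_append last_conv_nth)
    have "path_image \<beta> \<inter> path_image (g (last cs) c) \<subseteq> {p (last cs)}"
    proof -
      have "path_image (g (cs ! i) (cs ! Suc i)) \<inter> path_image (g (last cs) c) \<subseteq> {p (last cs)}" if i: "Suc i < ?n" for i
      proof -
        have "c \<notin> {cs ! i, cs ! Suc i}" using snoc.prems(1) i by (auto dest: nth_mem)
        then have "{cs ! i, cs ! Suc i} \<inter> {last cs, c} \<subseteq> {last cs}" "{cs ! i, cs ! Suc i} \<noteq> {last cs, c}" by auto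
        then have "p ` ({cs ! i, cs ! Suc i} \<inter> {last cs, c}) \<subseteq> p ` {last cs}"
          "{cs ! i, cs ! Suc i} \<noteq> {last cs, c}" by (auto simp only: image_mono)
        then show ?thesis using cross[OF e[OF i] le] by simp
      qed
      then have "\<forall>i. Suc i < ?n \<longrightarrow> path_image (g (cs ! i) (cs ! Suc i)) \<inter> path_image (g (last cs) c) \<subseteq> {p (last cs)}" by blast
      then show ?thesis unfolding \<beta>(4) subset_iff by (metis (no_types, lifting) IntE IntI UN_E mem_Collect_eq)
    qed
    then have "arc (\<beta> +++ g (last cs) c)" using \<beta> arc[OF le] by (intro arc_join) auto
    moreover have "path_image (\<beta> +++ g (last cs) c) = path_image \<beta> \<union> path_image (g (last cs) c)"
      using \<beta> arc[OF le] by (intro path_image_join) auto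
    moreover have "(\<Union>i\<in>{i. Suc i < length (cs @ [c])}. path_image (g ((cs @ [c]) ! i) ((cs @ [c]) ! Suc i)))
       = path_image \<beta> \<union> path_image (g (last cs) c)"
    proof -
      have "{i. Suc i < length (cs @ [c])} = insert (?n - 1) {i. Suc i < ?n}" using True by auto
      moreover have "(cs @ [c]) ! (?n - 1) = last cs" "(cs @ [c]) ! Suc (?n - 1) = c"
        using True ne by (auto simp: nth_append last_conv_nth)
      moreover have "(\<Union>i\<in>{i. Suc i < ?n}. path_image (g ((cs @ [c]) ! i) ((cs @ [c]) ! Suc i))) = path_image \<beta>"
        unfolding \<beta>(4) by (intro SUP_cong) (auto simp: nth_append)
      ultimately show ?thesis by (simp add: Un_commute)
    qed
    ultimately show ?thesis using \<beta> arc[OF le] ne by (intro exI[of _ "\<beta> +++ g (last cs) c"]) auto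
  qed
qed

end

section \<open>Oriented drawings of planar graphs and the excluded cycle\<close>

lemma simple_graph_edge:
  assumes "simple_graph G" "{a, b} \<in> edges G"
  shows "a \<in> verts G \<and> b \<in> verts G \<and> a \<noteq> b"
proof -
  have "{a, b} \<in> {{u, v} | u v. u \<in> verts G \<and> v \<in> verts G \<and> u \<noteq> v}"
    using assms unfolding simple_graph_def by blast
  then show ?thesis by (auto simp: doubleton_eq_iff)
qed

lemma planar_drawing:
  assumes G: "simple_graph G" "planar G"
  obtains p g where "drawing (verts G) (edges G) p g"
proof -
  have "\<exists>p g. drawing (verts G) (edges G) p g"
    using G(2) unfolding planar_def
  proof (elim exE conjE)
    fix p :: "nat \<Rightarrow> complex" and \<gamma> :: "nat set \<Rightarrow> real \<Rightarrow> complex"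
    assume inj: "inj_on p (verts G)"
      and e: "\<forall>e\<in>edges G. \<exists>u v. e = {u, v} \<and> arc (\<gamma> e) \<and> pathstart (\<gamma> e) = p u \<and>
          pathfinish (\<gamma> e) = p v \<and> path_image (\<gamma> e) \<inter> p ` verts G = {p u, p v}"
      and cr: "\<forall>e\<in>edges G. \<forall>e'\<in>edges G. e \<noteq> e' \<longrightarrow>
          path_image (\<gamma> e) \<inter> path_image (\<gamma> e') \<subseteq> p ` (e \<inter> e')"
    define g where "g a b = (if pathstart (\<gamma> {a, b}) = p a then \<gamma> {a, b} else reversepath (\<gamma> {a, b}))" for a b
    have im: "path_image (g a b) = path_image (\<gamma> {a, b})" for a b unfolding g_def by simp
    have ends: "path_image (g a b) \<inter> p ` verts G = {p a, p b} \<and>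
        arc (g a b) \<and> pathstart (g a b) = p a \<and> pathfinish (g a b) = p b" if ab: "{a, b} \<in> edges G" for a b
      using bspec[OF e ab]
    proof (elim exE conjE)
      fix u v assume uv: "{a, b} = {u, v}" "arc (\<gamma> {a, b})" "pathstart (\<gamma> {a, b}) = p u"
          "pathfinish (\<gamma> {a, b}) = p v" "path_image (\<gamma> {a, b}) \<inter> p ` verts G = {p u, p v}"
      have "u = a \<and> v = b \<or> u = b \<and> v = a" using uv(1) by (auto simp: doubleton_eq_iff)
      then show ?thesis
      proof (elim disjE conjE)
        assume "u = a" "v = b"
        then show ?thesis using uv(2-5) unfolding im by (simp add: g_def)
      next
        assume "u = b" "v = a"
        then show ?thesis using uv(2-5) unfolding im
          by (cases "p a = p b") (simp_all add: g_def arc_reversepath insert_commute)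
      qed
    qed
    have "drawing (verts G) (edges G) p g"
    proof
      fix a b c d assume "{a, b} \<in> edges G" "{c, d} \<in> edges G" "{a, b} \<noteq> {c, d}"
      then show "path_image (g a b) \<inter> path_image (g c d) \<subseteq> p ` ({a, b} \<inter> {c, d})"
        unfolding im using cr by simp
    qed (use inj ends simple_graph_edge[OF G(1)] in simp_all)
    then show ?thesis by blast
  qed
  then show ?thesis using that by (elim exE)
qed

text \<open>The cycle is a Jordan curve with \<open>u\<close>, \<open>w\<close> and \<open>v\<close> on the same side. The other side then
  acts as a third vertex joined to three vertices of the cycle.\<close>
lemma (in drawing) no_cycle:
  assumes cs: "distinct cs" "length cs \<ge> 3" "\<And>i. Suc i < length cs \<Longrightarrow> {cs ! i, cs ! Suc i} \<in> E"
    and cl: "{last cs, hd cs} \<in> E"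
    and uv: "u \<noteq> v" "u \<notin> set cs" "v \<notin> set cs"
    and hub: "\<And>c. c \<in> set cs \<Longrightarrow> {u, c} \<in> E \<and> {c, v} \<in> E"
    and w: "w \<notin> set cs" "{u, w} \<in> E" "{w, v} \<in> E"
  shows False
proof -
  obtain \<beta> where \<beta>: "arc \<beta>" "pathstart \<beta> = p (hd cs)" "pathfinish \<beta> = p (last cs)"
    "path_image \<beta> = (\<Union>i\<in>{i. Suc i < length cs}. path_image (g (cs ! i) (cs ! Suc i)))"
    using path_arc[OF cs(1) _ cs(3)] cs(2) by auto
  let ?n = "length cs"
  let ?e = "g (last cs) (hd cs)"
  let ?J = "path_image \<beta> \<union> path_image ?e"
  have ne: "cs \<noteq> []" using cs(2) by auto
  have hdl: "hd cs = cs ! 0" "last cs = cs ! (?n - 1)" using ne by (simp_all add: hd_conv_nth last_conv_nth)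
  have "path_image \<beta> \<inter> path_image ?e \<subseteq> {p (last cs), p (hd cs)}"
  proof -
    have "path_image (g (cs ! i) (cs ! Suc i)) \<inter> path_image ?e \<subseteq> {p (last cs), p (hd cs)}" if i: "Suc i < ?n" for i
    proof -
      \<comment> \<open>Here the length at least 3 enters: on two vertices the closing edge would be
        the path edge itself.\<close>
      have "{cs ! i, cs ! Suc i} \<noteq> {last cs, hd cs}"
        using cs(1,2) i nth_eq_iff_index_eq[OF cs(1), of i "?n - 1"] nth_eq_iff_index_eq[OF cs(1), of i 0]
          nth_eq_iff_index_eq[OF cs(1), of "Suc i" "?n - 1"] nth_eq_iff_index_eq[OF cs(1), of "Suc i" 0]
        unfolding hdl doubleton_eq_iff by linarith
      then have "path_image (g (cs ! i) (cs ! Suc i)) \<inter> path_image ?e \<subseteq> p ` ({cs ! i, cs ! Suc i} \<inter> {last cs, hd cs})"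
        by (rule cross[OF cs(3)[OF i] cl])
      also have "\<dots> \<subseteq> {p (last cs), p (hd cs)}" by auto
      finally show ?thesis .
    qed
    then have "\<forall>i. Suc i < ?n \<longrightarrow> path_image (g (cs ! i) (cs ! Suc i)) \<inter> path_image ?e \<subseteq> {p (last cs), p (hd cs)}" by blast
    then show ?thesis unfolding \<beta>(4) subset_iff by (metis (no_types, lifting) IntE IntI UN_E mem_Collect_eq)
  qed
  then have "simple_path (\<beta> +++ ?e)" using \<beta> arc[OF cl] by (intro simple_path_join_loop) auto
  moreover have im: "path_image (\<beta> +++ ?e) = ?J" using \<beta> arc[OF cl] by (intro path_image_join) auto
  moreover have "pathfinish (\<beta> +++ ?e) = pathstart (\<beta> +++ ?e)" using \<beta> arc[OF cl] by simp
  moreover have csV: "c \<in> V" if "c \<in> set cs" for c using hub[OF that] edge by blast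
  have uV: "u \<in> V" "v \<in> V" "w \<in> V" using w edge by blast+
  have wuv: "w \<noteq> u" "w \<noteq> v" using w edge by blast+
  \<comment> \<open>An edge with an end off the cycle meets the curve only in its own ends on the
    cycle.\<close>
  have Jp: "path_image (g a b) \<inter> ?J \<subseteq> p ` ({a, b} \<inter> set cs)" if ab: "{a, b} \<in> E" "\<not> {a, b} \<subseteq> set cs" for a b
  proof -
    have "path_image (g a b) \<inter> path_image (g (cs ! i) (cs ! Suc i)) \<subseteq> p ` ({a, b} \<inter> set cs)" if i: "Suc i < ?n" for i
    proof -
      have m: "{cs ! i, cs ! Suc i} \<subseteq> set cs" using i by auto
      then have "{a, b} \<noteq> {cs ! i, cs ! Suc i}" using ab(2) by metis
      then show ?thesis
        by (rule order_trans[OF cross[OF ab(1) cs(3)[OF i]] image_mono]) (use m in auto)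
    qed
    moreover have "path_image (g a b) \<inter> path_image ?e \<subseteq> p ` ({a, b} \<inter> set cs)"
    proof -
      have m: "{last cs, hd cs} \<subseteq> set cs" using ne by auto
      then have "{a, b} \<noteq> {last cs, hd cs}" using ab(2) by metis
      then show ?thesis
        by (rule order_trans[OF cross[OF ab(1) cl] image_mono]) (use m in auto)
    qed
    ultimately show ?thesis unfolding \<beta>(4) Int_Un_distrib Int_UN_distrib by (intro Un_least UN_least) auto
  qed
  have pc: "p c \<in> ?J" if c: "c \<in> set cs" for c
  proof -
    obtain i where i: "i < ?n" "cs ! i = c" using c by (auto simp: in_set_conv_nth)
    show ?thesis
    proof (cases "Suc i < ?n")
      case True then show ?thesis using ends(1)[OF cs(3)[OF True]] i \<beta>(4) by blast
    next
      case False
      then have "i = ?n - 1" using i by simp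
      then show ?thesis using ends(1)[OF cl] i hdl by auto
    qed
  qed
  have uJ: "p u \<notin> ?J"
    using Jp[of u w] w uv p_eq uV ends(1)[of u w] csV by auto
  ultimately obtain S F where SF: "S \<union> F = - ?J" "S \<inter> F = {}" "connected S" "connected F" "p u \<in> S" "F \<noteq> {}"
    "frontier S = ?J" "frontier F = ?J" "open S" "open F"
    using jordan_sides[of "\<beta> +++ ?e" "p u"] by (metis im)
  have con: "connected (path_image (g a b))" if "{a, b} \<in> E" for a b
    using arc[OF that] by (simp add: connected_arc_image)
  \<comment> \<open>Both edges at \<open>w\<close> avoid the curve, so \<open>u\<close>,
    \<open>w\<close> and \<open>v\<close> lie on one side.\<close>
  have "path_image (g u w) \<subseteq> S"
    using connected_in_side[OF SF(1,2,9,10) con[OF w(2)]] Jp[OF w(2)] w(1) uv ends(1)[OF w(2)] SF(5) by blast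
  then have "p w \<in> S" using ends(2)[OF w(2)] by blast
  then have "path_image (g w v) \<subseteq> S"
    using connected_in_side[OF SF(1,2,9,10) con[OF w(3)]] Jp[OF w(3)] w(1) uv ends(1)[OF w(3)] by blast
  then have vS: "p v \<in> S" using ends(2)[OF w(3)] by blast
  have open_arc: "path_image (g a b) \<subseteq> S \<union> {p b}" if ab: "{a, b} \<in> E" "a \<notin> set cs" "b \<in> set cs" "p a \<in> S" for a b
  proof -
    have A: "arc (g a b)" "pathstart (g a b) = p a" "pathfinish (g a b) = p b" using arc[OF ab(1)] by auto
    have "connected (path_image (g a b) - {p b})" using connected_arc_minus_finish[of "g a b"] A by simp
    moreover have "(path_image (g a b) - {p b}) \<inter> ?J = {}" using Jp[OF ab(1)] ab by blast
    moreover have "p a \<in> path_image (g a b) - {p b}"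
      using ends(1)[OF ab(1)] edge[OF ab(1)] p_eq by blast
    ultimately have "path_image (g a b) - {p b} \<subseteq> S"
      using connected_in_side[OF SF(1,2,9,10)] ab(4) by blast
    then show ?thesis by blast
  qed
  \<comment> \<open>A point of the opposite side plays the third vertex. Every vertex of the cycle
    is a frontier point of \<open>F\<close>, so adding it to \<open>F\<close> keeps the set
    connected; and the arc from \<open>u\<close> to \<open>v\<close> through a cycle vertex stays in
    \<open>S\<close> except at that vertex, so it does not meet \<open>F\<close>. Three cycle
    vertices give the theta curve.\<close>
  obtain q where q: "q \<in> F" using SF(6) by blast
  let ?b = "\<lambda>i. cs ! i"
  let ?\<alpha> = "\<lambda>i. g u (?b i) +++ g (?b i) v"
  have bc: "?b i \<in> set cs" if "i < 3" for i using that cs(2) by auto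
  have "inj_on ?b {..<3}" using cs(1,2) by (intro inj_onI) (auto simp: nth_eq_iff_index_eq)
  then have th: "theta_arcs ?\<alpha> (p u) (p v)" using theta_via[OF uv(1)] hub bc by blast
  have im: "path_image (?\<alpha> i) \<subseteq> S \<union> {p (?b i)}" "p (?b i) \<in> path_image (?\<alpha> i)" if "i < 3" for i
  proof -
    have h: "{u, ?b i} \<in> E" "{?b i, v} \<in> E" "{v, ?b i} \<in> E" using hub[OF bc[OF that]] by (auto simp: insert_commute)
    have I: "path_image (?\<alpha> i) = path_image (g u (?b i)) \<union> path_image (g (?b i) v)" using arc_via(4)[OF h(1,2) uv(1)] .
    have "path_image (g (?b i) v) \<subseteq> S \<union> {p (?b i)}"
    proof -
      have A: "arc (g (?b i) v)" "pathstart (g (?b i) v) = p (?b i)" "pathfinish (g (?b i) v) = p v" using arc[OF h(2)] by auto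
      have c: "connected (path_image (g (?b i) v) - {p (?b i)})"
        using connected_arc_minus_finish[of "reversepath (g (?b i) v)"] A by (simp add: arc_reversepath)
      have d: "(path_image (g (?b i) v) - {p (?b i)}) \<inter> ?J = {}" using Jp[OF h(2)] uv by blast
      have "p v \<in> path_image (g (?b i) v) - {p (?b i)}" using ends(2)[OF h(2)] edge[OF h(2)] p_eq by blast
      then show ?thesis using connected_in_side[OF SF(1,2,9,10) c d] vS by blast
    qed
    moreover have "path_image (g u (?b i)) \<subseteq> S \<union> {p (?b i)}" using open_arc[OF h(1) uv(2) bc[OF that] SF(5)] .
    ultimately show "path_image (?\<alpha> i) \<subseteq> S \<union> {p (?b i)}" using I by blast
    show "p (?b i) \<in> path_image (?\<alpha> i)" unfolding I using ends(2)[OF h(1)] by blast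
  qed
  show False
  proof (rule theta_no_common_point[OF th, of "\<lambda>i. insert (p (?b i)) F" q "\<lambda>i. p (?b i)"])
    fix i :: nat assume i: "i < 3"
    have "p (?b i) \<in> closure F" using pc[OF bc[OF i]] SF(8) by (auto simp: frontier_def)
    then have "connected (insert (p (?b i)) F)"
      using connected_intermediate_closure[OF SF(4)] closure_subset[of F] by blast
    moreover have "F \<inter> path_image (?\<alpha> j) = {}" if "j < 3" for j
      using im(1)[OF that] SF(1,2) pc[OF bc[OF that]] by blast
    then have "F \<inter> (\<Union>j<3. path_image (?\<alpha> j)) = {}" by blast
    moreover have "p (?b i) \<in> (\<Union>j<3. path_image (?\<alpha> j))" using im(2)[OF i] i by blast
    ultimately show "connected (insert (p (?b i)) F) \<and> q \<in> insert (p (?b i)) F \<and> p (?b i) \<in> insert (p (?b i)) F \<and>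
        insert (p (?b i)) F \<inter> (\<Union>j<3. path_image (?\<alpha> j)) = {p (?b i)}"
      using q by (simp add: Int_insert_left)
    have "p (?b i) \<notin> S" using pc[OF bc[OF i]] SF(1) by blast
    then have "p (?b i) \<noteq> p u" "p (?b i) \<noteq> p v" using SF(5) vS by metis+
    then show "p (?b i) \<in> path_image (?\<alpha> i) - {p u, p v}"
      using im(2)[OF i] by simp
  next
    have "q \<notin> path_image (?\<alpha> j)" if "j < 3" for j
    proof -
      have "q \<notin> S" "q \<notin> ?J" using q SF(1,2) by blast+
      then have "q \<notin> S \<union> {p (?b j)}" using pc[OF bc[OF that]] by auto
      then show ?thesis using im(1)[OF that] by (meson subsetD)
    qed
    then show "q \<notin> (\<Union>j<3. path_image (?\<alpha> j))" by blast
  qed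
qed

section \<open>Spectral radius and quadratic forms\<close>

definition qform :: "(nat \<Rightarrow> nat \<Rightarrow> real) \<Rightarrow> nat set \<Rightarrow> (nat \<Rightarrow> real) \<Rightarrow> real" where
  "qform A V x = (\<Sum>u\<in>V. \<Sum>w\<in>V. A u w * x u * x w)"

definition nsq :: "nat set \<Rightarrow> (nat \<Rightarrow> real) \<Rightarrow> real" where
  "nsq V x = (\<Sum>u\<in>V. (x u)\<^sup>2)"

lemma nsq_nonneg: "nsq V x \<ge> 0"
  unfolding nsq_def by (intro sum_nonneg) auto

lemma nsq_pos: "finite V \<Longrightarrow> v \<in> V \<Longrightarrow> x v \<noteq> 0 \<Longrightarrow> nsq V x > 0"
  unfolding nsq_def by (rule sum_pos2[of _ v]) auto

lemma qform_scale: "qform A V (\<lambda>u. c * x u) = c\<^sup>2 * qform A V x"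
  unfolding qform_def sum_distrib_left by (intro sum.cong refl) (simp add: power2_eq_square)

lemma nsq_scale: "nsq V (\<lambda>u. c * x u) = c\<^sup>2 * nsq V x"
  unfolding nsq_def sum_distrib_left by (intro sum.cong refl) (simp add: power_mult_distrib)

lemma qform_eigen:
  assumes "\<And>u. u \<in> V \<Longrightarrow> (\<Sum>w\<in>V. A u w * x w) = mu * x u"
  shows "qform A V x = mu * nsq V x"
proof -
  have "qform A V x = (\<Sum>u\<in>V. x u * (\<Sum>w\<in>V. A u w * x w))"
    unfolding qform_def by (simp add: sum_distrib_left mult_ac)
  also have "\<dots> = (\<Sum>u\<in>V. x u * (mu * x u))" using assms by (intro sum.cong) auto
  finally show ?thesis unfolding nsq_def by (simp add: sum_distrib_left power2_eq_square mult_ac)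
qed

lemma rayleigh_attained:
  assumes fin: "finite V" and ne: "V \<noteq> {}"
  shows "\<exists>x. nsq V x = 1 \<and> (\<forall>y. qform A V y \<le> qform A V x * nsq V y)"
proof -
  \<comment> \<open>Vectors are functions on all of \<open>nat\<close>. Setting them to 0 off
    \<open>V\<close> makes \<open>B\<close> a product of compact sets, hence compact by Tychonoff's
    theorem, and the unit sphere \<open>S\<close> is closed in it.\<close>
  define B where "B = PiE (UNIV :: nat set) (\<lambda>i. if i \<in> V then {-1..1::real} else {0})"
  define S where "S = B \<inter> {x. nsq V x = 1}"
  have "compactin (product_topology (\<lambda>i. euclidean) UNIV) B"
    unfolding B_def by (subst compactin_PiE) auto
  then have "compact B" by (simp add: euclidean_product_topology)
  moreover have cn: "continuous_on UNIV (\<lambda>x. nsq V x)"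
    unfolding nsq_def by (intro continuous_intros) simp
  then have "closed {x. nsq V x = 1}"
    using closed_Collect_eq[OF cn continuous_on_const[of UNIV 1]] by simp
  ultimately have cS: "compact S" unfolding S_def by (rule compact_Int_closed)
  obtain v where v: "v \<in> V" using ne by blast
  have "(\<lambda>i. if i = v then 1 else 0) \<in> S"
    using v fin unfolding S_def B_def nsq_def by (auto simp: if_distrib[of "\<lambda>z. z\<^sup>2"] cong: if_cong)
  then have neS: "S \<noteq> {}" by blast
  have "continuous_on UNIV (\<lambda>x. qform A V x)"
    unfolding qform_def by (intro continuous_intros) simp_all
  then have "continuous_on S (\<lambda>x. qform A V x)" by (rule continuous_on_subset) simp
  from continuous_attains_sup[OF cS neS this] obtain x where x: "x \<in> S" "\<And>y. y \<in> S \<Longrightarrow> qform A V y \<le> qform A V x" by blast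
  have "qform A V y \<le> qform A V x * nsq V y" for y
  proof (cases "nsq V y = 0")
    case True
    then have "\<forall>u\<in>V. y u = 0" using fin unfolding nsq_def by (simp add: sum_nonneg_eq_0_iff)
    then show ?thesis using True unfolding qform_def by simp
  next
    case False
    define c where "c = 1 / sqrt (nsq V y)"
    have p: "nsq V y > 0" using False nsq_nonneg[of V y] by simp
    have c2: "c\<^sup>2 * nsq V y = 1" using p unfolding c_def by (simp add: power_divide)
    define z where "z i = (if i \<in> V then c * y i else 0)" for i
    have nz: "nsq V z = 1" using nsq_scale[of V c y] c2 unfolding nsq_def z_def by simp
    have "\<bar>z i\<bar> \<le> 1" if "i \<in> V" for i
    proof -
      have "(z i)\<^sup>2 \<le> nsq V z" unfolding nsq_def using fin that by (intro member_le_sum) auto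
      then show ?thesis using nz abs_le_square_iff[of "z i" 1] by simp
    qed
    then have "z \<in> S" using nz unfolding S_def B_def by (auto simp: z_def abs_le_iff)
    then have "qform A V z \<le> qform A V x" by (rule x(2))
    moreover have "qform A V z = c\<^sup>2 * qform A V y"
      unfolding qform_scale[symmetric] unfolding qform_def z_def by simp
    ultimately have "c\<^sup>2 * qform A V y * nsq V y \<le> qform A V x * nsq V y" using p by (simp add: mult_right_mono)
    then show ?thesis using c2 by (metis mult.assoc mult.commute mult_1)
  qed
  moreover have "nsq V x = 1" using x(1) unfolding S_def by simp
  ultimately show ?thesis by blast
qed

lemma quadratic_nonneg_linear_zero:
  fixes b c :: real
  assumes "\<And>t. 0 \<le> 2 * t * b + t\<^sup>2 * c"
  shows "b = 0"
proof (rule ccontr)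
  assume b: "b \<noteq> 0"
  \<comment> \<open>At t = -b / d the expression equals b^2 * (c - 2 * d) / d^2, which is negative
    for nonzero b because c < 2 * d.\<close>
  define d where "d = max c 1"
  have d: "d > 0" "c < 2 * d" unfolding d_def by auto
  have "0 \<le> 2 * (-b/d) * b + (-b/d)\<^sup>2 * c" by (rule assms)
  then have "0 \<le> (2 * (-b/d) * b + (-b/d)\<^sup>2 * c) * d\<^sup>2" by simp
  also have "\<dots> = b\<^sup>2 * (c - 2 * d)" using d by (simp add: field_simps power2_eq_square)
  finally show False using b d by (simp add: zero_le_mult_iff)
qed

lemma sum_indicator_mult:
  fixes f :: "nat \<Rightarrow> real"
  assumes "finite V" "u \<in> V"
  shows "(\<Sum>i\<in>V. f i * (if i = u then 1 else 0)) = f u"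
  using assms by (simp add: if_distrib cong: if_cong)

text \<open>The difference of \<open>mu\<close> times \<open>nsq\<close> and \<open>qform\<close> is
  nonnegative and vanishes at \<open>x\<close>. Moving \<open>x\<close> by t along the unit vector
  of \<open>u\<close> makes it a quadratic polynomial in t without constant term, so its linear
  coefficient, the defect of the eigenvalue equation at \<open>u\<close>, must be zero.\<close>

lemma maximiser_eigenvector:
  assumes fin: "finite V" and sym: "\<And>u w. A u w = A w u"
    and le: "\<And>y. qform A V y \<le> mu * nsq V y" and eq: "qform A V x = mu * nsq V x"
    and u: "u \<in> V"
  shows "(\<Sum>w\<in>V. A u w * x w) = mu * x u"
proof -
  let ?e = "\<lambda>i. if i = u then 1 else 0 :: real"
  let ?Ax = "\<Sum>w\<in>V. A u w * x w"
  have "0 \<le> 2 * t * (mu * x u - ?Ax) + t\<^sup>2 * (mu - A u u)" for t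
  proof -
    let ?y = "\<lambda>i. x i + t * ?e i"
    have 1: "nsq V ?y = nsq V x + 2 * t * x u + t\<^sup>2"
    proof -
      have "nsq V ?y = (\<Sum>i\<in>V. (x i)\<^sup>2 + (2 * t * x i * ?e i + t\<^sup>2 * ?e i))"
        unfolding nsq_def by (intro sum.cong) (auto simp: power2_eq_square algebra_simps)
      also have "\<dots> = nsq V x + 2 * t * x u + t\<^sup>2"
        unfolding nsq_def by (simp only: sum.distrib sum_indicator_mult[OF fin u] add.assoc)
      finally show ?thesis .
    qed
    have 2: "qform A V ?y = qform A V x + 2 * t * ?Ax + t\<^sup>2 * A u u"
    proof -
      have r: "(\<Sum>w\<in>V. A i w * (x w + t * ?e w)) = (\<Sum>w\<in>V. A i w * x w) + t * A i u" for i
      proof -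
        have "(\<Sum>w\<in>V. A i w * (x w + t * ?e w)) = (\<Sum>w\<in>V. A i w * x w + t * (A i w * ?e w))"
          by (intro sum.cong refl) (simp only: algebra_simps)
        then show ?thesis by (simp only: sum.distrib sum_distrib_left[symmetric] sum_indicator_mult[OF fin u])
      qed
      have "qform A V ?y = (\<Sum>i\<in>V. (x i + t * ?e i) * (\<Sum>w\<in>V. A i w * (x w + t * ?e w)))"
        unfolding qform_def sum_distrib_left by (intro sum.cong refl) (simp only: mult_ac)
      also have "\<dots> = (\<Sum>i\<in>V. x i * (\<Sum>w\<in>V. A i w * x w) + t * (A u i * x i) + t * (((\<Sum>w\<in>V. A i w * x w) + t * A i u) * ?e i))"
        unfolding r by (intro sum.cong refl) (simp only: sym[of u] algebra_simps)
      also have "\<dots> = (\<Sum>i\<in>V. x i * (\<Sum>w\<in>V. A i w * x w)) + t * ?Ax + t * (?Ax + t * A u u)"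
        by (simp only: sum.distrib sum_distrib_left[symmetric] sum_indicator_mult[OF fin u])
      also have "(\<Sum>i\<in>V. x i * (\<Sum>w\<in>V. A i w * x w)) = qform A V x"
        unfolding qform_def sum_distrib_left by (intro sum.cong refl) (simp only: mult_ac)
      finally show ?thesis by (simp add: power2_eq_square algebra_simps)
    qed
    show ?thesis using le[of ?y] unfolding 1 2 eq by (simp add: algebra_simps)
  qed
  then have "mu * x u - ?Ax = 0" by (rule quadratic_nonneg_linear_zero)
  then show ?thesis by simp
qed

section \<open>Finiteness of the set of eigenvalues\<close>

lemma eigenvectors_orthogonal:
  assumes sym: "\<And>u w. A u w = A w u"
    and x: "\<And>u. u \<in> V \<Longrightarrow> (\<Sum>w\<in>V. A u w * x w) = a * x u"
    and y: "\<And>u. u \<in> V \<Longrightarrow> (\<Sum>w\<in>V. A u w * y w) = b * y u"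
    and "a \<noteq> b"
  shows "(\<Sum>u\<in>V. x u * y u) = (0::real)"
proof -
  have "a * (\<Sum>u\<in>V. x u * y u) = (\<Sum>u\<in>V. (\<Sum>w\<in>V. A u w * x w) * y u)"
    unfolding sum_distrib_left using x by (intro sum.cong) auto
  also have "\<dots> = (\<Sum>u\<in>V. \<Sum>w\<in>V. A u w * x w * y u)" by (simp add: sum_distrib_right)
  also have "\<dots> = (\<Sum>w\<in>V. \<Sum>u\<in>V. A u w * x w * y u)" by (rule sum.swap)
  also have "\<dots> = (\<Sum>w\<in>V. x w * (\<Sum>u\<in>V. A w u * y u))"
    unfolding sum_distrib_left using sym by (intro sum.cong refl) (simp add: mult_ac)
  also have "\<dots> = (\<Sum>w\<in>V. x w * (b * y w))" using y by simp
  also have "\<dots> = b * (\<Sum>u\<in>V. x u * y u)" by (simp add: sum_distrib_left mult_ac)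
  finally have "(a - b) * (\<Sum>u\<in>V. x u * y u) = 0" by (simp add: algebra_simps)
  then show ?thesis using assms(4) by simp
qed

text \<open>Since \<open>spectral_radius\<close> is a \<open>Max\<close>, it has its meaning only
  over a finite set. Unit eigenvectors of distinct eigenvalues are orthonormal; Bessel's inequality
  for every standard basis vector, summed over \<open>V\<close>, bounds their number by the size of
  \<open>V\<close>.\<close>

lemma finite_eigenvalues:
  fixes A :: "nat \<Rightarrow> nat \<Rightarrow> real"
  assumes fin: "finite V" and sym: "\<And>u w. A u w = A w u"
  shows "finite {mu::real. \<exists>x. (\<exists>v\<in>V. x v \<noteq> 0) \<and> (\<forall>u\<in>V. (\<Sum>w\<in>V. A u w * x w) = mu * x u)}"
    (is "finite ?M")
proof (rule conjunct1[OF finite_if_finite_subsets_card_bdd[of _ "card V"]])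
  fix F assume F: "F \<subseteq> ?M" "finite F"
  have "\<exists>x. nsq V x = 1 \<and> (\<forall>u\<in>V. (\<Sum>w\<in>V. A u w * x w) = mu * x u)" if "mu \<in> F" for mu
  proof -
    have "mu \<in> ?M" using subsetD[OF F(1) that] .
    then obtain x where "\<exists>v\<in>V. x v \<noteq> 0" and xe: "\<forall>u\<in>V. (\<Sum>w\<in>V. A u w * x w) = mu * x u" by auto
    then obtain v where x: "v \<in> V" "x v \<noteq> 0" "\<And>u. u \<in> V \<Longrightarrow> (\<Sum>w\<in>V. A u w * x w) = mu * x u" by auto
    let ?c = "1 / sqrt (nsq V x)"
    have "nsq V x > 0" by (rule nsq_pos[of V v x, OF fin x(1,2)])
    then have "nsq V (\<lambda>u. ?c * x u) = 1" unfolding nsq_scale by (simp add: power_divide)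
    moreover have "(\<Sum>w\<in>V. A u w * (?c * x w)) = mu * (?c * x u)" if "u \<in> V" for u
    proof -
      have "(\<Sum>w\<in>V. A u w * (?c * x w)) = ?c * (\<Sum>w\<in>V. A u w * x w)" by (simp add: sum_distrib_left mult_ac)
      then show ?thesis using x(3)[OF that] by (simp add: mult_ac)
    qed
    ultimately show ?thesis by blast
  qed
  then obtain X where X: "\<And>mu. mu \<in> F \<Longrightarrow> nsq V (X mu) = 1"
    "\<And>mu u. mu \<in> F \<Longrightarrow> u \<in> V \<Longrightarrow> (\<Sum>w\<in>V. A u w * X mu w) = mu * X mu u" by metis
  have orth: "(\<Sum>w\<in>V. X a w * X b w) = (if a = b then 1 else 0)" if "a \<in> F" "b \<in> F" for a b
  proof (cases "a = b")
    case True
    then show ?thesis using X(1)[OF that(1)] unfolding nsq_def by (simp add: power2_eq_square)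
  next
    case False
    then show ?thesis
      using eigenvectors_orthogonal[of A V "X a" a "X b" b, OF sym X(2)[OF that(1)] X(2)[OF that(2)]] by simp
  qed
  \<comment> \<open>Bessel's inequality for the unit vector \<open>?d\<close> at \<open>v\<close>;
    \<open>?p\<close> is its projection to the span of the eigenvectors.\<close>
  have bessel: "(\<Sum>mu\<in>F. (X mu v)\<^sup>2) \<le> 1" if v: "v \<in> V" for v
  proof -
    let ?s = "\<Sum>mu\<in>F. (X mu v)\<^sup>2"
    let ?p = "\<lambda>w. \<Sum>mu\<in>F. X mu v * X mu w"
    let ?d = "\<lambda>w. if w = v then 1 else 0 :: real"
    have "0 \<le> (\<Sum>w\<in>V. (?d w - ?p w)\<^sup>2)" by (intro sum_nonneg) auto
    also have "\<dots> = (\<Sum>w\<in>V. ?d w - 2 * (?d w * ?p w) + ?p w * ?p w)"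
      by (intro sum.cong) (auto simp: power2_eq_square algebra_simps)
    also have "\<dots> = 1 - 2 * ?p v + (\<Sum>w\<in>V. ?p w * ?p w)"
    proof -
      have "(\<Sum>w\<in>V. ?d w) = 1" using sum_indicator_mult[OF fin v, of "\<lambda>_. 1"] by simp
      moreover have "(\<Sum>w\<in>V. ?d w * ?p w) = ?p v"
        using sum_indicator_mult[OF fin v, of ?p] by (simp only: mult.commute)
      ultimately show ?thesis by (simp only: sum.distrib sum_subtractf sum_distrib_left[symmetric])
    qed
    also have "(\<Sum>w\<in>V. ?p w * ?p w) = (\<Sum>w\<in>V. \<Sum>a\<in>F. \<Sum>b\<in>F. (X a v * X b v) * (X a w * X b w))"
      unfolding sum_product by (intro sum.cong) (auto simp: mult_ac)
    also have "\<dots> = (\<Sum>a\<in>F. \<Sum>w\<in>V. \<Sum>b\<in>F. (X a v * X b v) * (X a w * X b w))" by (rule sum.swap)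
    also have "\<dots> = (\<Sum>a\<in>F. \<Sum>b\<in>F. \<Sum>w\<in>V. (X a v * X b v) * (X a w * X b w))"
      by (intro sum.cong refl sum.swap)
    also have "\<dots> = (\<Sum>a\<in>F. \<Sum>b\<in>F. (X a v * X b v) * (if a = b then 1 else 0))"
      using orth by (intro sum.cong refl) (simp add: sum_distrib_left[symmetric])
    also have "\<dots> = ?s" using F(2) by (simp add: if_distrib power2_eq_square cong: if_cong)
    finally show ?thesis by (simp add: power2_eq_square)
  qed
  have "real (card F) = (\<Sum>mu\<in>F. nsq V (X mu))" using X(1) by simp
  also have "\<dots> = (\<Sum>v\<in>V. \<Sum>mu\<in>F. (X mu v)\<^sup>2)" unfolding nsq_def by (rule sum.swap)
  also have "\<dots> \<le> (\<Sum>v\<in>V. 1)" using bessel by (intro sum_mono) auto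
  finally show "card F \<le> card V" by simp
qed

lemma adj_sym: "adj G u w = adj G w u" unfolding adj_def by (simp add: insert_commute)
lemma adj_nonneg: "adj G u w \<ge> 0" unfolding adj_def by simp

text \<open>Adjacency entries are nonnegative, so replacing a maximiser by its absolute values does
  not lower the form. This gives a nonnegative maximiser, which is an eigenvector; maximality tested
  on any other eigenvector shows that its eigenvalue is the largest.\<close>

lemma spectral_radius_rayleigh:
  assumes fin: "finite (verts G)" and ne: "verts G \<noteq> {}"
  shows "qform (adj G) (verts G) y \<le> spectral_radius G * nsq (verts G) y" (is ?A)
    and "\<exists>x. (\<forall>u. x u \<ge> 0) \<and> nsq (verts G) x = 1 \<and>
      (\<forall>u\<in>verts G. (\<Sum>w\<in>verts G. adj G u w * x w) = spectral_radius G * x u)" (is ?B)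
proof -
  let ?V = "verts G" and ?q = "qform (adj G) (verts G)"
  obtain x where x: "nsq ?V x = 1" "\<And>y. ?q y \<le> ?q x * nsq ?V y"
    using rayleigh_attained[OF fin ne] by blast
  let ?x = "\<lambda>u. \<bar>x u\<bar>"
  have n: "nsq ?V ?x = 1" using x(1) unfolding nsq_def by simp
  have "?q x \<le> ?q ?x"
    unfolding qform_def
  proof (intro sum_mono)
    fix u w
    have "adj G u w * (x u * x w) \<le> adj G u w * (\<bar>x u\<bar> * \<bar>x w\<bar>)"
      by (intro mult_left_mono adj_nonneg) (metis abs_ge_self abs_mult)
    then show "adj G u w * x u * x w \<le> adj G u w * \<bar>x u\<bar> * \<bar>x w\<bar>" by (simp add: mult_ac)
  qed
  then have q: "?q ?x = ?q x" using x(2)[of ?x] n by simp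
  have e: "(\<Sum>w\<in>?V. adj G u w * ?x w) = ?q x * ?x u" if "u \<in> ?V" for u
    by (rule maximiser_eigenvector[OF fin adj_sym x(2) _ that]) (simp add: q n)
  have "\<exists>v\<in>?V. ?x v \<noteq> 0" using n unfolding nsq_def by (metis (no_types, lifting) power_zero_numeral sum.neutral zero_neq_one)
  then have mem: "is_eigenvalue G (?q x)" unfolding is_eigenvalue_def
    using e by (intro exI[of _ ?x] conjI ballI)
  have le: "mu \<le> ?q x" if mu: "is_eigenvalue G mu" for mu
  proof -
    from mu show ?thesis unfolding is_eigenvalue_def
    proof (elim exE conjE bexE)
      fix y v assume y: "v \<in> ?V" "y v \<noteq> 0" "\<forall>u\<in>?V. (\<Sum>w\<in>?V. adj G u w * y w) = mu * y u"
      have "mu * nsq ?V y = ?q y" by (rule qform_eigen[symmetric]) (rule bspec[OF y(3)])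
      also have "\<dots> \<le> ?q x * nsq ?V y" by (rule x(2))
      finally show ?thesis using nsq_pos[of ?V v y, OF fin y(1,2)] by simp
    qed
  qed
  have "finite {mu. is_eigenvalue G mu}"
    using finite_eigenvalues[OF fin, of "adj G"] adj_sym unfolding is_eigenvalue_def by simp
  then have r: "spectral_radius G = ?q x"
    unfolding spectral_radius_def using mem le by (intro Max_eqI) auto
  show ?A unfolding r by (rule x(2))
  show ?B unfolding r using e n by (intro exI[of _ ?x]) auto
qed

section \<open>Graphs with bounded path length\<close>

definition gpath :: "nat set set \<Rightarrow> nat list \<Rightarrow> bool" where
  "gpath E ps \<longleftrightarrow> distinct ps \<and> successively (\<lambda>a b. {a, b} \<in> E) ps"

definition linked :: "nat set set \<Rightarrow> nat set \<Rightarrow> (nat \<times> nat) set" where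
  "linked E S = {(a, b). a \<in> S \<and> b \<in> S \<and> {a, b} \<in> E}"

text \<open>\<open>anc v\<close> is the set of ancestors of \<open>v\<close>, including \<open>v\<close>, in a depth-first search forest.\<close>
definition dfs_ancestors :: "nat set set \<Rightarrow> nat set \<Rightarrow> nat \<Rightarrow> (nat \<Rightarrow> nat set) \<Rightarrow> bool" where
  "dfs_ancestors E S m anc \<longleftrightarrow>
     (\<forall>v\<in>S. anc v \<subseteq> S \<and> card (anc v) \<le> m \<and> v \<in> anc v) \<and>
     (\<forall>a\<in>S. \<forall>b\<in>S. {a, b} \<in> E \<longrightarrow> a \<in> anc b \<or> b \<in> anc a) \<and>
     (\<forall>v\<in>S. \<forall>a\<in>anc v. \<forall>b\<in>anc v. a \<in> anc b \<or> b \<in> anc a) \<and>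
     (\<forall>v\<in>S. \<forall>a\<in>anc v. anc a \<subseteq> anc v)"

lemma rtrancl_linked_in: "(a, b) \<in> (linked E S)\<^sup>* \<Longrightarrow> a \<in> S \<Longrightarrow> b \<in> S"
  by (induction rule: rtrancl_induct) (auto simp: linked_def)

lemma sym_linked: "sym ((linked E S)\<^sup>*)"
  by (intro sym_rtrancl) (auto simp: sym_def linked_def insert_commute)

text \<open>Induction on the number of vertices of a path that starts at the root. Each component of
  \<open>S\<close> without \<open>r\<close> contains a neighbour \<open>x\<close> of
  \<open>r\<close>, and a path from \<open>x\<close> inside it can be prolonged by \<open>r\<close>,
  so it satisfies the assumptions with root \<open>x\<close> and bound one less. The ancestor sets
  of the components then receive \<open>r\<close>. The bound on \<open>ps\<close> excludes
  \<open>r\<close>: it says that \<open>r # ps\<close> has at most \<open>m\<close> vertices, which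
  matches the bound on the ancestor sets.\<close>

lemma dfs_ancestors_rooted:
  assumes "finite S" "r \<in> S" "\<And>v. v \<in> S \<Longrightarrow> (r, v) \<in> (linked E S)\<^sup>*"
    and "\<And>ps. gpath E (r # ps) \<Longrightarrow> set ps \<subseteq> S \<Longrightarrow> length ps < m"
  shows "\<exists>anc. dfs_ancestors E S m anc \<and> (\<forall>v\<in>S. r \<in> anc v)"
  using assms
proof (induction m arbitrary: r S)
  case 0
  have "gpath E [r]" by (simp add: gpath_def)
  then show ?case using "0.prems"(4)[of "[]"] by simp
next
  case (Suc m)
  define T where "T = S - {r}"
  define R where "R = (linked E T)\<^sup>*"
  define comp where "comp v = R `` {v}" for v
  have symR: "sym R" unfolding R_def by (rule sym_linked)
  have trR: "trans R" unfolding R_def by (rule trans_rtrancl)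
  have self: "v \<in> comp v" for v unfolding comp_def R_def by simp
  have inT: "comp v \<subseteq> T" if "v \<in> T" for v
    using rtrancl_linked_in that unfolding comp_def R_def by blast
  have eq: "comp b = comp a" if "b \<in> comp a" for a b
    using that symR trR unfolding comp_def by (auto dest: symD transD)
  \<comment> \<open>After its last visit to \<open>r\<close>, a walk from \<open>r\<close> to
    \<open>v\<close> stays in one component, which it enters at a neighbour of
    \<open>r\<close>.\<close>
  have nb: "\<exists>x. x \<in> comp v \<and> {r, x} \<in> E" if v: "v \<in> T" for v
  proof -
    have "(r, v) \<in> (linked E S)\<^sup>*" using Suc.prems(3) v unfolding T_def by blast
    then have "v = r \<or> (\<exists>x. (x, v) \<in> R \<and> {r, x} \<in> E)"
    proof (induction rule: rtrancl_induct)
      case base then show ?case by simp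
    next
      case (step b c)
      have bc: "b \<in> S" "c \<in> S" "{b, c} \<in> E" using step.hyps(2) unfolding linked_def by auto
      show ?case
      proof (cases "c = r \<or> b = r")
        case True
        then show ?thesis using bc unfolding R_def by auto
      next
        case False
        then obtain x where x: "(x, b) \<in> R" "{r, x} \<in> E" using step.IH by blast
        have "(b, c) \<in> linked E T" using False bc unfolding linked_def T_def by auto
        then have "(x, c) \<in> R" using x(1) unfolding R_def by (rule rtrancl_into_rtrancl[rotated])
        then show ?thesis using x by blast
      qed
    qed
    then obtain x where "(x, v) \<in> R" "{r, x} \<in> E" using v unfolding T_def by auto
    then show ?thesis using symR unfolding comp_def by (auto dest: symD)
  qed
  have "\<exists>anc. dfs_ancestors E C m anc" if C: "C \<in> comp ` T" for C
  proof -
    obtain v where v: "v \<in> T" "C = comp v" using C by blast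
    obtain x where x: "x \<in> C" "{r, x} \<in> E" using nb[OF v(1)] v(2) by blast
    have CT: "C \<subseteq> T" using inT v by blast
    have "\<exists>anc. dfs_ancestors E C m anc \<and> (\<forall>v\<in>C. x \<in> anc v)"
    proof (rule Suc.IH)
      show "finite C" using CT Suc.prems(1) unfolding T_def by (meson finite_Diff finite_subset)
      show "x \<in> C" by fact
      fix w assume "w \<in> C"
      then have "(x, w) \<in> R" using x(1) eq[of x v] v unfolding comp_def by blast
      then show "(x, w) \<in> (linked E C)\<^sup>*"
        unfolding R_def
      proof (induction rule: rtrancl_induct)
        case base then show ?case by simp
      next
        case (step b c)
        have "b \<in> C" using rtrancl_linked_in[OF step.IH x(1)] .
        moreover have "(b, c) \<in> R" using step.hyps(2) unfolding R_def by blast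
        ultimately have "c \<in> C" using v(2) trR unfolding comp_def by (auto dest: transD)
        then have "(b, c) \<in> linked E C" using \<open>b \<in> C\<close> step.hyps(2) unfolding linked_def by auto
        then show ?case using step.IH by (rule rtrancl_into_rtrancl[rotated])
      qed
    next
      fix ps assume ps: "gpath E (x # ps)" "set ps \<subseteq> C"
      have "r \<notin> set (x # ps)" using ps(2) CT x(1) unfolding T_def by auto
      then have "gpath E (r # x # ps)" using ps(1) x(2) unfolding gpath_def by simp
      moreover have "set (x # ps) \<subseteq> S" using ps(2) CT x(1) unfolding T_def by auto
      ultimately have "length (x # ps) < Suc m" by (rule Suc.prems(4))
      then show "length ps < m" by simp
    qed
    then show ?thesis by blast
  qed
  then obtain ac where ac: "\<And>C. C \<in> comp ` T \<Longrightarrow> dfs_ancestors E C m (ac C)" by metis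
  define anc where "anc v = (if v = r then {r} else insert r (ac (comp v) v))" for v
  have D: "ac (comp v) v \<subseteq> comp v" "card (ac (comp v) v) \<le> m" "v \<in> ac (comp v) v" if "v \<in> T" for v
    using ac[of "comp v"] self[of v] that unfolding dfs_ancestors_def by blast+
  have T: "v \<in> T \<longleftrightarrow> v \<in> S \<and> v \<noteq> r" for v unfolding T_def by auto
  have ancT: "anc v = insert r (ac (comp v) v)" if "v \<in> T" for v using that T unfolding anc_def by auto
  have up: "a \<in> T \<and> comp a = comp v" if "v \<in> T" "a \<in> ac (comp v) v" for a v
    using D(1)[OF that(1)] that(2) inT[OF that(1)] eq[of a v] by blast
  have "dfs_ancestors E S (Suc m) anc"
    unfolding dfs_ancestors_def
  proof (intro conjI ballI impI)
    fix v assume v: "v \<in> S"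
    show "anc v \<subseteq> S" using v D(1)[of v] inT[of v] Suc.prems(2) T unfolding anc_def by auto
    show "card (anc v) \<le> Suc m"
      using v D(2)[of v] T card_insert_le_m1[of "Suc m" "ac (comp v) v" r] unfolding anc_def by auto
    show "v \<in> anc v" using v D(3)[of v] T unfolding anc_def by auto
    fix a assume a: "a \<in> anc v"
    show "anc a \<subseteq> anc v"
    proof (cases "a = r")
      case True then show ?thesis unfolding anc_def by auto
    next
      case False
      then have vT: "v \<in> T" and av: "a \<in> ac (comp v) v" using a v T unfolding anc_def by (auto split: if_splits)
      have "ac (comp v) a \<subseteq> ac (comp v) v"
        using ac[of "comp v"] vT av self[of v] unfolding dfs_ancestors_def by blast
      then show ?thesis using ancT up[OF vT av] vT by auto
    qed
    fix b assume b: "b \<in> anc v"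
    show "a \<in> anc b \<or> b \<in> anc a"
    proof (cases "a = r \<or> b = r")
      case True then show ?thesis unfolding anc_def by auto
    next
      case False
      then have vT: "v \<in> T" and av: "a \<in> ac (comp v) v" and bv: "b \<in> ac (comp v) v"
        using a b v T unfolding anc_def by (auto split: if_splits)
      have "a \<in> ac (comp v) b \<or> b \<in> ac (comp v) a"
        using ac[of "comp v"] vT av bv self[of v] unfolding dfs_ancestors_def by blast
      then show ?thesis using ancT up[OF vT av] up[OF vT bv] by auto
    qed
  next
    fix a b assume ab: "a \<in> S" "b \<in> S" "{a, b} \<in> E"
    show "a \<in> anc b \<or> b \<in> anc a"
    proof (cases "a = r \<or> b = r")
      case True then show ?thesis unfolding anc_def by auto
    next
      case False
      then have t: "a \<in> T" "b \<in> T" using ab T by auto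
      have "b \<in> comp a" using t ab(3) unfolding comp_def R_def by (auto simp: linked_def)
      then have c: "comp b = comp a" by (rule eq)
      have "a \<in> ac (comp a) b \<or> b \<in> ac (comp a) a"
        using ac[of "comp a"] t ab(3) self[of a] \<open>b \<in> comp a\<close> unfolding dfs_ancestors_def by blast
      then show ?thesis using ancT t c by auto
    qed
  qed
  moreover have "\<forall>v\<in>S. r \<in> anc v" unfolding anc_def by auto
  ultimately show ?case by blast
qed

text \<open>A new root joined to all vertices makes the graph connected.\<close>
lemma dfs_ancestors_exist:
  assumes fin: "finite S" and E: "\<And>a b. {a, b} \<in> E \<Longrightarrow> a \<in> S \<and> b \<in> S"
    and path: "\<And>ps. gpath E ps \<Longrightarrow> set ps \<subseteq> S \<Longrightarrow> length ps < L"
  shows "\<exists>anc. dfs_ancestors E S (L - 1) anc"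
proof -
  obtain r where r: "r \<notin> S" using fin by (metis ex_new_if_finite infinite_UNIV_nat)
  let ?E = "E \<union> (\<lambda>v. {r, v}) ` S" and ?S = "insert r S"
  have in_E: "{a, b} \<in> ?E \<longleftrightarrow> {a, b} \<in> E" if "a \<in> S" "b \<in> S" for a b
    using that r by (auto simp: doubleton_eq_iff)
  have "\<exists>anc. dfs_ancestors ?E ?S L anc \<and> (\<forall>v\<in>?S. r \<in> anc v)"
  proof (rule dfs_ancestors_rooted)
    show "finite ?S" "r \<in> ?S" using fin by auto
    show "(r, v) \<in> (linked ?E ?S)\<^sup>*" if "v \<in> ?S" for v
      using that unfolding linked_def by (cases "v = r") auto
    fix ps assume ps: "gpath ?E (r # ps)" "set ps \<subseteq> ?S"
    have S: "set ps \<subseteq> S" using ps unfolding gpath_def by auto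
    have "successively (\<lambda>a b. {a, b} \<in> ?E) ps" "distinct ps"
      using ps(1) unfolding gpath_def by (cases ps; simp)+
    then have "gpath E ps"
      unfolding gpath_def using S in_E by (auto simp: successively_conv_nth subset_eq)
    then show "length ps < L" using path S by blast
  qed
  then obtain anc where anc: "dfs_ancestors ?E ?S L anc" "\<And>v. v \<in> ?S \<Longrightarrow> r \<in> anc v" by blast
  \<comment> \<open>Every ancestor set contains the auxiliary root, so deleting it lowers the bound
    from \<open>L\<close> to \<open>L - 1\<close>.\<close>
  have "dfs_ancestors E S (L - 1) (\<lambda>v. anc v - {r})"
    unfolding dfs_ancestors_def
  proof (intro conjI ballI impI)
    fix v assume v: "v \<in> S"
    show "anc v - {r} \<subseteq> S" using anc(1) v unfolding dfs_ancestors_def by blast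
    have "card (anc v) \<le> L" "finite (anc v)" using anc(1) v fin unfolding dfs_ancestors_def
      by (blast, meson finite_insert finite_subset insertI2)
    then show "card (anc v - {r}) \<le> L - 1" using anc(2)[of v] v by simp
    show "v \<in> anc v - {r}" using anc(1) v r unfolding dfs_ancestors_def by blast
    fix a assume a: "a \<in> anc v - {r}"
    show "anc a - {r} \<subseteq> anc v - {r}" using anc(1) v a unfolding dfs_ancestors_def by blast
    fix b assume b: "b \<in> anc v - {r}"
    show "a \<in> anc b - {r} \<or> b \<in> anc a - {r}" using anc(1) v a b unfolding dfs_ancestors_def by blast
  next
    fix a b assume ab: "a \<in> S" "b \<in> S" "{a, b} \<in> E"
    then have "a \<in> anc b \<or> b \<in> anc a" using anc(1) unfolding dfs_ancestors_def by blast
    then show "a \<in> anc b - {r} \<or> b \<in> anc a - {r}" using ab r by auto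
  qed
  then show ?thesis by blast
qed

section \<open>Degree counts in the depth-first search forest\<close>

definition nbrs :: "graph \<Rightarrow> nat \<Rightarrow> nat set" where
  "nbrs G v = {w \<in> verts G. {v, w} \<in> edges G}"

locale sparse_graph =
  fixes G :: graph and h :: nat and anc :: "nat \<Rightarrow> nat set"
  assumes simple: "simple_graph G"
    and anc: "dfs_ancestors (edges G) (verts G) h anc"
    and K33: "\<And>a c d. a \<noteq> c \<Longrightarrow> a \<noteq> d \<Longrightarrow> c \<noteq> d \<Longrightarrow>
      card (nbrs G a \<inter> nbrs G c \<inter> nbrs G d) \<le> 2"
begin

abbreviation "V \<equiv> verts G"
abbreviation "N \<equiv> nbrs G"

lemma fin: "finite V" using simple unfolding simple_graph_def by simp
lemma edgeD: "{a, b} \<in> edges G \<Longrightarrow> a \<in> V \<and> b \<in> V \<and> a \<noteq> b" using simple_graph_edge[OF simple] .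
lemma fin_nbrs: "finite (N v)" unfolding nbrs_def using fin by simp
lemma nbrs_sym: "a \<in> N b \<longleftrightarrow> b \<in> N a" unfolding nbrs_def using edgeD by (auto simp: insert_commute)
lemma adj_nbrs: "u \<in> V \<Longrightarrow> adj G u w = (if w \<in> N u then 1 else 0)"
  unfolding adj_def nbrs_def using edgeD by auto
lemma sum_adj: "S \<subseteq> V \<Longrightarrow> u \<in> V \<Longrightarrow> (\<Sum>w\<in>S. adj G u w * f w) = (\<Sum>w\<in>S \<inter> N u. f w)"
  using finite_subset[OF _ fin, of S] by (auto simp: adj_nbrs sum.inter_restrict intro!: sum.cong)
lemma fin_anc: "v \<in> V \<Longrightarrow> finite (anc v)"
  using anc fin unfolding dfs_ancestors_def by (meson finite_subset)
lemma card_anc: "v \<in> V \<Longrightarrow> card (anc v) \<le> h"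
  using anc unfolding dfs_ancestors_def by blast
text \<open>Direct every edge from the descendant to the ancestor: out-degrees are at most
  \<open>h\<close>, in-degrees at most \<open>D\<close>. The inequality 2 * x u * x w \<le> \<alpha>
  * (x u)^2 + (x w)^2 / \<alpha> weighs the two ends accordingly, and the best \<alpha> would give 2
  * sqrt (h * D).\<close>

lemma qform_le_degree:
  fixes \<alpha> :: real
  assumes S: "S \<subseteq> V" and x: "\<And>v. x v \<ge> 0" and al: "\<alpha> > 0"
    and deg: "\<And>v. v \<in> S \<Longrightarrow> real (card (S \<inter> N v)) \<le> D"
  shows "qform (adj G) S x \<le> (\<alpha> * h + D / \<alpha>) * nsq S x"
proof -
  have fS: "finite S" using S fin finite_subset by blast
  define r where "r u w = (if {u, w} \<in> edges G \<and> w \<in> anc u then 1 else 0 :: real)" for u w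
  have r0: "r u w \<ge> 0" for u w unfolding r_def by simp
  have adjr: "adj G u w \<le> r u w + r w u" if "u \<in> S" "w \<in> S" for u w
  proof -
    have "{u, w} \<in> edges G \<longrightarrow> u \<in> anc w \<or> w \<in> anc u"
      using anc S that unfolding dfs_ancestors_def by blast
    then show ?thesis unfolding adj_def r_def by (auto simp: insert_commute)
  qed
  have amgm: "2 * (x u * x w) \<le> \<alpha> * (x u)\<^sup>2 + (x w)\<^sup>2 / \<alpha>" for u w
  proof -
    have "0 \<le> (\<alpha> * x u - x w)\<^sup>2 / \<alpha>" using al by simp
    also have "\<dots> = \<alpha> * (x u)\<^sup>2 + (x w)\<^sup>2 / \<alpha> - 2 * (x u * x w)"
      using al by (simp add: power2_eq_square field_simps)
    finally show ?thesis by simp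
  qed
  have out: "(\<Sum>w\<in>S. r u w) \<le> h" if u: "u \<in> S" for u
  proof -
    have "(\<Sum>w\<in>S. r u w) \<le> (\<Sum>w\<in>S. if w \<in> anc u then 1 else 0)" unfolding r_def by (intro sum_mono) auto
    also have "\<dots> = card (S \<inter> anc u)" using fS by (simp add: sum.inter_restrict[symmetric])
    also have "\<dots> \<le> card (anc u)" using fin_anc u S by (intro of_nat_mono card_mono) auto
    finally show ?thesis using card_anc[of u] u S by force
  qed
  have inn: "(\<Sum>u\<in>S. r u w) \<le> D" if w: "w \<in> S" for w
  proof -
    have "(\<Sum>u\<in>S. r u w) \<le> (\<Sum>u\<in>S. if u \<in> N w then 1 else 0)"
      unfolding r_def nbrs_def using S by (intro sum_mono) (auto simp: insert_commute)
    also have "\<dots> = card (S \<inter> N w)" using fS by (simp add: sum.inter_restrict[symmetric])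
    finally show ?thesis using deg[OF w] by simp
  qed
  have "qform (adj G) S x \<le> (\<Sum>u\<in>S. \<Sum>w\<in>S. (r u w + r w u) * (x u * x w))"
    unfolding qform_def
  proof (intro sum_mono)
    fix u w assume "u \<in> S" "w \<in> S"
    then have "adj G u w * (x u * x w) \<le> (r u w + r w u) * (x u * x w)"
      using adjr x by (intro mult_right_mono) auto
    then show "adj G u w * x u * x w \<le> (r u w + r w u) * (x u * x w)" by (simp add: mult.assoc)
  qed
  also have "\<dots> = (\<Sum>u\<in>S. \<Sum>w\<in>S. r u w * (x u * x w)) + (\<Sum>u\<in>S. \<Sum>w\<in>S. r w u * (x u * x w))"
    by (simp add: distrib_right sum.distrib)
  also have "(\<Sum>u\<in>S. \<Sum>w\<in>S. r w u * (x u * x w)) = (\<Sum>u\<in>S. \<Sum>w\<in>S. r u w * (x u * x w))"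
    by (subst sum.swap) (simp add: mult.commute)
  also have "(\<Sum>u\<in>S. \<Sum>w\<in>S. r u w * (x u * x w)) + (\<Sum>u\<in>S. \<Sum>w\<in>S. r u w * (x u * x w)) =
      (\<Sum>u\<in>S. \<Sum>w\<in>S. r u w * (2 * (x u * x w)))"
    unfolding sum.distrib[symmetric] by (intro sum.cong refl) simp
  also have "\<dots> \<le> (\<Sum>u\<in>S. \<Sum>w\<in>S. r u w * (\<alpha> * (x u)\<^sup>2 + (x w)\<^sup>2 / \<alpha>))"
    by (intro sum_mono mult_left_mono amgm r0)
  also have "\<dots> = (\<Sum>u\<in>S. \<Sum>w\<in>S. r u w * (\<alpha> * (x u)\<^sup>2)) + (\<Sum>u\<in>S. \<Sum>w\<in>S. r u w * ((x w)\<^sup>2 / \<alpha>))"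
    unfolding sum.distrib[symmetric] by (intro sum.cong refl) (simp add: distrib_left)
  finally have 1: "qform (adj G) S x \<le> (\<Sum>u\<in>S. \<Sum>w\<in>S. r u w * (\<alpha> * (x u)\<^sup>2)) + (\<Sum>u\<in>S. \<Sum>w\<in>S. r u w * ((x w)\<^sup>2 / \<alpha>))" .
  have 2: "(\<Sum>u\<in>S. \<Sum>w\<in>S. r u w * ((x w)\<^sup>2 / \<alpha>)) = (\<Sum>w\<in>S. \<Sum>u\<in>S. r u w * ((x w)\<^sup>2 / \<alpha>))"
    by (rule sum.swap)
  have 3: "(\<Sum>u\<in>S. \<Sum>w\<in>S. r u w * (\<alpha> * (x u)\<^sup>2)) \<le> (\<Sum>u\<in>S. h * (\<alpha> * (x u)\<^sup>2))"
    unfolding sum_distrib_right[symmetric] using out al by (intro sum_mono mult_right_mono) auto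
  have 4: "(\<Sum>w\<in>S. \<Sum>u\<in>S. r u w * ((x w)\<^sup>2 / \<alpha>)) \<le> (\<Sum>w\<in>S. D * ((x w)\<^sup>2 / \<alpha>))"
    unfolding sum_distrib_right[symmetric] using inn al by (intro sum_mono mult_right_mono) auto
  have 5: "(\<Sum>u\<in>S. h * (\<alpha> * (x u)\<^sup>2)) + (\<Sum>w\<in>S. D * ((x w)\<^sup>2 / \<alpha>)) = (\<alpha> * h + D / \<alpha>) * nsq S x"
    unfolding nsq_def sum_distrib_left sum.distrib[symmetric] by (intro sum.cong) (auto simp: algebra_simps)
  show ?thesis using 1 2 3 4 5 by linarith
qed

text \<open>A vertex with three neighbours in \<open>A\<close> either lies above some of them or has three neighbours
  on a chain of ancestors; the second kind is counted by the lowest of the three.\<close>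
lemma excess_degree:
  assumes A: "A \<subseteq> V"
  shows "(\<Sum>b\<in>V. card (A \<inter> N b) - 2) \<le> card A * (h + 2 * h ^ 3)"
proof -
  \<comment> \<open>Neighbours in \<open>A\<close> below \<open>b\<close> are cheap: every member of
    \<open>A\<close> has at most \<open>h\<close> ancestors, so the sets \<open>up b\<close> have
    total size at most \<open>card A * h\<close>.\<close>
  define up where "up b = {a \<in> A \<inter> N b. b \<in> anc a}" for b
  define dn where "dn b = {a \<in> A \<inter> N b. a \<in> anc b}" for b
  have fA: "finite A" using A fin finite_subset by blast
  have un: "A \<inter> N b = up b \<union> dn b" if "b \<in> V" for b
    using anc that A unfolding up_def dn_def nbrs_def dfs_ancestors_def by blast
  define B3 where "B3 = {b \<in> V. card (dn b) \<ge> 3}"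
  \<comment> \<open>Two neighbours are free, so the neighbours above \<open>b\<close> cost something
    only if there are at least three, and then at most \<open>h\<close>.\<close>
  have one: "card (A \<inter> N b) - 2 \<le> card (up b) + (if b \<in> B3 then h else 0)" if b: "b \<in> V" for b
  proof -
    have "card (A \<inter> N b) \<le> card (up b) + card (dn b)" unfolding un[OF b] by (rule card_Un_le)
    moreover have "card (dn b) \<le> card (anc b)" using fin_anc[OF b] unfolding dn_def by (intro card_mono) auto
    ultimately show ?thesis using card_anc[OF b] b unfolding B3_def by auto
  qed
  have ups: "(\<Sum>b\<in>V. card (up b)) \<le> card A * h"
  proof -
    have "(\<Sum>b\<in>V. card (up b)) \<le> (\<Sum>b\<in>V. \<Sum>a\<in>A. if b \<in> anc a then 1 else 0)"
    proof (intro sum_mono)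
      fix b assume "b \<in> V"
      have "card (up b) \<le> card {a \<in> A. b \<in> anc a}" unfolding up_def using fA by (intro card_mono) auto
      also have "\<dots> = (\<Sum>a\<in>A. if b \<in> anc a then 1 else 0)" using fA by (simp add: sum.If_cases Collect_conj_eq)
      finally show "card (up b) \<le> (\<Sum>a\<in>A. if b \<in> anc a then 1 else 0)" .
    qed
    also have "\<dots> = (\<Sum>a\<in>A. \<Sum>b\<in>V. if b \<in> anc a then 1 else 0)" by (rule sum.swap)
    also have "\<dots> \<le> (\<Sum>a\<in>A. h)"
    proof (intro sum_mono)
      fix a assume a: "a \<in> A"
      have "(\<Sum>b\<in>V. if b \<in> anc a then 1 else 0) = card (V \<inter> anc a)" using fin by (simp add: sum.If_cases)
      also have "\<dots> \<le> card (anc a)" using fin_anc a A by (intro card_mono) auto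
      finally show "(\<Sum>b\<in>V. if b \<in> anc a then 1 else 0) \<le> h" using card_anc[of a] a A by auto
    qed
    finally show ?thesis by simp
  qed
  \<comment> \<open>The pairs that complete \<open>a\<close>, as the lowest vertex, to a triple on a
    chain: at most h^2 of them, each triple with at most two common neighbours by
    \<open>K33\<close>.\<close>
  define P where "P a = {(c, d). c \<in> anc a \<and> d \<in> anc a \<and> c \<noteq> d \<and> c \<noteq> a \<and> d \<noteq> a}" for a
  have P: "P a \<subseteq> anc a \<times> anc a" for a unfolding P_def by auto
  have fP: "finite (P a)" if "a \<in> A" for a
    using P[of a] fin_anc[of a] that A by (meson finite_SigmaI finite_subset subsetD)
  have cP: "card (P a) \<le> h * h" if "a \<in> A" for a
  proof -
    have "card (P a) \<le> card (anc a \<times> anc a)" using P fin_anc[of a] that A by (intro card_mono) auto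
    also have "\<dots> \<le> h * h" using card_anc[of a] that A by (simp add: card_cartesian_product mult_le_mono subset_eq)
    finally show ?thesis .
  qed
  let ?C = "\<lambda>a cd. N a \<inter> N (fst cd) \<inter> N (snd cd)"
  have "B3 \<subseteq> (\<Union>a\<in>A. \<Union>cd\<in>P a. ?C a cd)"
  proof
    fix b assume b: "b \<in> B3"
    then have bV: "b \<in> V" and "card (dn b) \<ge> 3" unfolding B3_def by auto
    then obtain T where "T \<subseteq> dn b" "card T = 3" by (meson obtain_subset_with_card_n)
    then obtain x y z where xyz: "x \<in> dn b" "y \<in> dn b" "z \<in> dn b" "x \<noteq> y" "x \<noteq> z" "y \<noteq> z"
      by (auto simp: card_3_iff)
    have a: "x \<in> anc b" "y \<in> anc b" "z \<in> anc b" "x \<in> A" "y \<in> A" "z \<in> A" "b \<in> N x" "b \<in> N y" "b \<in> N z"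
      using xyz nbrs_sym unfolding dn_def by auto
    have ch: "x \<in> anc y \<or> y \<in> anc x" "x \<in> anc z \<or> z \<in> anc x" "y \<in> anc z \<or> z \<in> anc y"
      using anc bV a unfolding dfs_ancestors_def by blast+
    have V: "x \<in> V" "y \<in> V" "z \<in> V" using a A by auto
    have tr: "q \<in> anc q'" if "q \<in> anc p" "p \<in> anc q'" "q' \<in> V" for p q q'
      using anc that unfolding dfs_ancestors_def by blast
    have "(y, z) \<in> P x \<or> (x, z) \<in> P y \<or> (x, y) \<in> P z"
      unfolding P_def using xyz ch tr V by blast
    then show "b \<in> (\<Union>a\<in>A. \<Union>cd\<in>P a. ?C a cd)" using a by (auto; force)
  qed
  moreover have "finite (\<Union>a\<in>A. \<Union>cd\<in>P a. ?C a cd)" using fA fP fin_nbrs by auto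
  ultimately have "card B3 \<le> card (\<Union>a\<in>A. \<Union>cd\<in>P a. ?C a cd)" by (rule card_mono[rotated])
  also have "\<dots> \<le> (\<Sum>a\<in>A. card (\<Union>cd\<in>P a. ?C a cd))" by (rule card_UN_le[OF fA])
  also have "\<dots> \<le> (\<Sum>a\<in>A. 2 * h ^ 2)"
  proof (intro sum_mono)
    fix a assume a: "a \<in> A"
    have "card (\<Union>cd\<in>P a. ?C a cd) \<le> (\<Sum>cd\<in>P a. card (?C a cd))" by (rule card_UN_le[OF fP[OF a]])
    also have "\<dots> \<le> (\<Sum>cd\<in>P a. 2)" using K33 by (intro sum_mono) (auto simp: P_def)
    also have "\<dots> \<le> 2 * h ^ 2" using cP[OF a] by (simp add: power2_eq_square)
    finally show "card (\<Union>cd\<in>P a. ?C a cd) \<le> 2 * h ^ 2" .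
  qed
  finally have c3: "card B3 \<le> card A * (2 * h ^ 2)" by simp
  have "(\<Sum>b\<in>V. card (A \<inter> N b) - 2) \<le> (\<Sum>b\<in>V. card (up b) + (if b \<in> B3 then h else 0))"
    by (intro sum_mono one)
  also have "\<dots> = (\<Sum>b\<in>V. card (up b)) + card B3 * h"
    using fin by (simp add: sum.distrib sum.If_cases) (simp add: B3_def Int_def)
  also have "\<dots> \<le> card A * h + card A * (2 * h ^ 2) * h" using ups c3 by (intro add_mono mult_right_mono) auto
  finally show ?thesis by (simp add: algebra_simps power2_eq_square power3_eq_cube)
qed

end

section \<open>Two vertices of almost full degree\<close>

lemma finite_argmax:
  fixes f :: "'a \<Rightarrow> real"
  assumes "finite A" "A \<noteq> {}"
  obtains u where "u \<in> A" "\<And>a. a \<in> A \<Longrightarrow> f a \<le> f u"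
proof -
  have "Max (f ` A) \<in> f ` A" using assms by (intro Max_in) auto
  then obtain u where "u \<in> A" "f u = Max (f ` A)" by auto
  then show ?thesis using that assms by simp
qed

lemma sum_square_le:
  fixes f :: "'a \<Rightarrow> real"
  shows "(\<Sum>a\<in>A. f a)\<^sup>2 \<le> card A * (\<Sum>a\<in>A. (f a)\<^sup>2)"
  using Cauchy_Schwarz_ineq_sum[of "\<lambda>_. 1" f A] by simp

text \<open>The quadratic bound makes \<open>h\<close> negligible against sqrt n. The bound by h^4
  makes the error of \<open>excess_degree\<close> a small fraction of n for sets of O(h) vertices,
  whose error is of order h^4.\<close>

locale big_sparse_graph = sparse_graph +
  assumes h1: "h \<ge> 1" and n1: "real (card V) \<ge> 10000000000000 * real h ^ 2" and n2: "real (card V) \<ge> 5000000000 * real h ^ 4"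
begin

abbreviation "n \<equiv> real (card V)"

lemma hn: "n \<ge> 10000000000000" and sqrt_n: "sqrt n > 0" "(sqrt n)\<^sup>2 = n" and sqrt_h: "1000000 * real h \<le> sqrt n"
proof -
  have "10000000000000 * real 1 ^ 2 \<le> 10000000000000 * real h ^ 2" using h1 by (intro mult_left_mono power_mono) auto
  then show n: "n \<ge> 10000000000000" using n1 by simp
  then show "sqrt n > 0" "(sqrt n)\<^sup>2 = n" by auto
  have "(1000000 * real h)\<^sup>2 \<le> n" using n1 by (simp add: power_mult_distrib)
  then show "1000000 * real h \<le> sqrt n" by (rule real_le_rsqrt)
qed

text \<open>By \<open>qform_le_degree\<close> the edges inside \<open>A\<close> are negligible
  because \<open>A\<close> is small, and those inside \<open>S - A\<close> because the degrees are.
  What remains are the edges between the two parts, that is, the sums of the entries at heavy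
  neighbours; up to a small total excess each vertex has at most two of these.\<close>

lemma heavy_split:
  assumes S: "S \<subseteq> V"
  obtains A where "A \<subseteq> S" "(\<Sum>b\<in>V. real (card (A \<inter> N b) - 2)) \<le> 7 / 10000 * n"
    "\<And>x. (\<And>v. x v \<ge> 0) \<Longrightarrow> qform (adj G) S x \<le> 3 / 1000 * sqrt n * nsq S x +
       2 * (\<Sum>b\<in>S - A. x b * (\<Sum>a\<in>A \<inter> N b. x a))"
proof -
  \<comment> \<open>The threshold for heavy vertices: high enough that edge counting leaves only
    O(h) of them, low enough that sqrt (h * D) is a small multiple of sqrt n.\<close>
  define D where "D = n / (500000 * real h)"
  define A where "A = {v \<in> S. real (card (S \<inter> N v)) \<ge> D}"
  have hr: "real h \<ge> 1" using h1 by simp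
  have h40: "0 \<le> real h ^ 4" by simp
  have h4: "real h * real h ^ 3 = real h ^ 4" "real h ^ 3 * real h = real h ^ 4" by (simp_all add: eval_nat_numeral)
  have AS: "A \<subseteq> S" unfolding A_def by blast
  have fS: "finite S" using S fin finite_subset by blast
  have fA: "finite A" using AS fS finite_subset by blast
  have exc: "(\<Sum>b\<in>V. card (A \<inter> N b) - 2) \<le> card A * (h + 2 * h ^ 3)" using excess_degree[OF subset_trans[OF AS S]] .
  have h3: "real (h + 2 * h ^ 3) \<le> 3 * real h ^ 3"
    using self_le_power[of "real h" 3] hr by simp
  have excr: "(\<Sum>b\<in>V. real (card (A \<inter> N b) - 2)) \<le> real (card A) * (3 * real h ^ 3)"
  proof -
    have "(\<Sum>b\<in>V. real (card (A \<inter> N b) - 2)) \<le> real (card A * (h + 2 * h ^ 3))"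
      using exc unfolding of_nat_sum[symmetric] by (rule of_nat_mono)
    also have "\<dots> \<le> real (card A) * (3 * real h ^ 3)" using h3 unfolding of_nat_mult by (intro mult_left_mono) auto
    finally show ?thesis .
  qed
  have D3: "3 * real h ^ 3 \<le> D / 1000"
  proof -
    have "3 * real h ^ 3 * (500000 * real h) * 1000 = 1500000000 * real h ^ 4" using h4 by simp
    also have "\<dots> \<le> n" using n2 h40 by linarith
    finally have "3 * real h ^ 3 * (500000 * real h) * 1000 \<le> n" .
    then have "3 * real h ^ 3 * 1000 \<le> D" using hr unfolding D_def by (subst pos_le_divide_eq) (auto simp: mult_ac)
    then show ?thesis by simp
  qed
  \<comment> \<open>Double counting of the edges between \<open>A\<close> and \<open>S\<close>: two
    for every vertex, plus the excess, of which each member of \<open>A\<close> accounts for at most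
    D / 1000.\<close>
  have "real (card A) * D \<le> 2 * n + real (card A) * (D / 1000)"
  proof -
    have "real (card A) * D = (\<Sum>a\<in>A. D)" by simp
    also have "\<dots> \<le> (\<Sum>a\<in>A. real (card (S \<inter> N a)))" by (intro sum_mono) (auto simp: A_def)
    also have "\<dots> = (\<Sum>a\<in>A. \<Sum>b\<in>S. if b \<in> N a then 1 else 0)"
      using fS by (simp add: sum.If_cases)
    also have "\<dots> = (\<Sum>b\<in>S. \<Sum>a\<in>A. if b \<in> N a then 1 else 0)" by (rule sum.swap)
    also have "\<dots> = (\<Sum>b\<in>S. real (card (A \<inter> N b)))"
    proof (intro sum.cong refl)
      fix b
      have "{a. b \<in> N a} = N b" using nbrs_sym by auto
      then show "(\<Sum>a\<in>A. if b \<in> N a then 1 else 0) = real (card (A \<inter> N b))" using fA by (simp add: sum.If_cases)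
    qed
    also have "\<dots> \<le> (\<Sum>b\<in>V. real (card (A \<inter> N b)))" by (intro sum_mono2) (use S fin in auto)
    also have "\<dots> \<le> (\<Sum>b\<in>V. 2 + real (card (A \<inter> N b) - 2))" by (intro sum_mono) auto
    also have "\<dots> = 2 * n + (\<Sum>b\<in>V. real (card (A \<inter> N b) - 2))" by (simp add: sum.distrib)
    also have "\<dots> \<le> 2 * n + real (card A) * (3 * real h ^ 3)" using excr by simp
    also have "\<dots> \<le> 2 * n + real (card A) * (D / 1000)" using D3 by (intro add_left_mono mult_left_mono) auto
    finally show ?thesis .
  qed
  then have "real (card A) * D * (999 / 1000) \<le> 2 * n" by simp
  moreover have "real (card A) * D * (999 / 1000) = real (card A) * (n * (999 / 1000)) / (500000 * real h)" unfolding D_def by simp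
  ultimately have "real (card A) * (n * (999 / 1000)) / (500000 * real h) \<le> 2 * n" by simp
  then have "real (card A) * (n * (999 / 1000)) \<le> (2 * n) * (500000 * real h)" using hr by (subst (asm) pos_divide_le_eq) auto
  then have "(real (card A) * (999 / 1000)) * n \<le> (1000000 * real h) * n" by (simp add: mult_ac)
  then have "real (card A) * (999 / 1000) \<le> 1000000 * real h" using hn by (subst (asm) mult_le_cancel_right) auto
  then have cA: "real (card A) \<le> 1100000 * real h" using hr by simp
  show ?thesis
  proof (rule that[OF AS])
    \<comment> \<open>By \<open>n2\<close> the excess is at most 3300000 / 5000000000 of n.\<close>
    have "real (card A) * (3 * real h ^ 3) \<le> (1100000 * real h) * (3 * real h ^ 3)" using cA by (intro mult_right_mono) auto
    also have "\<dots> = 3300000 * real h ^ 4" using h4 by simp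
    also have "\<dots> \<le> 7 / 10000 * n" using n2 h40 by linarith
    finally show "(\<Sum>b\<in>V. real (card (A \<inter> N b) - 2)) \<le> 7 / 10000 * n" using excr by simp
  next
    fix x :: "nat \<Rightarrow> real" assume x: "\<And>v. x v \<ge> 0"
    let ?B = "S - A"
    have qA: "qform (adj G) A x \<le> 3 / 1000 * sqrt n * nsq A x"
    proof -
      \<comment> \<open>Here \<alpha> = 1000 and degrees inside \<open>A\<close> are bounded by its
        size; the total 2100 * h is below 3/1000 of sqrt n by \<open>sqrt_h\<close>.\<close>
      have "qform (adj G) A x \<le> (1000 * real h + (1100000 * real h) / 1000) * nsq A x"
      proof (rule qform_le_degree)
        fix v assume "v \<in> A"
        have "real (card (A \<inter> N v)) \<le> card A" using fA by (intro of_nat_mono card_mono) auto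
        then show "real (card (A \<inter> N v)) \<le> 1100000 * real h" using cA by simp
      qed (use x AS S in auto)
      also have "\<dots> \<le> 3 / 1000 * sqrt n * nsq A x" using sqrt_h by (intro mult_right_mono nsq_nonneg) simp
      finally show ?thesis .
    qed
    have qB: "qform (adj G) ?B x \<le> 3 / 1000 * sqrt n * nsq ?B x"
    proof -
      \<comment> \<open>With this weight the two terms become 1/1000 and 2/1000 of sqrt n.\<close>
      let ?al = "sqrt n / (1000 * real h)"
      have "qform (adj G) ?B x \<le> (?al * real h + D / ?al) * nsq ?B x"
      proof (rule qform_le_degree)
        show "0 < ?al" using sqrt_n hr by simp
        fix v assume v: "v \<in> ?B"
        have "real (card (?B \<inter> N v)) \<le> card (S \<inter> N v)" using fS by (intro of_nat_mono card_mono) auto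
        then show "real (card (?B \<inter> N v)) \<le> D" using v unfolding A_def by auto
      qed (use x S in auto)
      also have "?al * real h + D / ?al = 3 / 1000 * sqrt n"
      proof -
        have "D / ?al = n / sqrt n * (2 / 1000)" using hr sqrt_n unfolding D_def by (simp add: field_simps)
        also have "n / sqrt n = sqrt n" by (rule real_div_sqrt) simp
        finally show ?thesis using hr by simp
      qed
      finally show ?thesis .
    qed
    have split: "(\<Sum>u\<in>S. f u) = (\<Sum>u\<in>A. f u) + (\<Sum>u\<in>?B. f u)" for f :: "nat \<Rightarrow> real"
      using sum.subset_diff[OF AS fS, of f] by simp
    have "qform (adj G) S x = qform (adj G) A x + (\<Sum>u\<in>A. \<Sum>w\<in>?B. adj G u w * x u * x w)
        + ((\<Sum>u\<in>?B. \<Sum>w\<in>A. adj G u w * x u * x w) + qform (adj G) ?B x)"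
      unfolding qform_def split by (simp only: sum.distrib)
    moreover have "(\<Sum>u\<in>A. \<Sum>w\<in>?B. adj G u w * x u * x w) = (\<Sum>u\<in>?B. \<Sum>w\<in>A. adj G u w * x u * x w)"
      by (subst sum.swap) (simp add: adj_sym[of G] mult_ac)
    moreover have "(\<Sum>u\<in>?B. \<Sum>w\<in>A. adj G u w * x u * x w) = (\<Sum>b\<in>?B. x b * (\<Sum>a\<in>A \<inter> N b. x a))"
    proof (intro sum.cong refl)
      fix b assume "b \<in> ?B"
      then have b: "b \<in> V" using S by auto
      have "(\<Sum>w\<in>A. adj G b w * x b * x w) = x b * (\<Sum>w\<in>A. adj G b w * x w)" by (simp add: sum_distrib_left mult_ac)
      then show "(\<Sum>w\<in>A. adj G b w * x b * x w) = x b * (\<Sum>a\<in>A \<inter> N b. x a)"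
        using sum_adj[of A b x] AS S b by auto
    qed
    moreover have "nsq S x = nsq A x + nsq ?B x" unfolding nsq_def by (rule split)
    ultimately show "qform (adj G) S x \<le> 3 / 1000 * sqrt n * nsq S x + 2 * (\<Sum>b\<in>?B. x b * (\<Sum>a\<in>A \<inter> N b. x a))"
      using qA qB by (simp add: distrib_left)
  qed
qed

text \<open>AM-GM with weight sqrt \<tau>: the squares of the entries outside \<open>A\<close> and
  the squares of the sums \<open>s b\<close>, which are charged to \<open>A\<close>, then receive
  the same factor sqrt \<tau>.\<close>

lemma cross_le:
  fixes x :: "nat \<Rightarrow> real"
  assumes "finite S" "A \<subseteq> S" "\<tau> > 0" and T: "(\<Sum>b\<in>S - A. (s b)\<^sup>2) \<le> \<tau> * nsq A x"
  shows "2 * (\<Sum>b\<in>S - A. x b * s b) \<le> sqrt \<tau> * nsq S x"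
proof -
  let ?r = "sqrt \<tau>"
  have r: "?r > 0" "?r * ?r = \<tau>" using assms(3) by auto
  have "2 * (x b * s b) \<le> ?r * (x b)\<^sup>2 + (s b)\<^sup>2 / ?r" for b
  proof -
    have "0 \<le> (?r * x b - s b)\<^sup>2 / ?r" using r by simp
    also have "\<dots> = ?r * (x b)\<^sup>2 + (s b)\<^sup>2 / ?r - 2 * (x b * s b)"
      using r(1) by (simp add: power2_eq_square field_simps del: real_sqrt_mult_self)
    finally show ?thesis by simp
  qed
  then have "2 * (\<Sum>b\<in>S - A. x b * s b) \<le> (\<Sum>b\<in>S - A. ?r * (x b)\<^sup>2 + (s b)\<^sup>2 / ?r)"
    unfolding sum_distrib_left by (intro sum_mono)
  also have "\<dots> = ?r * nsq (S - A) x + (\<Sum>b\<in>S - A. (s b)\<^sup>2) / ?r"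
    unfolding nsq_def by (simp add: sum.distrib sum_distrib_left sum_divide_distrib)
  also have "\<dots> \<le> ?r * nsq (S - A) x + \<tau> * nsq A x / ?r"
    using T r by (intro add_left_mono divide_right_mono) auto
  also have "\<tau> * nsq A x / ?r = ?r * nsq A x"
    using r by (metis mult.assoc nonzero_mult_div_cancel_left order_less_irrefl times_divide_eq_left)
  also have "?r * nsq (S - A) x + ?r * nsq A x = ?r * nsq S x"
    unfolding nsq_def using sum.subset_diff[OF assms(2,1), of "\<lambda>u. (x u)\<^sup>2"] by (simp add: distrib_left)
  finally show ?thesis .
qed

lemma nbr_sum_square:
  fixes x :: "nat \<Rightarrow> real"
  assumes "finite A"
  shows "(\<Sum>a\<in>A \<inter> N b. x a)\<^sup>2 \<le> card (A \<inter> N b) * nsq A x"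
proof -
  have "(\<Sum>a\<in>A \<inter> N b. x a)\<^sup>2 \<le> card (A \<inter> N b) * (\<Sum>a\<in>A \<inter> N b. (x a)\<^sup>2)" by (rule sum_square_le)
  also have "\<dots> \<le> card (A \<inter> N b) * nsq A x"
    unfolding nsq_def using assms by (intro mult_left_mono sum_mono2) auto
  finally show ?thesis .
qed

text \<open>A set of few vertices has a form small against sqrt n, since its members have at most
  two heavy neighbours up to the excess. It is applied to the exceptional vertices.\<close>

lemma qform_le_card:
  assumes S: "S \<subseteq> V" and x: "\<And>v. x v \<ge> 0"
  shows "qform (adj G) S x \<le> (3 / 1000 * sqrt n + sqrt (2 * card S + 7 / 10000 * n)) * nsq S x"
proof -
  obtain A where A: "A \<subseteq> S" "(\<Sum>b\<in>V. real (card (A \<inter> N b) - 2)) \<le> 7 / 10000 * n"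
    "qform (adj G) S x \<le> 3 / 1000 * sqrt n * nsq S x + 2 * (\<Sum>b\<in>S - A. x b * (\<Sum>a\<in>A \<inter> N b. x a))"
    by (rule heavy_split[OF S]) (use x in auto)
  have fS: "finite S" using S fin finite_subset by blast
  have fA: "finite A" using A(1) fS finite_subset by blast
  have "(\<Sum>b\<in>S - A. (\<Sum>a\<in>A \<inter> N b. x a)\<^sup>2) \<le> (\<Sum>b\<in>S - A. card (A \<inter> N b) * nsq A x)"
    by (intro sum_mono nbr_sum_square[OF fA])
  also have "\<dots> = (\<Sum>b\<in>S - A. real (card (A \<inter> N b))) * nsq A x" by (simp add: sum_distrib_right)
  also have "\<dots> \<le> (2 * card S + 7 / 10000 * n) * nsq A x"
  proof (intro mult_right_mono nsq_nonneg)
    have "(\<Sum>b\<in>S - A. real (card (A \<inter> N b))) \<le> (\<Sum>b\<in>S. real (card (A \<inter> N b)))"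
      using fS by (intro sum_mono2) auto
    also have "\<dots> \<le> (\<Sum>b\<in>S. 2 + real (card (A \<inter> N b) - 2))" by (intro sum_mono) auto
    also have "\<dots> = 2 * card S + (\<Sum>b\<in>S. real (card (A \<inter> N b) - 2))" by (simp add: sum.distrib)
    also have "(\<Sum>b\<in>S. real (card (A \<inter> N b) - 2)) \<le> (\<Sum>b\<in>V. real (card (A \<inter> N b) - 2))"
      using S fin by (intro sum_mono2) auto
    finally show "(\<Sum>b\<in>S - A. real (card (A \<inter> N b))) \<le> 2 * card S + 7 / 10000 * n" using A(2) by simp
  qed
  finally have "2 * (\<Sum>b\<in>S - A. x b * (\<Sum>a\<in>A \<inter> N b. x a)) \<le> sqrt (2 * card S + 7 / 10000 * n) * nsq S x"
    using hn by (intro cross_le[OF fS A(1)]) auto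
  then show ?thesis using A(3) by (simp add: distrib_right)
qed

text \<open>Up to a negligible error, \<open>\<rho>\<^sup>2\<close> is bounded by the sum over the remaining vertices of the
  squared sum of the entries at the heavy neighbours. This contributes at most twice the weight
  of the heavy vertices, and at most \<open>3/2\<close> times unless both of the two largest entries occur.\<close>
lemma two_hubs:
  assumes x: "\<And>v. x v \<ge> 0" "nsq V x = 1" and rho: "qform (adj G) V x \<ge> 1414 / 1000 * sqrt n"
  obtains u v where "u \<in> V" "v \<in> V" "u \<noteq> v" "card (V - (N u \<inter> N v)) \<le> 23 / 1000 * n"
proof -
  obtain A where A: "A \<subseteq> V" "(\<Sum>b\<in>V. real (card (A \<inter> N b) - 2)) \<le> 7 / 10000 * n"
    "qform (adj G) V x \<le> 3 / 1000 * sqrt n * nsq V x + 2 * (\<Sum>b\<in>V - A. x b * (\<Sum>a\<in>A \<inter> N b. x a))"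
    by (rule heavy_split[OF subset_refl]) (use x(1) in auto)
  let ?s = "\<lambda>b. \<Sum>a\<in>A \<inter> N b. x a"
  have fA: "finite A" using A(1) fin finite_subset by blast
  \<comment> \<open>Subtracting the error 3/1000 from 1414/1000 leaves 1.411, whose square exceeds
    1.99.\<close>
  have key: "\<tau> \<ge> 199 / 100 * n" if t: "\<tau> > 0" "(\<Sum>b\<in>V - A. (?s b)\<^sup>2) \<le> \<tau> * nsq A x" for \<tau>
  proof -
    have "2 * (\<Sum>b\<in>V - A. x b * ?s b) \<le> sqrt \<tau>" using cross_le[OF fin A(1) t] x(2) by simp
    then have "1411 / 1000 * sqrt n \<le> sqrt \<tau>" using A(3) rho x(2) by simp
    then have "(1411 / 1000 * sqrt n)\<^sup>2 \<le> (sqrt \<tau>)\<^sup>2" using sqrt_n by (intro power_mono) auto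
    moreover have "(1411 / 1000 * sqrt n)\<^sup>2 = (1411 / 1000)\<^sup>2 * n" by (simp only: power_mult_distrib sqrt_n(2))
    moreover have "(sqrt \<tau>)\<^sup>2 = \<tau>" using t(1) by simp
    ultimately have "(1411 / 1000)\<^sup>2 * n \<le> \<tau>" by simp
    moreover have "199 / 100 * n \<le> (1411 / 1000)\<^sup>2 * n" using hn by (intro mult_right_mono) (auto simp: power2_eq_square)
    ultimately show ?thesis by simp
  qed
  \<comment> \<open>With at most one heavy vertex the factor \<tau> = n would do.\<close>
  have c2: "card A \<ge> 2"
  proof (rule ccontr)
    assume "\<not> card A \<ge> 2"
    then have cA: "card A \<le> 1" by simp
    have "(\<Sum>b\<in>V - A. (?s b)\<^sup>2) \<le> (\<Sum>b\<in>V - A. nsq A x)"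
    proof (intro sum_mono)
      fix b
      have "card (A \<inter> N b) \<le> 1" using cA card_mono[of A "A \<inter> N b"] fA by auto
      then have "real (card (A \<inter> N b)) * nsq A x \<le> 1 * nsq A x" by (intro mult_right_mono nsq_nonneg) simp
      then show "(?s b)\<^sup>2 \<le> nsq A x" using nbr_sum_square[OF fA, of x b] by simp
    qed
    also have "\<dots> \<le> n * nsq A x"
      using card_mono[of V "V - A"] fin by (simp add: mult_right_mono nsq_nonneg)
    finally show False using key[of n] hn by simp
  qed
  then have "A \<noteq> {}" by auto
  then obtain u where u: "u \<in> A" "\<And>a. a \<in> A \<Longrightarrow> x a \<le> x u" using finite_argmax[OF fA] by blast
  have Au: "A - {u} \<noteq> {}" using c2 card_mono[of "{u}" A] by auto
  obtain v where v': "v \<in> A - {u}" "\<And>a. a \<in> A - {u} \<Longrightarrow> x a \<le> x v"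
    using finite_argmax[OF finite_Diff[OF fA] Au, of x] by blast
  have v: "v \<in> A" "v \<noteq> u" "\<And>a. a \<in> A \<Longrightarrow> a \<noteq> u \<Longrightarrow> x a \<le> x v" using v' by simp_all
  let ?W = "N u \<inter> N v"
  \<comment> \<open>A pair containing some \<open>d\<close> besides the two largest entries: as x d
    \<le> x v, the square is at most 3/2 * ((x u)^2 + 2 * (x d)^2) \<le> 3/2 * ((x u)^2 + (x v)^2 +
    (x d)^2).\<close>
  have two: "(x u + x d)\<^sup>2 \<le> 3 / 2 * nsq A x" if d: "d \<in> A" "d \<noteq> u" "d \<noteq> v" for d
  proof -
    have "(x u)\<^sup>2 + (x v)\<^sup>2 + (x d)\<^sup>2 = (\<Sum>a\<in>{u, v, d}. (x a)\<^sup>2)" using d v by simp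
    also have "\<dots> \<le> nsq A x" unfolding nsq_def using d u v fA by (intro sum_mono2) auto
    finally have 1: "(x u)\<^sup>2 + (x v)\<^sup>2 + (x d)\<^sup>2 \<le> nsq A x" .
    have "(x d)\<^sup>2 \<le> (x v)\<^sup>2" using v(3)[OF d(1,2)] x(1) by (intro power_mono) auto
    moreover have "0 \<le> (x u - 2 * x d)\<^sup>2" by simp
    then have "(x u + x d)\<^sup>2 \<le> 3 / 2 * ((x u)\<^sup>2 + 2 * (x d)\<^sup>2)" by (simp add: power2_eq_square algebra_simps)
    ultimately show ?thesis using 1 by simp
  qed
  have one: "(x u)\<^sup>2 \<le> 3 / 2 * nsq A x"
  proof -
    have "(x u)\<^sup>2 \<le> nsq A x" unfolding nsq_def using u fA by (intro member_le_sum) auto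
    then show ?thesis using nsq_nonneg[of A x] by simp
  qed
  \<comment> \<open>Only common neighbours of \<open>u\<close> and \<open>v\<close> are allowed the
    factor 2, other vertices 3/2; three or more heavy neighbours are paid for by the excess.\<close>
  have local: "(?s b)\<^sup>2 \<le> (3 / 2 + (if b \<in> ?W then 1 / 2 else 0) + 2 * real (card (A \<inter> N b) - 2)) * nsq A x" (is "_ \<le> ?c * _") for b
  proof (cases "b \<in> ?W \<or> card (A \<inter> N b) \<ge> 3")
    case True
    then have "real (card (A \<inter> N b)) \<le> ?c" by (cases "card (A \<inter> N b) \<ge> 3") auto
    then have "card (A \<inter> N b) * nsq A x \<le> ?c * nsq A x" by (intro mult_right_mono nsq_nonneg)
    then show ?thesis using nbr_sum_square[OF fA, of x b] by simp
  next
    case False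
    have "\<not> {u, v} \<subseteq> A \<inter> N b" using False nbrs_sym by auto
    have "?s b \<le> x u \<or> (\<exists>d\<in>A - {u, v}. ?s b \<le> x u + x d)"
    proof -
      have "card (A \<inter> N b) = 0 \<or> card (A \<inter> N b) = 1 \<or> card (A \<inter> N b) = 2" using False by auto
      then show ?thesis
      proof (elim disjE)
        assume "card (A \<inter> N b) = 0"
        then have "A \<inter> N b = {}" using fA by simp
        then show ?thesis using x(1) by simp
      next
        assume "card (A \<inter> N b) = 1"
        then obtain c where "A \<inter> N b = {c}" by (auto simp: card_1_singleton_iff)
        then show ?thesis using u(2)[of c] by auto
      next
        assume "card (A \<inter> N b) = 2"
        then obtain c d where cd: "A \<inter> N b = {c, d}" "c \<noteq> d" by (auto simp: card_2_iff)
        have s: "?s b = x c + x d" using cd by simp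
        have m: "c \<in> A" "d \<in> A" using cd by auto
        have "d \<notin> {u, v} \<or> c \<notin> {u, v}" using \<open>\<not> {u, v} \<subseteq> A \<inter> N b\<close> cd by auto
        then show ?thesis
        proof
          assume "d \<notin> {u, v}"
          then show ?thesis using s u(2)[OF m(1)] m(2) by (intro disjI2 bexI[of _ d]) auto
        next
          assume "c \<notin> {u, v}"
          then show ?thesis using s u(2)[OF m(2)] m(1) by (intro disjI2 bexI[of _ c]) auto
        qed
      qed
    qed
    moreover have s0: "?s b \<ge> 0" using x(1) by (intro sum_nonneg) auto
    ultimately have "(?s b)\<^sup>2 \<le> 3 / 2 * nsq A x"
    proof (elim disjE bexE)
      assume "?s b \<le> x u"
      then have "(?s b)\<^sup>2 \<le> (x u)\<^sup>2" using s0 by (intro power_mono) auto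
      then show ?thesis using one by simp
    next
      fix d assume d: "d \<in> A - {u, v}" "?s b \<le> x u + x d"
      then have "(?s b)\<^sup>2 \<le> (x u + x d)\<^sup>2" using s0 by (intro power_mono) auto
      then show ?thesis using two[of d] d by simp
    qed
    also have "\<dots> \<le> ?c * nsq A x" by (intro mult_right_mono nsq_nonneg) auto
    finally show ?thesis .
  qed
  have Wf: "?W \<subseteq> V" unfolding nbrs_def by auto
  \<comment> \<open>Comparison of this factor with 1.99 * n leaves at least 0.977 * n common
    neighbours.\<close>
  let ?\<tau> = "3 / 2 * n + card ?W / 2 + 14 / 10000 * n"
  have "(\<Sum>b\<in>V - A. (?s b)\<^sup>2) \<le> (\<Sum>b\<in>V. (?s b)\<^sup>2)" using fin by (intro sum_mono2) auto
  also have "\<dots> \<le> (\<Sum>b\<in>V. (3 / 2 + (if b \<in> ?W then 1 / 2 else 0) + 2 * real (card (A \<inter> N b) - 2)) * nsq A x)"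
    by (intro sum_mono local)
  also have "\<dots> = (\<Sum>b\<in>V. 3 / 2 + (if b \<in> ?W then 1 / 2 else 0) + 2 * real (card (A \<inter> N b) - 2)) * nsq A x"
    by (simp add: sum_distrib_right)
  also have "(\<Sum>b\<in>V. 3 / 2 + (if b \<in> ?W then 1 / 2 else 0) + 2 * real (card (A \<inter> N b) - 2))
      = 3 / 2 * n + card ?W / 2 + 2 * (\<Sum>b\<in>V. real (card (A \<inter> N b) - 2))"
  proof -
    have "V \<inter> {b. b \<in> ?W} = ?W" using Wf by auto
    then show ?thesis using fin by (simp add: sum.distrib sum_distrib_left sum.If_cases)
  qed
  also have "\<dots> * nsq A x \<le> ?\<tau> * nsq A x" using A(2) by (intro mult_right_mono nsq_nonneg) simp
  finally have "?\<tau> \<ge> 199 / 100 * n" using hn by (intro key) auto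
  then have "real (card ?W) \<ge> 977 / 1000 * n" by simp
  moreover have "real (card (V - ?W)) = n - card ?W"
    using card_Diff_subset[OF finite_subset[OF Wf fin] Wf] card_mono[OF fin Wf] by simp
  ultimately have "card (V - ?W) \<le> 23 / 1000 * n" by linarith
  then show ?thesis using that[of u v] u v A(1) by blast
qed

end

text \<open>\<open>W\<close> will be the common neighbourhood of \<open>u\<close> and
  \<open>v\<close>. The vertices outside \<open>W\<close> and different from the hubs keep no edges
  except those to the two hubs, so the result is the join of an edge with the graph that
  \<open>G\<close> induces on \<open>W\<close> and isolated vertices.\<close>

definition hub_completion :: "graph \<Rightarrow> nat \<Rightarrow> nat \<Rightarrow> nat set \<Rightarrow> graph" where
  "hub_completion G u v W = (verts G, {e \<in> edges G. e \<subseteq> W} \<union> {{u, v}} \<union>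
     {{u, w} | w. w \<in> verts G - {u, v}} \<union> {{v, w} | w. w \<in> verts G - {u, v}})"

lemma verts_hub_completion [simp]: "verts (hub_completion G u v W) = verts G"
  unfolding hub_completion_def verts_def by simp

lemma edges_hub_completion: "edges (hub_completion G u v W) = {e \<in> edges G. e \<subseteq> W} \<union> {{u, v}} \<union>
     {{u, w} | w. w \<in> verts G - {u, v}} \<union> {{v, w} | w. w \<in> verts G - {u, v}}"
  unfolding hub_completion_def edges_def by simp

definition bform :: "graph \<Rightarrow> nat set \<Rightarrow> nat set \<Rightarrow> (nat \<Rightarrow> real) \<Rightarrow> real" where
  "bform G P Q x = (\<Sum>p\<in>P. \<Sum>q\<in>Q. adj G p q * x p * x q)"

lemma bform_sym: "bform G P Q x = bform G Q P x"
  unfolding bform_def by (subst sum.swap) (simp add: adj_sym[of G] mult_ac)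

lemma qform_three_blocks:
  assumes "finite U" "finite W" "finite Z" "U \<inter> W = {}" "U \<inter> Z = {}" "W \<inter> Z = {}"
  shows "qform (adj G) (U \<union> W \<union> Z) x = bform G U U x + bform G W W x + bform G Z Z x
    + 2 * bform G U W x + 2 * bform G U Z x + 2 * bform G W Z x"
proof -
  have sp: "(\<Sum>a\<in>U \<union> W \<union> Z. f a) = (\<Sum>a\<in>U. f a) + (\<Sum>a\<in>W. f a) + (\<Sum>a\<in>Z. f a)" for f :: "nat \<Rightarrow> real"
    using assms by (subst sum.union_disjoint, auto)+
  have "qform (adj G) (U \<union> W \<union> Z) x = bform G U U x + bform G U W x + bform G U Z x
     + (bform G W U x + bform G W W x + bform G W Z x) + (bform G Z U x + bform G Z W x + bform G Z Z x)"
    unfolding qform_def bform_def sp by (simp only: sum.distrib)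
  then show ?thesis using bform_sym[of G W U x] bform_sym[of G Z U x] bform_sym[of G Z W x] by simp
qed

context big_sparse_graph
begin

text \<open>In the Perron vector the entries on \<open>W\<close> and their analogue on the
  exceptional set \<open>Z\<close> are small compared with those of the hubs, and the two hubs have
  nearly equal entries. Exchanging the other edges at \<open>Z\<close> for edges to both hubs
  therefore raises the quadratic form by at least \<open>X1 * s\<close>, with \<open>s\<close> the
  sum over \<open>Z\<close>. If the spectral radius does not grow, \<open>s\<close> vanishes,
  \<open>u\<close> and \<open>v\<close> are adjacent, and \<open>Z\<close> is empty.\<close>

lemma hub_structure:
  assumes rho: "spectral_radius G \<ge> 1414 / 1000 * sqrt n"
  obtains u v where "u \<in> V" "v \<in> V" "u \<noteq> v" "card (V - (N u \<inter> N v)) \<le> 23 / 1000 * n"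
    "G = hub_completion G u v (N u \<inter> N v) \<or>
     spectral_radius G < spectral_radius (hub_completion G u v (N u \<inter> N v))"
proof -
  let ?r = "spectral_radius G"
  have ne: "V \<noteq> {}" using hn by auto
  obtain x where x: "\<And>u. x u \<ge> 0" "nsq V x = 1"
    and e: "\<And>u. u \<in> V \<Longrightarrow> (\<Sum>w\<in>V. adj G u w * x w) = ?r * x u"
    using spectral_radius_rayleigh(2)[OF fin ne] by auto
  have qx: "qform (adj G) V x = ?r" using qform_eigen[OF e] x(2) by simp
  obtain u v where uv: "u \<in> V" "v \<in> V" "u \<noteq> v" "card (V - (N u \<inter> N v)) \<le> 23 / 1000 * n"
    by (rule two_hubs[OF x]) (use rho qx in auto)
  define W where "W = N u \<inter> N v"
  define U where "U = {u, v}"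
  define Z where "Z = V - U - W"
  have NV: "N a \<subseteq> V" for a unfolding nbrs_def by auto
  have uN: "u \<notin> N u" "v \<notin> N v" unfolding nbrs_def using edgeD by blast+
  have VU: "V = U \<union> W \<union> Z" using uv NV unfolding Z_def U_def W_def by blast
  have fins: "finite U" "finite W" "finite Z" using fin VU by (metis finite_Un)+
  have dis: "U \<inter> W = {}" "U \<inter> Z = {}" "W \<inter> Z = {}" using uN unfolding Z_def U_def W_def by auto
  have sp: "(\<Sum>a\<in>V. f a) = f u + f v + (\<Sum>a\<in>W. f a) + (\<Sum>a\<in>Z. f a)" for f :: "nat \<Rightarrow> real"
  proof -
    have "(\<Sum>a\<in>U. f a) = f u + f v" using uv unfolding U_def by simp
    moreover have "(\<Sum>a\<in>V. f a) = (\<Sum>a\<in>U. f a) + (\<Sum>a\<in>W. f a) + (\<Sum>a\<in>Z. f a)"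
      unfolding VU using fins dis by (subst sum.union_disjoint, auto)+
    ultimately show ?thesis by simp
  qed
  have s2: "(sqrt n)\<^sup>2 = n" by (rule sqrt_n(2))
  have sn: "sqrt n \<ge> 1000000"
    using hn by (intro real_le_rsqrt) simp
  have r0: "?r \<ge> 1000" "?r > 0" using rho sn by linarith+
  have r2: "?r * ?r \<ge> 199 / 100 * n"
  proof -
    have "(1414 / 1000 * sqrt n) * (1414 / 1000 * sqrt n) \<le> ?r * ?r" using rho sn by (intro mult_mono) auto
    then show ?thesis using s2 hn by (simp add: power2_eq_square)
  qed
  have cZ: "real (card Z) \<le> 23 / 1000 * n"
  proof -
    have "Z \<subseteq> V - (N u \<inter> N v)" unfolding Z_def W_def by auto
    then have "card Z \<le> card (V - (N u \<inter> N v))" using fin by (intro card_mono) auto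
    then show ?thesis using uv(4) by linarith
  qed
  have "W \<noteq> {}"
  proof
    assume "W = {}"
    then have "N u \<inter> N v = {}" unfolding W_def .
    then show False using uv(4) hn by simp
  qed
  then obtain m where m: "m \<in> W" "\<And>w. w \<in> W \<Longrightarrow> x w \<le> x m" using finite_argmax[OF fins(2), of x] by blast
  define M where "M = x m"
  define X1 where "X1 = max (x u) (x v)"
  define X2 where "X2 = min (x u) (x v)"
  define s where "s = (\<Sum>z\<in>Z. x z)"
  \<comment> \<open>An upper bound for what a vertex of \<open>Z\<close> receives from outside
    \<open>Z\<close>: it misses one of the hubs, and by \<open>K33\<close> it has at most two
    neighbours in \<open>W\<close>.\<close>
  define b where "b = X1 + 2 * M"
  have X: "x u \<le> X1" "x v \<le> X1" "X2 \<le> x u" "X2 \<le> x v" "x u + x v = X1 + X2" unfolding X1_def X2_def by auto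
  have pos: "M \<ge> 0" "X1 \<ge> 0" "X2 \<ge> 0" "s \<ge> 0" "b \<ge> 0"
    using x(1) X unfolding M_def X1_def X2_def s_def b_def by (auto intro: sum_nonneg simp: le_max_iff_disj)
  have WN: "(\<Sum>w\<in>W \<inter> N a. x w) \<le> 2 * M" if "a \<noteq> u" "a \<noteq> v" for a
  proof -
    have "W \<inter> N a = N u \<inter> N v \<inter> N a" unfolding W_def by auto
    then have "card (W \<inter> N a) \<le> 2" using K33[of u v a] uv(3) that by auto
    moreover have "(\<Sum>w\<in>W \<inter> N a. x w) \<le> of_nat (card (W \<inter> N a)) * M"
      using m unfolding M_def by (intro sum_bounded_above) auto
    moreover have "real (card (W \<inter> N a)) * M \<le> 2 * M" if "card (W \<inter> N a) \<le> 2"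
      using that pos by (intro mult_right_mono) auto
    ultimately show ?thesis by linarith
  qed
  have eig: "?r * x a = adj G a u * x u + adj G a v * x v + (\<Sum>w\<in>W \<inter> N a. x w) + (\<Sum>w\<in>Z \<inter> N a. x w)" if a: "a \<in> V" for a
  proof -
    have "W \<subseteq> V" "Z \<subseteq> V" using VU by auto
    then show ?thesis using e[OF a] sp[of "\<lambda>w. adj G a w * x w"] sum_adj[of W a x] sum_adj[of Z a x] a by simp
  qed
  have hubz: "adj G z u * x u + adj G z v * x v \<le> X1" if z: "z \<in> Z" for z
  proof -
    have "\<not> (z \<in> N u \<and> z \<in> N v)" using z unfolding Z_def W_def by auto
    then have "adj G z u = 0 \<or> adj G z v = 0"
      using adj_nbrs[OF uv(1), of z] adj_nbrs[OF uv(2), of z] adj_sym[of G z] by auto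
    moreover have "adj G z u \<le> 1" "adj G z v \<le> 1" unfolding adj_def by auto
    then have "adj G z u * x u \<le> X1" "adj G z v * x v \<le> X1"
      using mult_right_mono[of "adj G z u" 1 "x u"] mult_right_mono[of "adj G z v" 1 "x v"] x(1) X by auto
    ultimately show ?thesis by auto
  qed
  have Zu: "z \<noteq> u" "z \<noteq> v" "z \<in> V" if "z \<in> Z" for z using that unfolding Z_def U_def by auto
  have Wu: "w \<noteq> u" "w \<noteq> v" "w \<in> V" if "w \<in> W" for w using that dis VU unfolding U_def by auto
  \<comment> \<open>As \<open>Z\<close> has at most 0.023 * n vertices, its form is at most (0.003 +
    0.22) * sqrt n times the squares, below a fifth of 1.414 * sqrt n.\<close>
  have qZ: "qform (adj G) Z x \<le> ?r / 5 * nsq Z x"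
  proof -
    have "sqrt (2 * card Z + 7 / 10000 * n) \<le> sqrt ((22 / 100)\<^sup>2 * n)"
      using cZ hn by (intro real_sqrt_le_mono) (simp add: power2_eq_square)
    also have "\<dots> = 22 / 100 * sqrt n" by (simp add: real_sqrt_mult)
    finally have "3 / 1000 * sqrt n + sqrt (2 * card Z + 7 / 10000 * n) \<le> ?r / 5" using rho sn by linarith
    then have "(3 / 1000 * sqrt n + sqrt (2 * card Z + 7 / 10000 * n)) * nsq Z x \<le> ?r / 5 * nsq Z x"
      by (intro mult_right_mono nsq_nonneg)
    moreover have "Z \<subseteq> V" using VU by auto
    ultimately show ?thesis using qform_le_card[of Z x, OF _ x(1)] by linarith
  qed
  have bZZ: "bform G Z Z x = (\<Sum>z\<in>Z. x z * (\<Sum>w\<in>Z \<inter> N z. x w))"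
    unfolding bform_def
  proof (intro sum.cong refl)
    fix z assume "z \<in> Z"
    then have "(\<Sum>w\<in>Z. adj G z w * x w) = (\<Sum>w\<in>Z \<inter> N z. x w)" using sum_adj[of Z z x] Zu VU by auto
    moreover have "(\<Sum>q\<in>Z. adj G z q * x z * x q) = x z * (\<Sum>w\<in>Z. adj G z w * x w)" by (simp add: sum_distrib_left mult_ac)
    ultimately show "(\<Sum>q\<in>Z. adj G z q * x z * x q) = x z * (\<Sum>w\<in>Z \<inter> N z. x w)" by simp
  qed
  have qb: "bform G Z Z x = qform (adj G) Z x" unfolding bform_def qform_def ..
  \<comment> \<open>The eigenvalue equations on \<open>Z\<close>, weighted by the entries and
    summed; the edges inside \<open>Z\<close> are absorbed by \<open>qZ\<close>.\<close>
  have zeta: "4 / 5 * ?r * nsq Z x \<le> b * s"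
  proof -
    have "?r * nsq Z x = (\<Sum>z\<in>Z. x z * (?r * x z))" unfolding nsq_def sum_distrib_left by (intro sum.cong) (auto simp: power2_eq_square)
    also have "\<dots> \<le> (\<Sum>z\<in>Z. x z * (b + (\<Sum>w\<in>Z \<inter> N z. x w)))"
    proof (intro sum_mono mult_left_mono x(1))
      fix z assume z: "z \<in> Z"
      show "?r * x z \<le> b + (\<Sum>w\<in>Z \<inter> N z. x w)"
        using eig[OF Zu(3)[OF z]] hubz[OF z] WN[OF Zu(1,2)[OF z]] unfolding b_def distrib_left by linarith
    qed
    also have "\<dots> = b * s + bform G Z Z x" unfolding bZZ s_def by (simp add: distrib_left sum.distrib sum_distrib_left mult_ac)
    finally show ?thesis using qZ unfolding qb by simp
  qed
  \<comment> \<open>Cauchy-Schwarz turns the bound on the squares into one on the sum, with card Z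
    \<le> 0.023 * n \<le> 0.012 * ?r^2.\<close>
  have sle: "s \<le> 15 / 1000 * ?r * b"
  proof (cases "s = 0")
    case True then show ?thesis using pos r0 by simp
  next
    case False
    then have sp: "s > 0" using pos by simp
    have "4 / 5 * ?r * (s * s) \<le> 4 / 5 * ?r * (card Z * nsq Z x)"
      using sum_square_le[of x Z] r0 unfolding s_def nsq_def power2_eq_square by (intro mult_left_mono) auto
    also have "\<dots> = card Z * (4 / 5 * ?r * nsq Z x)" by simp
    also have "\<dots> \<le> card Z * (b * s)" using zeta by (intro mult_left_mono) auto
    finally have "(4 / 5 * ?r * s) * s \<le> (card Z * b) * s" by (simp add: mult_ac)
    then have "4 / 5 * ?r * s \<le> card Z * b" using sp by (subst (asm) mult_le_cancel_right) auto
    also have "\<dots> \<le> (23 / 1000 * n) * b" using cZ pos by (intro mult_right_mono) auto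
    also have "\<dots> \<le> (12 / 1000 * (?r * ?r)) * b" using r2 pos hn by (intro mult_right_mono) auto
    finally have "(4 / 5 * s) * ?r \<le> (12 / 1000 * ?r * b) * ?r" by (simp add: mult_ac)
    then have "4 / 5 * s \<le> 12 / 1000 * ?r * b" using r0 by (subst (asm) mult_le_cancel_right) auto
    then show ?thesis by linarith
  qed
  \<comment> \<open>The equation at \<open>m\<close>, the vertex of \<open>W\<close> with the
    largest entry: it receives from the two hubs, from at most two vertices of \<open>W\<close>, and
    from \<open>Z\<close>.\<close>
  have Mle: "M \<le> 2 / 100 * X1"
  proof -
    have "(\<Sum>w\<in>Z \<inter> N m. x w) \<le> s" unfolding s_def using fins x(1) by (intro sum_mono2) auto
    moreover have "adj G m u \<le> 1" "adj G m v \<le> 1" unfolding adj_def by auto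
    then have "adj G m u * x u \<le> x u" "adj G m v * x v \<le> x v"
      using mult_right_mono[of "adj G m u" 1 "x u"] mult_right_mono[of "adj G m v" 1 "x v"] x(1) by auto
    ultimately have "?r * M \<le> 2 * X1 + 2 * M + s"
      using eig[OF Wu(3)[OF m(1)]] WN[OF Wu(1,2)[OF m(1)]] X unfolding M_def by linarith
    also have "\<dots> \<le> ?r * (2 / 1000 * X1) + ?r * (2 / 1000 * M) + 15 / 1000 * ?r * b"
      using sle mult_right_mono[OF r0(1), of "2 / 1000 * X1"] mult_right_mono[OF r0(1), of "2 / 1000 * M"] pos by simp
    finally have "?r * M \<le> ?r * (2 / 1000 * X1 + 2 / 1000 * M + 15 / 1000 * b)" by (simp add: algebra_simps)
    then have "M \<le> 2 / 1000 * X1 + 2 / 1000 * M + 15 / 1000 * b" using r0 by (subst (asm) mult_le_cancel_left) auto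
    then show ?thesis using pos unfolding b_def distrib_left by linarith
  qed
  \<comment> \<open>Both hubs see all of \<open>W\<close>, so their equations differ only in the
    edge between them and in \<open>Z\<close>.\<close>
  have X12: "98 / 100 * X1 \<le> X2"
  proof -
    have hub: "?r * x p \<le> x q + (\<Sum>w\<in>W. x w) + s" "?r * x p \<ge> (\<Sum>w\<in>W. x w)" if pq: "(p, q) = (u, v) \<or> (p, q) = (v, u)" for p q
    proof -
      have W: "W \<inter> N p = W" using pq unfolding W_def by auto
      have "adj G u u = 0" "adj G v v = 0" unfolding adj_def using edgeD[of u u] edgeD[of v v] by auto
      moreover have "adj G u v \<le> 1" "adj G v u \<le> 1" "adj G u v \<ge> 0" "adj G v u \<ge> 0" unfolding adj_def by auto
      then have "adj G u v * x v \<le> x v" "adj G v u * x u \<le> x u" "0 \<le> adj G u v * x v" "0 \<le> adj G v u * x u"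
        using mult_right_mono[of "adj G u v" 1 "x v"] mult_right_mono[of "adj G v u" 1 "x u"] x(1) by auto
      moreover have "(\<Sum>w\<in>Z \<inter> N p. x w) \<le> s" unfolding s_def using fins x(1) by (intro sum_mono2) auto
      moreover have "0 \<le> (\<Sum>w\<in>Z \<inter> N p. x w)" using x(1) by (intro sum_nonneg) auto
      ultimately show "?r * x p \<le> x q + (\<Sum>w\<in>W. x w) + s" "?r * x p \<ge> (\<Sum>w\<in>W. x w)"
        using eig[of p] uv pq W by auto
    qed
    have "?r * X1 \<le> X2 + (\<Sum>w\<in>W. x w) + s" "?r * X2 \<ge> (\<Sum>w\<in>W. x w)"
      using hub[of u v] hub[of v u] unfolding X1_def X2_def by (auto simp: max_def min_def)
    then have "?r * (X1 - X2) \<le> X1 + s" using X by (simp add: algebra_simps)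
    also have "\<dots> \<le> ?r * (1 / 1000 * X1) + 15 / 1000 * ?r * b"
      using sle mult_right_mono[OF r0(1), of "1 / 1000 * X1"] pos by simp
    also have "\<dots> = ?r * (1 / 1000 * X1 + 15 / 1000 * b)" by (simp add: algebra_simps)
    finally have "X1 - X2 \<le> 1 / 1000 * X1 + 15 / 1000 * b" using r0 by (subst (asm) mult_le_cancel_left) auto
    then show ?thesis using Mle pos unfolding b_def distrib_left by linarith
  qed
  have X1p: "X1 > 0"
  proof (rule ccontr)
    assume "\<not> X1 > 0"
    then have z: "X1 = 0" using pos by simp
    then have "M = 0" using Mle pos by simp
    then have "s = 0" using sle pos z unfolding b_def by simp
    have "x a = 0" if "a \<in> V" for a
    proof -
      have "x a \<le> 0"
      proof -
        have "a \<in> {u, v} \<union> W \<union> Z" using that VU unfolding U_def by simp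
        then consider "a = u" | "a = v" | "a \<in> W" | "a \<in> Z" by blast
        then show ?thesis
        proof cases
          case 1 then show ?thesis using X(1) z by simp
        next
          case 2 then show ?thesis using X(2) z by simp
        next
          case 3 then show ?thesis using m(2)[OF 3] \<open>M = 0\<close> unfolding M_def by simp
        next
          case 4 then show ?thesis
            using \<open>s = 0\<close> sum_nonneg_eq_0_iff[OF fins(3), of x] x(1) unfolding s_def by simp
        qed
      qed
      then show ?thesis using x(1)[of a] by simp
    qed
    then show False using x(2) unfolding nsq_def by simp
  qed
  let ?H = "hub_completion G u v W"
  have inH: "{a, c} \<in> edges ?H \<longleftrightarrow> {a, c} \<in> edges G \<and> a \<in> W \<and> c \<in> W \<or> {a, c} = {u, v} \<or>
      (a = u \<or> a = v) \<and> c \<in> W \<union> Z \<or> (c = u \<or> c = v) \<and> a \<in> W \<union> Z" for a c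
  proof -
    have D: "V - {u, v} = W \<union> Z" unfolding Z_def U_def W_def using NV uN by blast
    have 1: "{a, c} \<in> {{p, w} | w. w \<in> W \<union> Z} \<longleftrightarrow> a = p \<and> c \<in> W \<union> Z \<or> c = p \<and> a \<in> W \<union> Z" for p
    proof
      assume "{a, c} \<in> {{p, w} | w. w \<in> W \<union> Z}"
      then obtain w where "{a, c} = {p, w}" "w \<in> W \<union> Z" by blast
      then show "a = p \<and> c \<in> W \<union> Z \<or> c = p \<and> a \<in> W \<union> Z" by (simp add: doubleton_eq_iff) blast
    qed (auto simp: insert_commute)
    have 2: "{a, c} \<in> {e \<in> edges G. e \<subseteq> W} \<longleftrightarrow> {a, c} \<in> edges G \<and> a \<in> W \<and> c \<in> W" by simp
    show ?thesis unfolding edges_hub_completion D Un_iff[of "{a, c}"] 1 2 singleton_iff by argo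
  qed
  have WZ: "u \<notin> W" "v \<notin> W" "u \<notin> Z" "v \<notin> Z" using Wu Zu by blast+
  have hUU: "bform ?H U U x = 2 * (x u * x v)"
    using uv(3) WZ inH[of u v] inH[of v u] inH[of u u] inH[of v v] unfolding bform_def U_def adj_def by (simp add: insert_commute)
  have hWW: "bform ?H W W x = bform G W W x"
    unfolding bform_def
  proof (intro sum.cong refl)
    fix p q assume "p \<in> W" "q \<in> W"
    then have "adj ?H p q = adj G p q" using inH[of p q] WZ dis unfolding adj_def by (auto simp: doubleton_eq_iff)
    then show "adj ?H p q * x p * x q = adj G p q * x p * x q" by simp
  qed
  have hUW: "bform ?H U W x = bform G U W x"
    unfolding bform_def
  proof (intro sum.cong refl)
    fix p q assume pq: "p \<in> U" "q \<in> W"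
    then have "adj ?H p q = 1" using inH[of p q] unfolding adj_def U_def by auto
    moreover have "adj G p q = 1" using pq adj_nbrs[of p q] uv unfolding U_def W_def by auto
    ultimately show "adj ?H p q * x p * x q = adj G p q * x p * x q" by simp
  qed
  have hWZ: "bform ?H W Z x = 0"
    unfolding bform_def
  proof (intro sum.neutral ballI)
    fix p q assume "p \<in> W" "q \<in> Z"
    then have "adj ?H p q = 0" using inH[of p q] WZ dis unfolding adj_def by (auto simp: doubleton_eq_iff)
    then show "adj ?H p q * x p * x q = 0" by simp
  qed
  have hZZ: "bform ?H Z Z x = 0"
    unfolding bform_def
  proof (intro sum.neutral ballI)
    fix p q assume "p \<in> Z" "q \<in> Z"
    then have "adj ?H p q = 0" using inH[of p q] WZ dis unfolding adj_def by (auto simp: doubleton_eq_iff)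
    then show "adj ?H p q * x p * x q = 0" by simp
  qed
  have hUZ: "bform ?H U Z x = (X1 + X2) * s"
  proof -
    have "bform ?H U Z x = (\<Sum>p\<in>U. \<Sum>q\<in>Z. x p * x q)"
      unfolding bform_def
    proof (intro sum.cong refl)
      fix p q assume pq: "p \<in> U" "q \<in> Z"
      then have "adj ?H p q = 1" using inH[of p q] unfolding adj_def U_def by auto
      then show "adj ?H p q * x p * x q = x p * x q" by simp
    qed
    also have "\<dots> = (x u + x v) * s" using uv(3) unfolding U_def s_def by (simp add: sum_distrib_left[symmetric] distrib_right)
    finally show ?thesis using X by simp
  qed
  have gUU: "bform G U U x = 2 * (adj G u v * (x u * x v))"
  proof -
    have "adj G u u = 0" "adj G v v = 0" unfolding adj_def using edgeD[of u u] edgeD[of v v] by auto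
    then show ?thesis using uv(3) adj_sym[of G v u] unfolding bform_def U_def by (simp add: mult_ac)
  qed
  have gUZ: "bform G U Z x \<le> X1 * s"
  proof -
    have "bform G U Z x = bform G Z U x" by (rule bform_sym)
    also have "\<dots> = (\<Sum>z\<in>Z. (adj G z u * x u + adj G z v * x v) * x z)"
      unfolding bform_def U_def using uv(3) by (intro sum.cong) (auto simp: algebra_simps)
    also have "\<dots> \<le> (\<Sum>z\<in>Z. X1 * x z)" using hubz x(1) by (intro sum_mono mult_right_mono) auto
    finally show ?thesis unfolding s_def by (simp add: sum_distrib_left)
  qed
  have gWZ: "bform G W Z x \<le> 2 * M * s"
  proof -
    have "bform G W Z x = bform G Z W x" by (rule bform_sym)
    also have "\<dots> = (\<Sum>z\<in>Z. (\<Sum>w\<in>W \<inter> N z. x w) * x z)"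
      unfolding bform_def
    proof (intro sum.cong refl)
      fix z assume "z \<in> Z"
      then have "(\<Sum>w\<in>W. adj G z w * x w) = (\<Sum>w\<in>W \<inter> N z. x w)" using sum_adj[of W z x] Zu VU by auto
      moreover have "(\<Sum>q\<in>W. adj G z q * x z * x q) = (\<Sum>w\<in>W. adj G z w * x w) * x z" by (simp add: sum_distrib_left mult_ac)
      ultimately show "(\<Sum>q\<in>W. adj G z q * x z * x q) = (\<Sum>w\<in>W \<inter> N z. x w) * x z" by simp
    qed
    also have "\<dots> \<le> (\<Sum>z\<in>Z. (2 * M) * x z)" using WN Zu x(1) by (intro sum_mono mult_right_mono) auto
    finally show ?thesis unfolding s_def by (simp add: sum_distrib_left)
  qed
  have gZZ: "bform G Z Z x \<le> b * s / 4" using qZ zeta unfolding qb by simp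
  \<comment> \<open>All hub edges at \<open>Z\<close> together are worth
    \<open>(X1 + X2) * s\<close>; given up are at most \<open>X1 * s\<close> at the hubs,
    \<open>2 * M * s\<close> towards \<open>W\<close> and \<open>b * s / 4\<close> inside
    \<open>Z\<close>. Apart from the edge between the hubs, the net gain in the form is at least
    \<open>(2 * X2 - b / 4 - 4 * M) * s\<close>.\<close>
  have gap: "qform (adj ?H) V x - qform (adj G) V x \<ge> 2 * (1 - adj G u v) * (x u * x v) + X1 * s"
  proof -
    have "qform (adj ?H) V x - qform (adj G) V x \<ge>
        2 * (x u * x v) + 2 * ((X1 + X2) * s) - 2 * (adj G u v * (x u * x v)) - b * s / 4 - 2 * (X1 * s) - 2 * (2 * M * s)"
      unfolding VU qform_three_blocks[OF fins dis] hUU hWW hUW hWZ hZZ hUZ gUU using gUZ gWZ gZZ by linarith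
    moreover have "X1 * s \<le> (2 * X2 - b / 4 - 4 * M) * s"
    proof (intro mult_right_mono)
      show "X1 \<le> 2 * X2 - b / 4 - 4 * M"
        using X12 Mle pos(1,2) unfolding b_def add_divide_distrib by linarith
    qed (rule pos(4))
    ultimately show ?thesis by (simp add: algebra_simps)
  qed
  have a01: "adj G u v = 0 \<or> adj G u v = 1" unfolding adj_def by auto
  have xuv: "x u * x v > 0" using X X12 X1p by (intro mult_pos_pos) linarith+
  have le: "qform (adj ?H) V y \<le> spectral_radius ?H * nsq V y" for y
    using spectral_radius_rayleigh(1)[of ?H y] fin ne by simp
  have "G = ?H \<or> ?r < spectral_radius ?H"
  proof (cases "?r < spectral_radius ?H")
    case False
    have qle: "qform (adj ?H) V x \<le> ?r" using le[of x] x(2) False by simp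
    have X1s: "X1 * s \<ge> 0" using X1p pos by simp
    have a1: "adj G u v = 1"
    proof (rule ccontr)
      assume "adj G u v \<noteq> 1"
      then have "adj G u v = 0" using a01 by simp
      then show False using gap qle qx xuv X1s by simp
    qed
    then have "X1 * s \<le> 0" using gap qle qx by simp
    then have s0: "s = 0" using X1p pos by (simp add: mult_le_0_iff)
    then have "qform (adj ?H) V x \<ge> ?r" using gap a1 qx by simp
    then have eqx: "qform (adj ?H) V x = spectral_radius ?H * nsq V x" using le[of x] x(2) False qle by simp
    \<comment> \<open>Now \<open>x\<close> is an eigenvector of the completed graph too. Its entry
      at a vertex of \<open>Z\<close> is 0, but there that vertex is adjacent to \<open>u\<close>,
      whose entry is positive.\<close>
    have "Z = {}"
    proof (rule ccontr)
      assume "Z \<noteq> {}"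
      then obtain z where z: "z \<in> Z" by blast
      have "(\<Sum>w\<in>V. adj ?H z w * x w) = spectral_radius ?H * x z"
        by (rule maximiser_eigenvector[OF fin adj_sym le eqx]) (use Zu z in auto)
      moreover have "x z = 0" using s0 fins(3) x(1) z unfolding s_def by (simp add: sum_nonneg_eq_0_iff)
      moreover have "(\<Sum>w\<in>V. adj ?H z w * x w) \<ge> adj ?H z u * x u"
        using fin uv(1) x(1) adj_nonneg by (intro member_le_sum) auto
      moreover have "adj ?H z u = 1" using inH[of z u] z unfolding adj_def by auto
      ultimately have "x u \<le> 0" by simp
      then show False using X X12 X1p by linarith
    qed
    have "edges G = edges ?H"
    proof (intro set_eqI iffI)
      fix e assume e: "e \<in> edges G"
      then obtain a c where ac: "e = {a, c}" using simple unfolding simple_graph_def by blast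
      have "a \<in> U \<union> W" "c \<in> U \<union> W" "a \<noteq> c" using edgeD[of a c] e ac VU \<open>Z = {}\<close> by auto
      then show "e \<in> edges ?H" using e inH[of a c] unfolding ac U_def by auto
    next
      fix e assume e: "e \<in> edges ?H"
      then obtain a c where ac: "e = {a, c}" "e \<in> edges G \<or> e = {u, v} \<or> (a = u \<or> a = v) \<and> c \<in> V - {u, v}"
        unfolding edges_hub_completion by auto (use simple in \<open>auto simp: simple_graph_def\<close>)
      have "V - {u, v} = W" using VU dis \<open>Z = {}\<close> unfolding U_def by auto
      moreover have "{u, v} \<in> edges G" using a1 unfolding adj_def by (auto split: if_splits)
      moreover have "{u, w} \<in> edges G" "{v, w} \<in> edges G" if "w \<in> W" for w using that unfolding W_def nbrs_def by auto
      ultimately show "e \<in> edges G" using ac by auto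
    qed
    moreover have "verts G = verts ?H" by simp
    ultimately have "G = ?H" unfolding verts_def edges_def by (rule prod_eqI[rotated])
    then show ?thesis ..
  qed simp
  then show ?thesis using that[of u v] uv unfolding W_def by blast
qed

end

section \<open>Joining two hubs to a linear forest\<close>

definition pedges :: "nat list \<Rightarrow> nat set set" where
  "pedges ps = {{ps ! j, ps ! Suc j} | j. Suc j < length ps}"

lemma gpath_nth: "gpath E ps \<longleftrightarrow> distinct ps \<and> (\<forall>i. Suc i < length ps \<longrightarrow> {ps ! i, ps ! Suc i} \<in> E)"
  unfolding gpath_def successively_conv_nth by simp

text \<open>A longest path in \<open>W\<close> is a whole component: its ends cannot be prolonged,
  its interior vertices already have two neighbours on it, and a chord would close a cycle. Removing
  it leaves a smaller set with the same properties.\<close>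

lemma linear_forest:
  assumes "finite W" "\<And>a b. {a, b} \<in> E \<Longrightarrow> a \<noteq> b"
    and "\<And>w. w \<in> W \<Longrightarrow> card {x \<in> W. {w, x} \<in> E} \<le> 2"
    and "\<And>cs. gpath E cs \<Longrightarrow> length cs \<ge> 3 \<Longrightarrow> set cs \<subseteq> W \<Longrightarrow> {last cs, hd cs} \<notin> E"
  shows "\<exists>pss. distinct (concat pss) \<and> set (concat pss) = W \<and> [] \<notin> set pss \<and>
     (\<forall>a\<in>W. \<forall>b\<in>W. {a, b} \<in> E \<longleftrightarrow> (\<exists>ps\<in>set pss. {a, b} \<in> pedges ps))"
  using assms
proof (induction "card W" arbitrary: W rule: less_induct)
  case less
  show ?case
  proof (cases "W = {}")
    case True
    then show ?thesis by (intro exI[of _ "[]"]) auto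
  next
    case False
    then obtain w0 where w0: "w0 \<in> W" by blast
    let ?P = "\<lambda>ps. gpath E ps \<and> set ps \<subseteq> W \<and> ps \<noteq> []"
    have "?P [w0]" using w0 by (simp add: gpath_def)
    moreover have "\<forall>ps. ?P ps \<longrightarrow> length ps < Suc (card W)"
      using card_mono[OF less.prems(1)] by (auto simp: gpath_def distinct_card[symmetric] less_Suc_eq_le)
    ultimately obtain ps where ps: "?P ps" and mx: "\<And>qs. ?P qs \<Longrightarrow> length qs \<le> length ps"
      using ex_has_greatest_nat[of ?P "[w0]" length "Suc (card W)"] by blast
    let ?n = "length ps"
    have d: "distinct ps" and ed: "\<And>i. Suc i < ?n \<Longrightarrow> {ps ! i, ps ! Suc i} \<in> E" and sub: "set ps \<subseteq> W" and ne: "ps \<noteq> []"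
      using ps unfolding gpath_nth by auto
    have inW: "ps ! i \<in> W" if "i < ?n" for i using sub that by auto
    have interior: "y = ps ! (i - 1) \<or> y = ps ! Suc i"
      if i: "0 < i" "Suc i < ?n" and y: "y \<in> W" "{ps ! i, y} \<in> E" for i y
    proof -
      let ?N = "{x \<in> W. {ps ! i, x} \<in> E}"
      have "ps ! (i - 1) \<noteq> ps ! Suc i" using d i by (simp add: nth_eq_iff_index_eq)
      then have "card {ps ! (i - 1), ps ! Suc i} = 2" by simp
      moreover have "{ps ! (i - 1), ps ! Suc i} \<subseteq> ?N"
        using ed[of "i - 1"] ed[of i] inW i by (auto simp: insert_commute)
      moreover have "finite ?N" "card ?N \<le> 2" using less.prems(1) less.prems(3)[OF inW[of i]] i by auto
      ultimately have "{ps ! (i - 1), ps ! Suc i} = ?N" by (intro card_seteq) auto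
      then show ?thesis using y by blast
    qed
    have closed: "y \<in> set ps" if x: "x \<in> set ps" and y: "y \<in> W" "{x, y} \<in> E" for x y
    proof (rule ccontr)
      assume ny: "y \<notin> set ps"
      obtain i where i: "i < ?n" "x = ps ! i" using x by (auto simp: in_set_conv_nth)
      consider "i = 0" | "Suc i = ?n" | "0 < i" "Suc i < ?n" using i by linarith
      then show False
      proof cases
        case 1
        have "gpath E (y # ps)" using ps ny y(2) i 1 ne
          by (cases ps) (auto simp: gpath_def insert_commute)
        then show False using mx[of "y # ps"] y(1) sub by simp
      next
        case 2
        then have "x = last ps" using i ne by (simp add: last_conv_nth flip: 2)
        then have "gpath E (ps @ [y])" using ps ny y(2) ne by (auto simp: gpath_def successively_append_iff)
        then show False using mx[of "ps @ [y]"] y(1) sub by simp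
      next
        case 3
        then show False using interior[OF 3 y(1)] y(2) i ny by (auto simp: less_imp_diff_less)
      qed
    qed
    \<comment> \<open>An edge between path vertices that are not consecutive could only join the two
      ends, which closes a cycle when the path has at least three vertices.\<close>
    have inner: "j = Suc i" if ij: "i < j" "j < ?n" and e: "{ps ! i, ps ! j} \<in> E" for i j
    proof -
      consider "0 < i" | "Suc j < ?n" | "i = 0" "Suc j = ?n" using ij by linarith
      then show ?thesis
      proof cases
        case 1
        have "ps ! j = ps ! (i - 1) \<or> ps ! j = ps ! Suc i" using interior[OF 1 _ inW[OF ij(2)] e] ij by simp
        then show ?thesis using d ij by (auto simp: nth_eq_iff_index_eq)
      next
        case 2
        have "ps ! i = ps ! (j - 1) \<or> ps ! i = ps ! Suc j"
          using interior[of j "ps ! i"] 2 inW[of i] e ij by (simp add: insert_commute)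
        then show ?thesis using d ij 2 by (auto simp: nth_eq_iff_index_eq)
      next
        case 3
        have "\<not> ?n \<ge> 3"
        proof
          assume n3: "?n \<ge> 3"
          have "j = ?n - 1" using 3 by simp
          then have "last ps = ps ! j" "hd ps = ps ! i" using ne 3 by (simp_all add: last_conv_nth hd_conv_nth)
          then show False using less.prems(4)[of ps] ps e n3 by (simp add: insert_commute)
        qed
        then show ?thesis using 3 ij by linarith
      qed
    qed
    let ?W = "W - set ps"
    have "?W \<subset> W" using sub hd_in_set[OF ne] by blast
    then have cW: "card ?W < card W" by (rule psubset_card_mono[OF less.prems(1)])
    have "\<exists>qss. distinct (concat qss) \<and> set (concat qss) = ?W \<and> [] \<notin> set qss \<and>
       (\<forall>a\<in>?W. \<forall>b\<in>?W. {a, b} \<in> E \<longleftrightarrow> (\<exists>ps\<in>set qss. {a, b} \<in> pedges ps))"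
    proof (rule less.hyps[OF cW])
      show "finite ?W" using less.prems(1) by simp
      fix w assume w: "w \<in> ?W"
      have "card {x \<in> ?W. {w, x} \<in> E} \<le> card {x \<in> W. {w, x} \<in> E}" using less.prems(1) by (intro card_mono) auto
      then show "card {x \<in> ?W. {w, x} \<in> E} \<le> 2" using less.prems(3)[of w] w by simp
    next
      fix cs assume "gpath E cs" "length cs \<ge> 3" "set cs \<subseteq> ?W"
      then show "{last cs, hd cs} \<notin> E" using less.prems(4)[of cs] by blast
    qed (rule less.prems(2))
    then obtain qss where q: "distinct (concat qss)" "set (concat qss) = ?W" "[] \<notin> set qss"
       "\<forall>a\<in>?W. \<forall>b\<in>?W. {a, b} \<in> E \<longleftrightarrow> (\<exists>ps\<in>set qss. {a, b} \<in> pedges ps)" by (elim exE conjE)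
    have pe: "{a, b} \<in> pedges qs \<Longrightarrow> a \<in> set qs \<and> b \<in> set qs" for a b qs
      unfolding pedges_def by (auto simp: doubleton_eq_iff)
    have "{a, b} \<in> E \<longleftrightarrow> (\<exists>qs\<in>set (ps # qss). {a, b} \<in> pedges qs)" if ab: "a \<in> W" "b \<in> W" for a b
    proof (cases "a \<in> set ps \<or> b \<in> set ps")
      case True
      have "{a, b} \<notin> pedges qs" if "qs \<in> set qss" for qs using pe[of a b qs] True q(2) that by auto
      moreover have "{a, b} \<in> E \<longleftrightarrow> {a, b} \<in> pedges ps"
      proof
        assume e: "{a, b} \<in> E"
        then have "a \<in> set ps" "b \<in> set ps" using True closed[of a b] closed[of b a] ab by (auto simp: insert_commute)
        then obtain i j where ij: "i < ?n" "j < ?n" "a = ps ! i" "b = ps ! j" by (auto simp: in_set_conv_nth)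
        have "i \<noteq> j" using less.prems(2)[OF e] ij by auto
        moreover have "{ps ! i, ps ! j} \<in> E" "{ps ! j, ps ! i} \<in> E" using e ij by (simp_all add: insert_commute)
        ultimately have "j = Suc i \<or> i = Suc j" using inner[of i j] inner[of j i] ij(1,2) by linarith
        then show "{a, b} \<in> pedges ps" unfolding pedges_def using ij by (auto simp: insert_commute)
      qed (use ed in \<open>auto simp: pedges_def\<close>)
      ultimately show ?thesis by auto
    next
      case False
      then have "{a, b} \<notin> pedges ps" using pe[of a b ps] by auto
      then show ?thesis using q(4) ab False by auto
    qed
    then show ?thesis using d q sub ne by (intro exI[of _ "ps # qss"]) auto
  qed
qed

text \<open>A presentation by ordered vertex lists, so that a vertex is identified by its position
  and graphs with equal lists of lengths can be matched position by position.\<close>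

definition hub_graph :: "graph \<Rightarrow> nat \<Rightarrow> nat \<Rightarrow> nat list list \<Rightarrow> bool" where
  "hub_graph G u v pss \<longleftrightarrow> distinct (u # v # concat pss) \<and> verts G = insert u (insert v (set (concat pss))) \<and>
     edges G = {{u, v}} \<union> {{u, w} | w. w \<in> set (concat pss)} \<union> {{v, w} | w. w \<in> set (concat pss)} \<union>
       (\<Union>ps\<in>set pss. pedges ps)"

lemma hub_graph_perm:
  assumes "hub_graph G u v pss" "mset pss = mset pss'"
  shows "hub_graph G u v pss'"
proof -
  have s: "set pss = set pss'" using assms(2) by (metis set_mset_mset)
  have "mset (concat pss) = mset (concat pss')"
  proof -
    have "mset (map mset pss) = mset (map mset pss')" using assms(2) by simp
    then show ?thesis unfolding mset_concat by (metis sum_mset_sum_list)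
  qed
  then have "distinct (concat pss') = distinct (concat pss)" using mset_eq_imp_distinct_iff by blast
  moreover have "set (concat pss') = set (concat pss)" using s by simp
  ultimately show ?thesis using assms(1) s unfolding hub_graph_def by simp
qed

lemma concat_nth_inj:
  assumes "distinct (concat pss)" "k < length pss" "j < length (pss ! k)" "k' < length pss" "j' < length (pss ! k')"
    "pss ! k ! j = pss ! k' ! j'"
  shows "k = k' \<and> j = j'"
  using assms
proof (induction pss arbitrary: k k')
  case Nil then show ?case by simp
next
  case (Cons ps pss)
  have m: "pss ! i ! l \<in> set (concat pss)" if "i < length pss" "l < length (pss ! i)" for i l
    using that by (auto intro: bexI[of _ "pss ! i"])
  show ?case
  proof (cases k; cases k')
    assume "k = 0" "k' = 0"
    then show ?thesis using Cons.prems by (simp add: nth_eq_iff_index_eq)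
  next
    fix i assume k: "k = 0" "k' = Suc i"
    have "ps ! j \<in> set ps" by (rule nth_mem) (use Cons.prems k in simp)
    moreover have "pss ! i ! j' \<in> set (concat pss)" by (rule m) (use Cons.prems k in simp_all)
    moreover have "ps ! j = pss ! i ! j'" using Cons.prems(6) k by simp
    moreover have "set ps \<inter> set (concat pss) = {}" using Cons.prems(1) by simp
    ultimately show ?thesis by (metis IntI empty_iff)
  next
    fix i assume k: "k = Suc i" "k' = 0"
    have "ps ! j' \<in> set ps" by (rule nth_mem) (use Cons.prems k in simp)
    moreover have "pss ! i ! j \<in> set (concat pss)" by (rule m) (use Cons.prems k in simp_all)
    moreover have "ps ! j' = pss ! i ! j" using Cons.prems(6) k by simp
    moreover have "set ps \<inter> set (concat pss) = {}" using Cons.prems(1) by simp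
    ultimately show ?thesis by (metis IntI empty_iff)
  next
    fix i i' assume "k = Suc i" "k' = Suc i'"
    then show ?thesis using Cons.IH[of i i'] Cons.prems by simp
  qed
qed

lemma in_concat_nth:
  "w \<in> set (concat pss) \<longleftrightarrow> (\<exists>k j. k < length pss \<and> j < length (pss ! k) \<and> w = pss ! k ! j)"
proof
  assume "w \<in> set (concat pss)"
  then obtain ps where "ps \<in> set pss" "w \<in> set ps" by auto
  then show "\<exists>k j. k < length pss \<and> j < length (pss ! k) \<and> w = pss ! k ! j" by (metis in_set_conv_nth)
next
  assume "\<exists>k j. k < length pss \<and> j < length (pss ! k) \<and> w = pss ! k ! j"
  then obtain k j where "k < length pss" "j < length (pss ! k)" "w = pss ! k ! j" by (elim exE conjE)
  then have "pss ! k \<in> set pss" "w \<in> set (pss ! k)" by simp_all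
  then show "w \<in> set (concat pss)" unfolding set_concat by blast
qed

lemma hub_graph_edge_cases:
  assumes "hub_graph G u v pss" "e \<in> edges G"
  obtains "e = {u, v}" | k j where "k < length pss" "j < length (pss ! k)" "e = {u, pss ! k ! j} \<or> e = {v, pss ! k ! j}"
   | k j where "k < length pss" "Suc j < length (pss ! k)" "e = {pss ! k ! j, pss ! k ! Suc j}"
proof -
  have *: "\<exists>k j. k < length pss \<and> j < length (pss ! k) \<and> w = pss ! k ! j" if "w \<in> set (concat pss)" for w
    using that unfolding in_concat_nth .
  consider "e = {u, v}" | w where "w \<in> set (concat pss)" "e = {u, w} \<or> e = {v, w}"
    | ps where "ps \<in> set pss" "e \<in> pedges ps"
    using assms unfolding hub_graph_def by blast
  then show ?thesis
  proof cases
    case 1 then show ?thesis using that(1) by blast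
  next
    case 2 then show ?thesis using *[OF 2(1)] that(2) by blast
  next
    case 3
    then obtain k where "k < length pss" "ps = pss ! k" by (auto simp: in_set_conv_nth)
    then show ?thesis using 3(2) that(3) unfolding pedges_def by blast
  qed
qed

lemma hub_graph_isomorphic:
  assumes G: "hub_graph G u v pss" and G': "hub_graph G' u' v' pss'" and len: "map length pss = map length pss'"
  shows "isomorphic G G'"
proof -
  have l: "length pss = length pss'" using len by (metis length_map)
  have lk: "length (pss ! k) = length (pss' ! k)" if "k < length pss" for k
    using len that l by (metis nth_map)
  \<comment> \<open>The vertex at position (k, j) goes to the vertex at the same position;
    \<open>concat_nth_inj\<close> makes the choice unique. Both presentations are parameters because
    the inverse map has the same form.\<close>
  define F where "F ps' qs' a b a' b' x = (if x = a then a' else if x = b then b' else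
     (SOME y. \<exists>k j. k < length ps' \<and> j < length (ps' ! k) \<and> x = ps' ! k ! j \<and> y = qs' ! k ! j))"
    for ps' qs' :: "nat list list" and a b a' b' x :: nat
  have F: "F ps' qs' a b a' b' a = a'" "F ps' qs' a b a' b' b = b'"
     "k < length ps' \<Longrightarrow> j < length (ps' ! k) \<Longrightarrow> F ps' qs' a b a' b' (ps' ! k ! j) = qs' ! k ! j"
    if dist: "distinct (a # b # concat ps')" for ps' qs' a b a' b' k j
  proof -
    show "F ps' qs' a b a' b' a = a'" "F ps' qs' a b a' b' b = b'" using dist unfolding F_def by auto
    assume kj: "k < length ps'" "j < length (ps' ! k)"
    then have "ps' ! k ! j \<in> set (concat ps')" by (auto intro: bexI[of _ "ps' ! k"])
    then have "ps' ! k ! j \<noteq> a" "ps' ! k ! j \<noteq> b" using dist by auto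
    moreover have "(SOME y. \<exists>k' j'. k' < length ps' \<and> j' < length (ps' ! k') \<and> ps' ! k ! j = ps' ! k' ! j' \<and> y = qs' ! k' ! j') = qs' ! k ! j"
    proof (rule some_equality)
      show "\<exists>k' j'. k' < length ps' \<and> j' < length (ps' ! k') \<and> ps' ! k ! j = ps' ! k' ! j' \<and> qs' ! k ! j = qs' ! k' ! j'"
        using kj by blast
      fix y assume "\<exists>k' j'. k' < length ps' \<and> j' < length (ps' ! k') \<and> ps' ! k ! j = ps' ! k' ! j' \<and> y = qs' ! k' ! j'"
      then obtain k' j' where "k' < length ps'" "j' < length (ps' ! k')" "ps' ! k ! j = ps' ! k' ! j'" "y = qs' ! k' ! j'" by blast
      then show "y = qs' ! k ! j" using concat_nth_inj[of ps' k j k' j'] kj dist by auto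
    qed
    ultimately show "F ps' qs' a b a' b' (ps' ! k ! j) = qs' ! k ! j" unfolding F_def by simp
  qed
  let ?f = "F pss pss' u v u' v'" and ?g = "F pss' pss u' v' u v"
  have d: "distinct (u # v # concat pss)" "distinct (u' # v' # concat pss')" using G G' unfolding hub_graph_def by auto
  have vG: "x = u \<or> x = v \<or> (\<exists>k j. k < length pss \<and> j < length (pss ! k) \<and> x = pss ! k ! j)" if "x \<in> verts G" for x
    using that G unfolding hub_graph_def in_concat_nth[symmetric] by simp
  have vG': "x = u' \<or> x = v' \<or> (\<exists>k j. k < length pss' \<and> j < length (pss' ! k) \<and> x = pss' ! k ! j)" if "x \<in> verts G'" for x
    using that G' unfolding hub_graph_def in_concat_nth[symmetric] by simp
  have nin: "pss ! k ! j \<in> set (concat pss)" if "k < length pss" "j < length (pss ! k)" for k j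
    using that unfolding in_concat_nth by blast
  have nin': "pss' ! k ! j \<in> set (concat pss')" if "k < length pss'" "j < length (pss' ! k)" for k j
    using that unfolding in_concat_nth by blast
  have fv: "?f x \<in> verts G' \<and> ?g (?f x) = x" if "x \<in> verts G" for x
    using vG[OF that]
  proof (elim disjE exE conjE)
    fix k j assume kj: "k < length pss" "j < length (pss ! k)" "x = pss ! k ! j"
    then have kj': "k < length pss'" "j < length (pss' ! k)" using l lk by auto
    then show ?thesis using F(3)[OF d(1) kj(1,2)] F(3)[OF d(2) kj'] nin'[OF kj'] G' kj(3) unfolding hub_graph_def by simp
  qed (use F[OF d(1)] F[OF d(2)] G' in \<open>auto simp: hub_graph_def\<close>)
  have gv: "?g x \<in> verts G \<and> ?f (?g x) = x" if "x \<in> verts G'" for x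
    using vG'[OF that]
  proof (elim disjE exE conjE)
    fix k j assume kj: "k < length pss'" "j < length (pss' ! k)" "x = pss' ! k ! j"
    then have kj': "k < length pss" "j < length (pss ! k)" using l lk by auto
    then show ?thesis using F(3)[OF d(2) kj(1,2)] F(3)[OF d(1) kj'] nin[OF kj'] G kj(3) unfolding hub_graph_def by simp
  qed (use F[OF d(1)] F[OF d(2)] G in \<open>auto simp: hub_graph_def\<close>)
  have fe: "?f ` e \<in> edges G'" if "e \<in> edges G" for e
  proof (rule hub_graph_edge_cases[OF G that])
    assume "e = {u, v}"
    then show ?thesis using F(1,2)[OF d(1)] G' unfolding hub_graph_def by auto
  next
    fix k j assume kj: "k < length pss" "j < length (pss ! k)" "e = {u, pss ! k ! j} \<or> e = {v, pss ! k ! j}"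
    then have "?f ` e = {u', pss' ! k ! j} \<or> ?f ` e = {v', pss' ! k ! j}" using F[OF d(1)] by auto
    moreover have "pss' ! k ! j \<in> set (concat pss')" using nin' kj l lk by simp
    ultimately show ?thesis using G' unfolding hub_graph_def by blast
  next
    fix k j assume kj: "k < length pss" "Suc j < length (pss ! k)" "e = {pss ! k ! j, pss ! k ! Suc j}"
    then have "?f ` e = {pss' ! k ! j, pss' ! k ! Suc j}" using F(3)[OF d(1) kj(1), of j] F(3)[OF d(1) kj(1), of "Suc j"] by simp
    moreover have "pss' ! k \<in> set pss'" "Suc j < length (pss' ! k)" using kj l lk by auto
    ultimately have "?f ` e \<in> (\<Union>ps\<in>set pss'. pedges ps)" unfolding pedges_def by blast
    then show ?thesis using G' unfolding hub_graph_def by simp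
  qed
  have ge: "?g ` e \<in> edges G" if "e \<in> edges G'" for e
  proof (rule hub_graph_edge_cases[OF G' that])
    assume "e = {u', v'}"
    then show ?thesis using F(1,2)[OF d(2)] G unfolding hub_graph_def by auto
  next
    fix k j assume kj: "k < length pss'" "j < length (pss' ! k)" "e = {u', pss' ! k ! j} \<or> e = {v', pss' ! k ! j}"
    then have "?g ` e = {u, pss ! k ! j} \<or> ?g ` e = {v, pss ! k ! j}" using F[OF d(2)] by auto
    moreover have "pss ! k ! j \<in> set (concat pss)" using nin kj l lk by simp
    ultimately show ?thesis using G unfolding hub_graph_def by blast
  next
    fix k j assume kj: "k < length pss'" "Suc j < length (pss' ! k)" "e = {pss' ! k ! j, pss' ! k ! Suc j}"
    then have "?g ` e = {pss ! k ! j, pss ! k ! Suc j}" using F(3)[OF d(2) kj(1), of j] F(3)[OF d(2) kj(1), of "Suc j"] by simp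
    moreover have "pss ! k \<in> set pss" "Suc j < length (pss ! k)" using kj l lk by auto
    ultimately have "?g ` e \<in> (\<Union>ps\<in>set pss. pedges ps)" unfolding pedges_def by blast
    then show ?thesis using G unfolding hub_graph_def by simp
  qed
  show ?thesis
    unfolding isomorphic_def
  proof (intro exI[of _ ?f] conjI ballI)
    show "bij_betw ?f (verts G) (verts G')" by (rule bij_betwI[of _ _ _ ?g]) (use fv gv in auto)
    fix a b assume ab: "a \<in> verts G" "b \<in> verts G"
    show "{a, b} \<in> edges G \<longleftrightarrow> {?f a, ?f b} \<in> edges G'"
    proof
      assume "{a, b} \<in> edges G" then show "{?f a, ?f b} \<in> edges G'" using fe[of "{a, b}"] by simp
    next
      assume "{?f a, ?f b} \<in> edges G'" then show "{a, b} \<in> edges G" using ge[of "{?f a, ?f b}"] fv ab by simp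
    qed
  qed
qed

section \<open>The graphs \<open>K2_join_paths\<close> as hub graphs\<close>

fun blocks :: "nat \<Rightarrow> nat list \<Rightarrow> nat list list" where
  "blocks a [] = []"
| "blocks a (l # ls) = [a..<a + l] # blocks (a + l) ls"

lemma concat_blocks: "concat (blocks a ls) = [a..<a + sum_list ls]"
proof (induction ls arbitrary: a)
  case (Cons l ls)
  then show ?case using upt_add_eq_append[of a "a + l" "sum_list ls"] by (simp add: add.assoc)
qed simp

lemma length_blocks: "map length (blocks a ls) = ls"
  by (induction ls arbitrary: a) simp_all

lemma pedges_upt: "pedges [a..<b] = {{i, Suc i} | i. a \<le> i \<and> Suc i < b}"
  unfolding pedges_def
proof (intro set_eqI iffI)
  fix e assume "e \<in> {{i, Suc i} | i. a \<le> i \<and> Suc i < b}"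
  then obtain i where "e = {i, Suc i}" "a \<le> i" "Suc i < b" by blast
  then show "e \<in> {{[a..<b] ! j, [a..<b] ! Suc j} | j. Suc j < length [a..<b]}"
    by (intro CollectI exI[of _ "i - a"]) auto
qed auto

text \<open>Reconciles the encoding in \<open>paths_graph\<close>, where consecutive numbers are
  joined except across partial sums of the lengths, with the edges of separate blocks. The offset
  \<open>a\<close> is there for the induction.\<close>

lemma pedges_blocks:
  "(\<Union>ps\<in>set (blocks a ls). pedges ps) = {{i, Suc i} | i. a \<le> i \<and> Suc i < a + sum_list ls \<and>
     Suc i \<notin> {a + sum_list (take k ls) | k. k \<le> length ls}}"
proof (induction ls arbitrary: a)
  case Nil then show ?case by auto
next
  case (Cons l ls)
  have sums: "{a + sum_list (take k (l # ls)) | k. k \<le> length (l # ls)} =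
      insert a {a + l + sum_list (take k ls) | k. k \<le> length ls}" (is "?L = ?R")
  proof (intro set_eqI iffI)
    fix x assume "x \<in> ?L"
    then obtain k where k: "k \<le> Suc (length ls)" "x = a + sum_list (take k (l # ls))" by auto
    then show "x \<in> ?R" by (cases k) auto
  next
    fix x assume "x \<in> ?R"
    then consider "x = a" | k where "k \<le> length ls" "x = a + l + sum_list (take k ls)" by blast
    then show "x \<in> ?L"
    proof cases
      case 1 then show ?thesis by (intro CollectI exI[of _ 0]) simp
    next
      case 2 then show ?thesis by (intro CollectI exI[of _ "Suc k"]) simp
    qed
  qed
  have mem: "a + l \<in> {a + l + sum_list (take k ls) | k. k \<le> length ls}" by (intro CollectI exI[of _ 0]) simp
  have ge: "x \<ge> a + l" if "x \<in> {a + l + sum_list (take k ls) | k. k \<le> length ls}" for x using that by auto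
  let ?S = "{a + l + sum_list (take k ls) | k. k \<le> length ls}"
  have "(\<Union>ps\<in>set (blocks a (l # ls)). pedges ps) = {{i, Suc i} | i. a \<le> i \<and> Suc i < a + l} \<union>
     {{i, Suc i} | i. a + l \<le> i \<and> Suc i < a + l + sum_list ls \<and> Suc i \<notin> ?S}"
    by (simp add: Cons.IH pedges_upt)
  also have "\<dots> = {{i, Suc i} | i. a \<le> i \<and> Suc i < a + sum_list (l # ls) \<and> Suc i \<notin> insert a ?S}"
  proof (intro set_eqI iffI)
    fix e assume "e \<in> {{i, Suc i} | i. a \<le> i \<and> Suc i < a + l} \<union>
     {{i, Suc i} | i. a + l \<le> i \<and> Suc i < a + l + sum_list ls \<and> Suc i \<notin> ?S}"
    then obtain i where "e = {i, Suc i}" "a \<le> i \<and> Suc i < a + l \<or> a + l \<le> i \<and> Suc i < a + l + sum_list ls \<and> Suc i \<notin> ?S" by blast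
    then have "e = {i, Suc i}" "a \<le> i" "Suc i < a + sum_list (l # ls)" "Suc i \<notin> insert a ?S" using ge[of "Suc i"] by auto
    then show "e \<in> {{i, Suc i} | i. a \<le> i \<and> Suc i < a + sum_list (l # ls) \<and> Suc i \<notin> insert a ?S}" by blast
  next
    fix e assume "e \<in> {{i, Suc i} | i. a \<le> i \<and> Suc i < a + sum_list (l # ls) \<and> Suc i \<notin> insert a ?S}"
    then obtain i where i: "e = {i, Suc i}" "a \<le> i" "Suc i < a + sum_list (l # ls)" "Suc i \<notin> insert a ?S" by blast
    have "Suc i \<noteq> a + l" using i(4) mem by auto
    then have "a \<le> i \<and> Suc i < a + l \<or> a + l \<le> i \<and> Suc i < a + l + sum_list ls \<and> Suc i \<notin> ?S" using i by auto
    then show "e \<in> {{i, Suc i} | i. a \<le> i \<and> Suc i < a + l} \<union>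
     {{i, Suc i} | i. a + l \<le> i \<and> Suc i < a + l + sum_list ls \<and> Suc i \<notin> ?S}" using i(1) by blast
  qed
  finally show ?case unfolding sums .
qed

lemma hub_graph_K2_join_paths:
  "hub_graph (K2_join_paths ls) (sum_list ls) (sum_list ls + 1) (blocks 0 ls)"
proof -
  let ?s = "sum_list ls"
  have v: "verts (K2_join_paths ls) = {0..<?s + 2}" unfolding K2_join_paths_def verts_def by (simp add: Let_def)
  have e: "edges (K2_join_paths ls) = edges (paths_graph ls) \<union> {{?s, ?s + 1}} \<union> {{?s, v} | v. v < ?s} \<union> {{?s + 1, v} | v. v < ?s}"
    unfolding K2_join_paths_def edges_def by (simp add: Let_def)
  have p: "edges (paths_graph ls) = (\<Union>ps\<in>set (blocks 0 ls). pedges ps)"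
    unfolding pedges_blocks paths_graph_def edges_def by simp
  have c: "concat (blocks 0 ls) = [0..<?s]" using concat_blocks[of 0 ls] by simp
  have "{0..<?s + 2} = insert ?s (insert (?s + 1) {0..<?s})" by auto
  then show ?thesis unfolding hub_graph_def c v e p by (auto simp: Un_ac)
qed

section \<open>Eigenvectors along the paths of a hub graph\<close>

lemma reciprocal_sum_exists:
  fixes r :: real
  assumes "r > 2"
  obtains z where "0 < z" "z < 1" "r = z + 1 / z"
proof -
  define q where "q = sqrt (r\<^sup>2 - 4)"
  have r4: "r\<^sup>2 > 4" using assms power_strict_mono[of 2 r 2] by simp
  have q2: "q\<^sup>2 = r\<^sup>2 - 4" unfolding q_def by (rule real_sqrt_pow2) (use r4 in linarith)
  have q0: "q \<ge> 0" unfolding q_def using r4 by simp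
  have qr: "q < r" using q2 q0 assms power2_less_imp_less[of q r] by simp
  \<comment> \<open>The smaller root of z^2 - r * z + 1 = 0; the roots have product 1, so the larger
    one is 1 / z.\<close>
  define z where "z = (r - q) / 2"
  have z0: "z > 0" unfolding z_def using qr by simp
  have "z * ((r + q) / 2) = (r\<^sup>2 - q\<^sup>2) / 4" unfolding z_def by (simp add: power2_eq_square algebra_simps)
  then have "z * ((r + q) / 2) = 1" using q2 by simp
  then have i: "1 / z = (r + q) / 2" using z0 by (simp add: field_simps)
  have "1 / z > 1" unfolding i using assms q0 by simp
  then have "z < 1" using z0 by (simp add: field_simps)
  moreover have "r = z + 1 / z" unfolding i unfolding z_def by (simp add: field_simps)
  ultimately show ?thesis using that z0 by blast
qed

text \<open>The solution of \<open>r * Y i = Y (i - 1) + Y (i + 1) + 1\<close> for \<open>1 \<le> i \<le> a\<close> with zero boundary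
  values at \<open>0\<close> and \<open>a + 1\<close>, where \<open>r = z + 1 / z\<close>.\<close>
definition path_sol :: "real \<Rightarrow> nat \<Rightarrow> nat \<Rightarrow> real" where
  "path_sol z a i = (1 - (z ^ i + z ^ (Suc a - i)) / (1 + z ^ Suc a)) / (z + 1 / z - 2)"

text \<open>The total of the eigenvector over a path with \<open>a\<close> vertices when the two hub
  entries add up to 1.\<close>

definition path_weight :: "real \<Rightarrow> nat \<Rightarrow> real" where
  "path_weight z a = (\<Sum>j<a. path_sol z a (Suc j))"

lemma path_sol_boundary:
  assumes "z > 0"
  shows "path_sol z a 0 = 0" "path_sol z a (Suc a) = 0"
proof -
  have "1 + z ^ Suc a > 0" using assms by (simp add: add_pos_pos)
  then show "path_sol z a 0 = 0" "path_sol z a (Suc a) = 0" unfolding path_sol_def by (simp_all add: add.commute)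
qed

lemma recip_minus_two: "z > 0 \<Longrightarrow> z + 1 / z - 2 = (1 - z)\<^sup>2 / (z::real)"
  by (simp add: field_simps power2_eq_square)

lemma path_sol_step:
  assumes z: "0 < z" "z < 1" and j: "j < a"
  shows "(z + 1 / z) * path_sol z a (Suc j) = path_sol z a j + path_sol z a (Suc (Suc j)) + 1"
proof -
  let ?r = "z + 1 / z" and ?D = "1 + z ^ Suc a"
  have D: "?D > 0" using z by (simp add: add_pos_pos)
  have r: "?r - 2 \<noteq> 0" using recip_minus_two[OF z(1)] z by simp
  have up: "?r * z ^ Suc j = z ^ j + z ^ Suc (Suc j)" using z by (simp add: field_simps)
  obtain d where d: "a = Suc (j + d)" using j less_iff_Suc_add by auto
  have e: "Suc a - Suc j = Suc d" "Suc a - j = Suc (Suc d)" "Suc a - Suc (Suc j) = d" unfolding d by auto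
  have dn: "?r * z ^ Suc d = z ^ d + z ^ Suc (Suc d)" using z by (simp add: field_simps)
  have "?r * (1 - (z ^ Suc j + z ^ Suc d) / ?D) = ?r - (?r * z ^ Suc j + ?r * z ^ Suc d) / ?D"
    by (simp add: right_diff_distrib distrib_left)
  also have "\<dots> = (1 - (z ^ j + z ^ Suc (Suc d)) / ?D) + (1 - (z ^ Suc (Suc j) + z ^ d) / ?D) + (?r - 2)"
    unfolding up dn by (simp add: add_divide_distrib)
  finally have k: "?r * (1 - (z ^ Suc j + z ^ Suc d) / ?D) = \<dots>" .
  have "?r * path_sol z a (Suc j) = (?r * (1 - (z ^ Suc j + z ^ Suc d) / ?D)) / (?r - 2)"
    unfolding path_sol_def e by simp
  also have "\<dots> = path_sol z a j + path_sol z a (Suc (Suc j)) + 1"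
    unfolding k path_sol_def e using r by (simp only: add_divide_distrib divide_self_if if_False refl simp_thms)
  finally show ?thesis .
qed

text \<open>A discrete maximum principle: at an inner index where the absolute value is largest, r *
  |d| \<le> 2 * |d|, and r > 2 leaves only 0. It yields uniqueness for the recurrence on a
  path.\<close>

lemma path_recurrence_zero:
  fixes d :: "nat \<Rightarrow> real"
  assumes r: "r > 2" and "d 0 = 0" "d (Suc a) = 0"
    and step: "\<And>j. j < a \<Longrightarrow> r * d (Suc j) = d j + d (Suc (Suc j))"
    and i: "i \<le> Suc a"
  shows "d i = 0"
proof -
  obtain m where m: "m \<in> {..Suc a}" "\<And>i. i \<in> {..Suc a} \<Longrightarrow> \<bar>d i\<bar> \<le> \<bar>d m\<bar>"
    using finite_argmax[of "{..Suc a}" "\<lambda>i. \<bar>d i\<bar>"] by blast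
  have "d m = 0"
  proof (cases "m = 0 \<or> m = Suc a")
    case True then show ?thesis using assms(2,3) by auto
  next
    case False
    then obtain j where j: "m = Suc j" "j < a" using m(1) by (cases m) auto
    have "r * \<bar>d m\<bar> = \<bar>d j + d (Suc (Suc j))\<bar>" using step[OF j(2)] r unfolding j(1) by (simp add: abs_mult flip: step[OF j(2)])
    also have "\<dots> \<le> \<bar>d j\<bar> + \<bar>d (Suc (Suc j))\<bar>" by (rule abs_triangle_ineq)
    also have "\<dots> \<le> \<bar>d m\<bar> + \<bar>d m\<bar>" using m(2)[of j] m(2)[of "Suc (Suc j)"] j by (intro add_mono) auto
    finally have "(r - 2) * \<bar>d m\<bar> \<le> 0" by (simp add: algebra_simps)
    then have "\<bar>d m\<bar> \<le> 0" using r by (simp add: mult_le_0_iff)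
    then show ?thesis by simp
  qed
  then show ?thesis using m(2)[of i] i by simp
qed

locale hub =
  fixes G u v pss
  assumes hub: "hub_graph G u v pss"
begin

abbreviation "V \<equiv> verts G"
abbreviation "P \<equiv> set (concat pss)"

lemma dist: "u \<noteq> v" "u \<notin> P" "v \<notin> P" "distinct (concat pss)"
  using hub unfolding hub_graph_def by auto

lemma V_eq: "V = insert u (insert v P)" using hub unfolding hub_graph_def by simp
lemma finV: "finite V" unfolding V_eq by simp
lemma neV: "V \<noteq> {}" unfolding V_eq by simp
lemma inP: "k < length pss \<Longrightarrow> j < length (pss ! k) \<Longrightarrow> pss ! k ! j \<in> P" unfolding in_concat_nth by blast

lemma edge_hub: "w \<in> P \<Longrightarrow> {u, w} \<in> edges G \<and> {v, w} \<in> edges G" "{u, v} \<in> edges G"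
  using hub unfolding hub_graph_def by blast+

lemma no_loop: "{w} \<notin> edges G"
proof
  assume w: "{w} \<in> edges G"
  show False
  proof (rule hub_graph_edge_cases[OF hub w])
    fix k j assume "k < length pss" "j < length (pss ! k)" "{w} = {u, pss ! k ! j} \<or> {w} = {v, pss ! k ! j}"
    then show False using inP[of k j] dist by (auto simp: singleton_insert_inj_eq)
  next
    fix k j assume "k < length pss" "Suc j < length (pss ! k)" "{w} = {pss ! k ! j, pss ! k ! Suc j}"
    then show False using concat_nth_inj[OF dist(4), of k j k "Suc j"] by (auto simp: singleton_insert_inj_eq)
  qed (use dist in \<open>auto simp: singleton_insert_inj_eq\<close>)
qed

lemma edge_path:
  assumes kj: "k < length pss" "j < length (pss ! k)"
  shows "{pss ! k ! j, w} \<in> edges G \<longleftrightarrow> w = u \<or> w = v \<or> (0 < j \<and> w = pss ! k ! (j - 1)) \<or>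
     (Suc j < length (pss ! k) \<and> w = pss ! k ! Suc j)" (is "?L \<longleftrightarrow> ?R")
proof
  let ?p = "pss ! k ! j"
  have pP: "?p \<in> P" using inP kj by blast
  then have pn: "?p \<noteq> u" "?p \<noteq> v" using dist by auto
  assume ?L
  then show ?R
  proof (rule hub_graph_edge_cases[OF hub])
    assume "{?p, w} = {u, v}" then show ?R using pn by (auto simp: doubleton_eq_iff)
  next
    fix k' j' assume "{?p, w} = {u, pss ! k' ! j'} \<or> {?p, w} = {v, pss ! k' ! j'}"
    then show ?R using pn by (auto simp: doubleton_eq_iff)
  next
    fix k' j' assume k': "k' < length pss" "Suc j' < length (pss ! k')" "{?p, w} = {pss ! k' ! j', pss ! k' ! Suc j'}"
    then consider "?p = pss ! k' ! j'" "w = pss ! k' ! Suc j'" | "?p = pss ! k' ! Suc j'" "w = pss ! k' ! j'"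
      by (auto simp: doubleton_eq_iff)
    then show ?R
    proof cases
      case 1
      then have "k = k' \<and> j = j'" using concat_nth_inj[OF dist(4) kj, of k' j'] k' by simp
      then show ?thesis using 1 k' by auto
    next
      case 2
      then have "k = k' \<and> j = Suc j'" using concat_nth_inj[OF dist(4) kj, of k' "Suc j'"] k' by simp
      then show ?thesis using 2 k' by auto
    qed
  qed
next
  let ?p = "pss ! k ! j"
  have pP: "?p \<in> P" using inP kj by blast
  have pe: "{pss ! k ! i, pss ! k ! Suc i} \<in> edges G" if "Suc i < length (pss ! k)" for i
  proof -
    have "{pss ! k ! i, pss ! k ! Suc i} \<in> pedges (pss ! k)" unfolding pedges_def using that by blast
    moreover have "pss ! k \<in> set pss" using kj by simp
    ultimately show ?thesis using hub unfolding hub_graph_def by blast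
  qed
  assume ?R
  then show ?L
  proof (elim disjE conjE)
    assume "0 < j" "w = pss ! k ! (j - 1)"
    then show ?L using pe[of "j - 1"] kj by (simp add: insert_commute)
  qed (use edge_hub(1)[OF pP] pe kj in \<open>auto simp: insert_commute\<close>)
qed

lemma simple: "simple_graph G"
  unfolding simple_graph_def
proof (intro conjI subsetI)
  fix e assume e: "e \<in> edges G"
  obtain a b where ab: "e = {a, b}" "a \<in> V" "b \<in> V"
  proof (rule hub_graph_edge_cases[OF hub e])
    fix k j assume "k < length pss" "j < length (pss ! k)" "e = {u, pss ! k ! j} \<or> e = {v, pss ! k ! j}"
    then show thesis using that inP V_eq by blast
  next
    fix k j assume "k < length pss" "Suc j < length (pss ! k)" "e = {pss ! k ! j, pss ! k ! Suc j}"
    then show thesis using that[of "pss ! k ! j" "pss ! k ! Suc j"] inP[of k j] inP[of k "Suc j"] V_eq by auto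
  qed (use that V_eq in blast)
  moreover have "a \<noteq> b" using no_loop[of a] e ab by auto
  ultimately show "e \<in> {{u, v} |u v. u \<in> V \<and> v \<in> V \<and> u \<noteq> v}" by blast
qed (rule finV)

lemma sum_adj_edges: "(\<Sum>w\<in>V. adj G p w * f w) = (\<Sum>w\<in>{w \<in> V. {p, w} \<in> edges G}. f w)"
proof -
  have "(\<Sum>w\<in>V. adj G p w * f w) = (\<Sum>w\<in>V. if {p, w} \<in> edges G then f w else 0)"
    unfolding adj_def by (intro sum.cong) auto
  also have "\<dots> = (\<Sum>w\<in>{w \<in> V. {p, w} \<in> edges G}. f w)" using finV by (simp add: sum.inter_filter)
  finally show ?thesis .
qed

lemma sum_adj_hub:
  shows "(\<Sum>w\<in>V. adj G u w * f w) = f v + (\<Sum>w\<in>P. f w)" "(\<Sum>w\<in>V. adj G v w * f w) = f u + (\<Sum>w\<in>P. f w)"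
proof -
  have "{w \<in> V. {u, w} \<in> edges G} = insert v P" "{w \<in> V. {v, w} \<in> edges G} = insert u P"
    using edge_hub no_loop[of u] no_loop[of v] V_eq by (auto simp: insert_commute)
  then show "(\<Sum>w\<in>V. adj G u w * f w) = f v + (\<Sum>w\<in>P. f w)" "(\<Sum>w\<in>V. adj G v w * f w) = f u + (\<Sum>w\<in>P. f w)"
    unfolding sum_adj_edges using dist by (simp_all del: set_concat)
qed

lemma sum_adj_path:
  assumes kj: "k < length pss" "j < length (pss ! k)"
  shows "(\<Sum>w\<in>V. adj G (pss ! k ! j) w * f w) = f u + f v + (if 0 < j then f (pss ! k ! (j - 1)) else 0) +
     (if Suc j < length (pss ! k) then f (pss ! k ! Suc j) else 0)"
proof -
  let ?A = "if 0 < j then {pss ! k ! (j - 1)} else {}" and ?B = "if Suc j < length (pss ! k) then {pss ! k ! Suc j} else {}"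
  have AB: "?A \<subseteq> P" "?B \<subseteq> P" using inP[of k "j - 1"] inP[of k "Suc j"] kj by auto
  have E: "{w \<in> V. {pss ! k ! j, w} \<in> edges G} = {u, v} \<union> (?A \<union> ?B)"
    unfolding edge_path[OF kj] using AB V_eq by (auto split: if_splits)
  have "?A \<inter> ?B = {}"
  proof -
    have "j - 1 < length (pss ! k)" using kj by simp
    then show ?thesis using concat_nth_inj[OF dist(4), of k "j - 1" k "Suc j"] kj by auto
  qed
  then have 1: "(\<Sum>w\<in>?A \<union> ?B. f w) = (\<Sum>w\<in>?A. f w) + (\<Sum>w\<in>?B. f w)"
    by (intro sum.union_disjoint) auto
  have "{u, v} \<inter> (?A \<union> ?B) = {}" using AB dist by blast
  then have 2: "(\<Sum>w\<in>{u, v} \<union> (?A \<union> ?B). f w) = (\<Sum>w\<in>{u, v}. f w) + (\<Sum>w\<in>?A \<union> ?B. f w)"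
    by (intro sum.union_disjoint) auto
  have 3: "(\<Sum>w\<in>{u, v}. f w) = f u + f v" using dist by simp
  show ?thesis unfolding sum_adj_edges E 2 1 3 by simp
qed

lemma sum_P: "(\<Sum>w\<in>P. f w) = (\<Sum>k<length pss. \<Sum>j<length (pss ! k). f (pss ! k ! j))" for f :: "nat \<Rightarrow> real"
proof -
  have "(\<Sum>w\<in>P. f w) = sum_list (map f (concat pss))"
    by (rule sum_list_distinct_conv_sum_set[OF dist(4), symmetric])
  also have "\<dots> = sum_list (map (\<lambda>ps. sum_list (map f ps)) pss)" by (induction pss) auto
  also have "\<dots> = (\<Sum>k<length pss. sum_list (map f (pss ! k)))" by (simp add: sum_list_sum_nth atLeast0LessThan)
  also have "\<dots> = (\<Sum>k<length pss. \<Sum>j<length (pss ! k). f (pss ! k ! j))"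
    by (intro sum.cong refl) (simp add: sum_list_sum_nth atLeast0LessThan)
  finally show ?thesis .
qed

lemma sum_weights: "(\<Sum>k<length pss. path_weight z (length (pss ! k))) = sum_list (map (path_weight z) (map length pss))"
  by (simp add: sum_list_sum_nth atLeast0LessThan)

text \<open>On every path the eigenvector solves the recurrence with the hub sum \<open>S\<close> as
  inhomogeneity, hence equals \<open>S\<close> times \<open>path_sol\<close>. Adding the equations
  of the two hubs and cancelling \<open>S\<close> gives the identity.\<close>

lemma spectral_radius_hub:
  assumes z: "0 < z" "z < 1" and r: "spectral_radius G = z + 1 / z"
  shows "z + 1 / z = 1 + 2 * sum_list (map (path_weight z) (map length pss))"
proof -
  let ?r = "z + 1 / z"
  have "(1 - z)\<^sup>2 / z > 0" using z by simp
  then have r2: "?r > 2" using recip_minus_two[OF z(1)] by linarith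
  obtain x where x: "\<And>u. x u \<ge> 0" "nsq V x = 1" and e: "\<And>w. w \<in> V \<Longrightarrow> (\<Sum>q\<in>V. adj G w q * x q) = ?r * x w"
    using spectral_radius_rayleigh(2)[OF finV neV] r by auto
  define S where "S = x u + x v"
  have sol: "x (pss ! k ! j) = S * path_sol z (length (pss ! k)) (Suc j)" if k: "k < length pss" "j < length (pss ! k)" for k j
  proof -
    let ?a = "length (pss ! k)"
    define X where "X i = (if 0 < i \<and> i \<le> ?a then x (pss ! k ! (i - 1)) else 0)" for i
    define d where "d i = X i - S * path_sol z ?a i" for i
    have "d (Suc j) = 0"
    proof (rule path_recurrence_zero[OF r2])
      show "d 0 = 0" "d (Suc ?a) = 0" unfolding d_def X_def by (simp_all add: path_sol_boundary[OF z(1)])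
      show "Suc j \<le> Suc ?a" using k by simp
      fix i assume i: "i < ?a"
      have "pss ! k ! i \<in> V" using inP[OF k(1) i] V_eq by simp
      from e[OF this] have "?r * X (Suc i) = S + X i + X (Suc (Suc i))"
        unfolding sum_adj_path[OF k(1) i] X_def S_def using i by auto
      then show "?r * d (Suc i) = d i + d (Suc (Suc i))"
        using path_sol_step[OF z i] unfolding d_def by (simp add: algebra_simps)
    qed
    then show ?thesis using k unfolding d_def X_def by simp
  qed
  have sx: "(\<Sum>w\<in>P. x w) = S * sum_list (map (path_weight z) (map length pss))"
  proof -
    have "(\<Sum>w\<in>P. x w) = (\<Sum>k<length pss. \<Sum>j<length (pss ! k). S * path_sol z (length (pss ! k)) (Suc j))"
      unfolding sum_P using sol by (intro sum.cong) auto
    then show ?thesis unfolding sum_weights[symmetric] path_weight_def by (simp add: sum_distrib_left)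
  qed
  have hu: "?r * x u = x v + (\<Sum>w\<in>P. x w)" "?r * x v = x u + (\<Sum>w\<in>P. x w)"
    using e[of u] e[of v] sum_adj_hub[of x] V_eq by auto
  have "S \<noteq> 0"
  proof
    assume S0: "S = 0"
    then have "x u = 0" "x v = 0" using x(1)[of u] x(1)[of v] unfolding S_def by auto
    moreover have "x w = 0" if "w \<in> P" for w using that sol S0 unfolding in_concat_nth by auto
    ultimately have "x w = 0" if "w \<in> V" for w using that unfolding V_eq by blast
    then have "nsq V x = 0" unfolding nsq_def by simp
    then show False using x(2) by simp
  qed
  moreover have "?r * S = S * (1 + 2 * sum_list (map (path_weight z) (map length pss)))"
    using hu sx unfolding S_def by (simp add: algebra_simps)
  ultimately show ?thesis by (metis mult.commute mult_left_cancel)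
qed

text \<open>The test vector with entry 1 at the hubs and \<open>2 * path_sol\<close> on the paths
  satisfies the eigenvalue equation for z + 1 / z at every path vertex. Only the two hub rows
  deviate, each by the difference of the two sides of \<open>ge\<close>, so the Rayleigh quotient is
  at least z + 1 / z. No eigenvalue of the graph has to be computed.\<close>

lemma spectral_radius_hub_ge:
  assumes z: "0 < z" "z < 1" and ge: "z + 1 / z \<le> 1 + 2 * sum_list (map (path_weight z) (map length pss))"
  shows "z + 1 / z \<le> spectral_radius G"
    and "z + 1 / z < 1 + 2 * sum_list (map (path_weight z) (map length pss)) \<Longrightarrow> z + 1 / z < spectral_radius G"
proof -
  let ?r = "z + 1 / z" and ?W = "sum_list (map (path_weight z) (map length pss))"
  define w where "w p = (if p = u \<or> p = v then 1 else
    (SOME y. \<exists>k j. k < length pss \<and> j < length (pss ! k) \<and> p = pss ! k ! j \<and> y = 2 * path_sol z (length (pss ! k)) (Suc j)))" for p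
  have wh: "w u = 1" "w v = 1" unfolding w_def by auto
  have wp: "w (pss ! k ! j) = 2 * path_sol z (length (pss ! k)) (Suc j)" if k: "k < length pss" "j < length (pss ! k)" for k j
  proof -
    have "pss ! k ! j \<noteq> u" "pss ! k ! j \<noteq> v" using inP[OF k] dist by auto
    moreover have "(SOME y. \<exists>k' j'. k' < length pss \<and> j' < length (pss ! k') \<and> pss ! k ! j = pss ! k' ! j' \<and>
        y = 2 * path_sol z (length (pss ! k')) (Suc j')) = 2 * path_sol z (length (pss ! k)) (Suc j)"
    proof (rule some_equality)
      show "\<exists>k' j'. k' < length pss \<and> j' < length (pss ! k') \<and> pss ! k ! j = pss ! k' ! j' \<and>
        2 * path_sol z (length (pss ! k)) (Suc j) = 2 * path_sol z (length (pss ! k')) (Suc j')" using k by blast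
      fix y assume "\<exists>k' j'. k' < length pss \<and> j' < length (pss ! k') \<and> pss ! k ! j = pss ! k' ! j' \<and>
        y = 2 * path_sol z (length (pss ! k')) (Suc j')"
      then obtain k' j' where "k' < length pss" "j' < length (pss ! k')" "pss ! k ! j = pss ! k' ! j'"
        "y = 2 * path_sol z (length (pss ! k')) (Suc j')" by blast
      then show "y = 2 * path_sol z (length (pss ! k)) (Suc j)" using concat_nth_inj[OF dist(4) k, of k' j'] by auto
    qed
    ultimately show ?thesis unfolding w_def by simp
  qed
  have sw: "(\<Sum>p\<in>P. w p) = 2 * ?W"
  proof -
    have "(\<Sum>p\<in>P. w p) = (\<Sum>k<length pss. \<Sum>j<length (pss ! k). 2 * path_sol z (length (pss ! k)) (Suc j))"
      unfolding sum_P using wp by (intro sum.cong) auto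
    then show ?thesis unfolding sum_weights[symmetric] path_weight_def by (simp add: sum_distrib_left)
  qed
  have path: "(\<Sum>q\<in>V. adj G p q * w q) = ?r * w p" if p: "p \<in> P" for p
  proof -
    obtain k j where k: "k < length pss" "j < length (pss ! k)" "p = pss ! k ! j" using p unfolding in_concat_nth by blast
    let ?a = "length (pss ! k)"
    have 1: "(if 0 < j then w (pss ! k ! (j - 1)) else 0) = 2 * path_sol z ?a j"
      using wp[OF k(1), of "j - 1"] k(2) path_sol_boundary[OF z(1), of ?a] by (cases j) auto
    have 2: "(if Suc j < ?a then w (pss ! k ! Suc j) else 0) = 2 * path_sol z ?a (Suc (Suc j))"
    proof (cases "Suc j < ?a")
      case True then show ?thesis using wp[OF k(1) True] by simp
    next
      case False
      then have "Suc (Suc j) = Suc ?a" using k(2) by simp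
      then show ?thesis using False path_sol_boundary(2)[OF z(1), of ?a] by simp
    qed
    show ?thesis unfolding k(3) sum_adj_path[OF k(1,2)] 1 2 wh wp[OF k(1,2)]
      using path_sol_step[OF z k(2)] by (simp add: algebra_simps)
  qed
  have "qform (adj G) V w = (\<Sum>p\<in>V. w p * (\<Sum>q\<in>V. adj G p q * w q))"
    unfolding qform_def sum_distrib_left by (intro sum.cong refl) (simp only: mult_ac)
  also have "\<dots> = w u * (\<Sum>q\<in>V. adj G u q * w q) + (w v * (\<Sum>q\<in>V. adj G v q * w q) + (\<Sum>p\<in>P. w p * (\<Sum>q\<in>V. adj G p q * w q)))"
    using dist by (subst (1) V_eq) (simp del: set_concat)
  also have "(\<Sum>p\<in>P. w p * (\<Sum>q\<in>V. adj G p q * w q)) = (\<Sum>p\<in>P. ?r * (w p)\<^sup>2)"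
  proof (intro sum.cong refl)
    fix p assume "p \<in> P"
    then show "w p * (\<Sum>q\<in>V. adj G p q * w q) = ?r * (w p)\<^sup>2" by (simp only: path) (simp add: power2_eq_square)
  qed
  also have "(\<Sum>p\<in>P. ?r * (w p)\<^sup>2) = ?r * (\<Sum>p\<in>P. (w p)\<^sup>2)" by (rule sum_distrib_left[symmetric])
  also have "w u * (\<Sum>q\<in>V. adj G u q * w q) + (w v * (\<Sum>q\<in>V. adj G v q * w q) + ?r * (\<Sum>p\<in>P. (w p)\<^sup>2))
      = 2 * (1 + 2 * ?W) + ?r * (\<Sum>p\<in>P. (w p)\<^sup>2)"
    unfolding sum_adj_hub sw wh by simp
  also have "\<dots> = ?r * nsq V w + 2 * (1 + 2 * ?W - ?r)"
  proof -
    have "nsq V w = 2 + (\<Sum>p\<in>P. (w p)\<^sup>2)"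
      unfolding nsq_def V_eq using dist(1-3) wh by (simp del: set_concat)
    then show ?thesis by (simp only:) (simp add: algebra_simps)
  qed
  finally have q: "qform (adj G) V w = ?r * nsq V w + 2 * (1 + 2 * ?W - ?r)" .
  have n: "nsq V w > 0" by (rule nsq_pos[of V u w, OF finV]) (use wh V_eq in auto)
  have "?r * nsq V w + 2 * (1 + 2 * ?W - ?r) \<le> spectral_radius G * nsq V w"
    using spectral_radius_rayleigh(1)[OF finV neV, of w] unfolding q .
  then have k: "2 * (1 + 2 * ?W - ?r) \<le> (spectral_radius G - ?r) * nsq V w" by (simp add: algebra_simps)
  moreover have "0 \<le> 2 * (1 + 2 * ?W - ?r)" using ge by simp
  ultimately have "0 \<le> (spectral_radius G - ?r) * nsq V w" by (rule order_trans[rotated])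
  then show "?r \<le> spectral_radius G" using n by (simp add: zero_le_mult_iff)
  assume "?r < 1 + 2 * ?W"
  then have "0 < 2 * (1 + 2 * ?W - ?r)" by simp
  then have "0 < (spectral_radius G - ?r) * nsq V w" using k by (rule less_le_trans)
  then show "?r < spectral_radius G" using n by (simp add: zero_less_mult_iff)
qed

end

section \<open>Majorization of path lengths\<close>

text \<open>The part of \<open>path_weight\<close> that is not linear in the length, up to a
  negative factor: for a fixed total length, larger weight means smaller total defect. It vanishes
  at length 0.\<close>

definition path_defect :: "real \<Rightarrow> nat \<Rightarrow> real" where
  "path_defect z a = (1 + z) / (1 + z ^ Suc a) - 1"

lemma one_plus_pow_pos: "0 < z \<Longrightarrow> 0 < 1 + z ^ (k::nat)" for z :: real
  by (simp add: add_pos_pos)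

lemma path_weight_defect:
  assumes z: "0 < z" "z < 1"
  shows "path_weight z a = (a - 2 / (1 - z) * path_defect z a) / (z + 1 / z - 2)"
proof -
  let ?D = "1 + z ^ Suc a"
  have D: "?D > 0" by (rule one_plus_pow_pos[OF z(1)])
  have g: "(\<Sum>j<a. z ^ Suc j) = (z - z ^ Suc a) / (1 - z)"
  proof -
    have "(1 - z) * (\<Sum>j<a. z ^ Suc j) = z - z ^ Suc a"
      by (induction a) (simp_all add: distrib_left left_diff_distrib)
    then show ?thesis using z by (simp add: field_simps)
  qed
  have "(\<Sum>j<a. z ^ (Suc a - Suc j)) = (\<Sum>j<a. z ^ Suc (a - Suc j))"
    by (intro sum.cong refl) (simp add: Suc_diff_Suc)
  also have "\<dots> = (\<Sum>j<a. z ^ Suc j)" by (rule sum.nat_diff_reindex)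
  finally have g': "(\<Sum>j<a. z ^ (Suc a - Suc j)) = (z - z ^ Suc a) / (1 - z)" using g by simp
  have "(\<Sum>j<a. 1 - (z ^ Suc j + z ^ (Suc a - Suc j)) / ?D) = a - ((\<Sum>j<a. z ^ Suc j) + (\<Sum>j<a. z ^ (Suc a - Suc j))) / ?D"
    by (simp only: sum_subtractf sum.distrib[symmetric] sum_divide_distrib) simp
  also have "\<dots> = a - 2 / (1 - z) * ((z - z ^ Suc a) / ?D)" unfolding g g' by simp
  also have "(z - z ^ Suc a) / ?D = path_defect z a" unfolding path_defect_def using D by (simp add: field_simps)
  finally have "(\<Sum>j<a. 1 - (z ^ Suc j + z ^ (Suc a - Suc j)) / ?D) = a - 2 / (1 - z) * path_defect z a" .
  then show ?thesis unfolding path_weight_def path_sol_def sum_divide_distrib[symmetric] by simp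
qed

lemma sum_path_weight:
  assumes z: "0 < z" "z < 1"
  shows "sum_list (map (path_weight z) ls) =
    (real (sum_list ls) - 2 / (1 - z) * sum_list (map (path_defect z) ls)) / (z + 1 / z - 2)"
  by (induction ls) (simp_all add: path_weight_defect[OF z] add_divide_distrib[symmetric] algebra_simps)

lemma sum_path_weight_mono:
  assumes z: "0 < z" "z < 1" and s: "sum_list ls = sum_list bs"
  shows "sum_list (map (path_defect z) bs) \<le> sum_list (map (path_defect z) ls) \<Longrightarrow>
      sum_list (map (path_weight z) ls) \<le> sum_list (map (path_weight z) bs)"
    and "sum_list (map (path_defect z) bs) < sum_list (map (path_defect z) ls) \<Longrightarrow>
      sum_list (map (path_weight z) ls) < sum_list (map (path_weight z) bs)"
proof -
  have p: "z + 1 / z - 2 > 0" "2 / (1 - z) > 0" using recip_minus_two[OF z(1)] z by simp_all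
  show "sum_list (map (path_defect z) bs) \<le> sum_list (map (path_defect z) ls) \<Longrightarrow>
      sum_list (map (path_weight z) ls) \<le> sum_list (map (path_weight z) bs)"
    unfolding sum_path_weight[OF z] s using p by (intro divide_right_mono diff_left_mono mult_left_mono) auto
  show "sum_list (map (path_defect z) bs) < sum_list (map (path_defect z) ls) \<Longrightarrow>
      sum_list (map (path_weight z) ls) < sum_list (map (path_weight z) bs)"
    unfolding sum_path_weight[OF z] s using p by (intro divide_strict_right_mono diff_strict_left_mono mult_strict_left_mono) auto
qed

text \<open>For small \<open>z\<close> all nonempty paths have nearly the same defect
  \<open>z\<close>, so that the total defect is governed by the number of paths.\<close>

lemma path_defect_bounds:
  assumes z: "0 < z" "z < 1"
  shows "path_defect z a \<le> z" "a \<ge> 1 \<Longrightarrow> z * (1 - 2 * z) \<le> path_defect z a"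
proof -
  have "(1 + z) / (1 + z ^ Suc a) \<le> (1 + z) / 1" using z by (intro divide_left_mono) (auto simp: add_pos_pos)
  then show "path_defect z a \<le> z" unfolding path_defect_def by simp
  assume "a \<ge> 1"
  then have "z ^ Suc a \<le> z ^ 2" using z by (intro power_decreasing) auto
  then have "(1 + z) / (1 + z ^ 2) \<le> (1 + z) / (1 + z ^ Suc a)" using z by (intro divide_left_mono) (auto simp: add_pos_pos)
  moreover have "1 + z * (1 - 2 * z) \<le> (1 + z) / (1 + z ^ 2)"
  proof -
    have "(1 + z) - (1 + z * (1 - 2 * z)) * (1 + z ^ 2) = z\<^sup>2 * (1 - z) + 2 * z ^ 4"
      by (simp add: algebra_simps power2_eq_square power4_eq_xxxx)
    moreover have "z\<^sup>2 * (1 - z) + 2 * z ^ 4 \<ge> 0" using z by (intro add_nonneg_nonneg mult_nonneg_nonneg) auto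
    ultimately have "(1 + z * (1 - 2 * z)) * (1 + z ^ 2) \<le> 1 + z" by linarith
    then show ?thesis by (subst pos_le_divide_eq) (auto simp: add_pos_nonneg)
  qed
  ultimately show "z * (1 - 2 * z) \<le> path_defect z a" unfolding path_defect_def by linarith
qed

lemma path_defect_concave:
  assumes z: "0 < z" "z < 1"
  shows "path_defect z (Suc (Suc i)) - path_defect z (Suc i) < path_defect z (Suc i) - path_defect z i"
proof -
  define q where "q = z ^ Suc i"
  have q: "0 < q" "q < 1" unfolding q_def using z power_Suc_less_one[of z i] by auto
  have e: "z ^ Suc (Suc i) = q * z" "z ^ Suc (Suc (Suc i)) = q * z * z" unfolding q_def by simp_all
  have p: "1 + q > 0" "1 + q * z > 0" "1 + q * z * z > 0" using q z by (simp_all add: add_pos_pos)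
  have qz: "q * z < 1" using q z mult_strict_mono[of q 1 z 1] by simp
  \<comment> \<open>The second difference of 1 / (1 + z^j), with the opposite sign, in factored
    form; all factors are positive.\<close>
  have "2 / (1 + q * z) - 1 / (1 + q) - 1 / (1 + q * z * z)
      = q * (1 - z)\<^sup>2 * (1 - q * z) / ((1 + q) * (1 + q * z) * (1 + q * z * z))"
    using p by (simp add: divide_simps) (simp add: algebra_simps power2_eq_square)
  also have "\<dots> > 0" using p q z qz by (intro divide_pos_pos mult_pos_pos) auto
  finally have "0 < (1 + z) * (2 / (1 + q * z) - 1 / (1 + q) - 1 / (1 + q * z * z))" using z by (intro mult_pos_pos) auto
  also have "\<dots> = 2 * ((1 + z) / (1 + q * z)) - (1 + z) / (1 + q) - (1 + z) / (1 + q * z * z)"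
    by (simp add: right_diff_distrib)
  finally have "0 < 2 * ((1 + z) / (1 + q * z)) - (1 + z) / (1 + q) - (1 + z) / (1 + q * z * z)" .
  then show ?thesis unfolding path_defect_def e q_def[symmetric] by linarith
qed

text \<open>The subtraction is truncated, so this is the sum of positive parts. For lists of equal
  sum, comparing these numbers for all \<open>c\<close> is the majorization order, expressed without
  sorting or partial sums.\<close>

definition excess :: "nat \<Rightarrow> nat list \<Rightarrow> nat" where
  "excess c ls = sum_list (map (\<lambda>a. a - c) ls)"

lemma excess_Nil [simp]: "excess c [] = 0" and excess_Cons [simp]: "excess c (a # ls) = (a - c) + excess c ls"
  and excess_append [simp]: "excess c (ls @ ls') = excess c ls + excess c ls'"
  unfolding excess_def by simp_all

lemma excess_replicate [simp]: "excess c (replicate q a) = q * (a - c)"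
  by (induction q) auto

lemma excess_0: "excess 0 ls = sum_list ls" unfolding excess_def by simp

text \<open>As a function of \<open>c\<close>, the positive part of a - c has second difference 1 at
  c = a and 0 elsewhere. Hence the excesses determine the multiset of positive entries.\<close>

lemma count_excess: "c \<ge> 1 \<Longrightarrow> int (count (mset ls) c) = int (excess (c - 1) ls) - 2 * int (excess c ls) + int (excess (Suc c) ls)"
  by (induction ls) auto

lemma mset_eq_by_excess:
  assumes "\<And>c. excess c ls = excess c bs" "0 \<notin> set ls" "0 \<notin> set bs"
  shows "mset ls = mset bs"
proof (rule multiset_eqI)
  fix c
  show "count (mset ls) c = count (mset bs) c"
  proof (cases "c = 0")
    case True then show ?thesis using assms(2,3) by (simp add: count_mset_0_iff[THEN iffD2] not_in_iff[THEN iffD1])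
  next
    case False
    then have "int (count (mset ls) c) = int (count (mset bs) c)" using count_excess[of c ls] count_excess[of c bs] assms(1) by simp
    then show ?thesis by simp
  qed
qed

lemma excess_big: "(\<And>a. a \<in> set ls \<Longrightarrow> a \<le> c) \<Longrightarrow> excess c ls = 0"
  by (induction ls) auto

text \<open>Abel summation: a function with \<open>f 0 = 0\<close> is a combination of the functions \<open>a - c\<close>
  with the second differences of \<open>f\<close> as coefficients.\<close>
lemma second_difference_expansion:
  fixes f :: "nat \<Rightarrow> real"
  assumes "f 0 = 0" "a \<le> M"
  shows "f a = (f 1 - f 0) * a + (\<Sum>c\<in>{1..<M}. ((f (Suc c) - f c) - (f c - f (c - 1))) * real (a - c))"
  using assms(2)
proof (induction a)
  case 0 then show ?case using assms(1) by simp
next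
  case (Suc a)
  let ?w = "\<lambda>c. (f (Suc c) - f c) - (f c - f (c - 1))"
  have tel: "(\<Sum>c\<in>{1..<Suc a}. ?w c) = (f (Suc a) - f a) - (f 1 - f 0)"
  proof (induction a)
    case (Suc a)
    have "{1..<Suc (Suc a)} = insert (Suc a) {1..<Suc a}" by auto
    then show ?case using Suc.IH by simp
  qed simp
  have "(\<Sum>c\<in>{1..<M}. ?w c * real (Suc a - c)) = (\<Sum>c\<in>{1..<M}. ?w c * real (a - c) + (if c \<in> {1..<Suc a} then ?w c else 0))"
    by (intro sum.cong refl) (auto simp: Suc_diff_le algebra_simps)
  also have "\<dots> = (\<Sum>c\<in>{1..<M}. ?w c * real (a - c)) + (\<Sum>c\<in>{1..<M} \<inter> {1..<Suc a}. ?w c)"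
    unfolding sum.distrib by (intro arg_cong2[of _ _ _ _ "(+)"] refl sum.inter_restrict[symmetric]) simp
  also have "{1..<M} \<inter> {1..<Suc a} = {1..<Suc a}" using Suc.prems by auto
  finally have 1: "(\<Sum>c\<in>{1..<M}. ?w c * real (Suc a - c)) = (\<Sum>c\<in>{1..<M}. ?w c * real (a - c)) + ((f (Suc a) - f a) - (f 1 - f 0))"
    unfolding tel .
  have 2: "f a = (f 1 - f 0) * a + (\<Sum>c\<in>{1..<M}. ?w c * real (a - c))" using Suc by simp
  show ?case unfolding 1 using 2 by (simp add: algebra_simps)
qed

lemma sum_second_difference:
  fixes f :: "nat \<Rightarrow> real"
  assumes "f 0 = 0" "\<And>a. a \<in> set ls \<Longrightarrow> a \<le> M"
  shows "sum_list (map f ls) = (f 1 - f 0) * sum_list ls +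
    (\<Sum>c\<in>{1..<M}. ((f (Suc c) - f c) - (f c - f (c - 1))) * real (excess c ls))"
  using assms(2)
proof (induction ls)
  case (Cons a ls)
  have "f a = (f 1 - f 0) * a + (\<Sum>c\<in>{1..<M}. ((f (Suc c) - f c) - (f c - f (c - 1))) * real (a - c))"
    by (rule second_difference_expansion) (use assms(1) Cons.prems in auto)
  moreover have "sum_list (map f ls) = (f 1 - f 0) * sum_list ls +
    (\<Sum>c\<in>{1..<M}. ((f (Suc c) - f c) - (f c - f (c - 1))) * real (excess c ls))" using Cons by simp
  ultimately show ?case by (simp add: distrib_left sum.distrib)
qed simp

text \<open>The expansion by second differences writes the difference of the total defects as a
  combination of differences of excesses. Its coefficients are positive by strict concavity, so one
  differing excess makes the inequality strict, and by \<open>mset_eq_by_excess\<close> different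
  multisets have one.\<close>

lemma majorization:
  assumes z: "0 < z" "z < 1" and s: "sum_list ls = sum_list bs"
    and le: "\<And>c. c \<ge> 1 \<Longrightarrow> excess c ls \<le> excess c bs"
  shows "sum_list (map (path_defect z) bs) \<le> sum_list (map (path_defect z) ls)"
    and "0 \<notin> set ls \<Longrightarrow> 0 \<notin> set bs \<Longrightarrow> mset ls \<noteq> mset bs \<Longrightarrow>
      sum_list (map (path_defect z) bs) < sum_list (map (path_defect z) ls)"
proof -
  let ?f = "path_defect z"
  let ?w = "\<lambda>c. (?f (Suc c) - ?f c) - (?f c - ?f (c - 1))"
  define M where "M = Max (insert 1 (set (ls @ bs)))"
  have M: "a \<le> M" if "a \<in> set ls \<or> a \<in> set bs" for a unfolding M_def using that by (intro Max_ge) auto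
  have f0: "?f 0 = 0" unfolding path_defect_def using z by simp
  have w: "?w c < 0" if "c \<ge> 1" for c
    using path_defect_concave[OF z, of "c - 1"] that by simp
  have sub: "sum_list (map ?f ls) - sum_list (map ?f bs) = (\<Sum>c\<in>{1..<M}. - ?w c * (real (excess c bs) - real (excess c ls)))"
  proof -
    have "sum_list (map ?f ls) = (?f 1 - ?f 0) * sum_list ls + (\<Sum>c\<in>{1..<M}. ?w c * real (excess c ls))"
      by (rule sum_second_difference[where f = ?f, OF f0]) (use M in auto)
    moreover have "sum_list (map ?f bs) = (?f 1 - ?f 0) * sum_list bs + (\<Sum>c\<in>{1..<M}. ?w c * real (excess c bs))"
      by (rule sum_second_difference[where f = ?f, OF f0]) (use M in auto)
    ultimately have "sum_list (map ?f ls) - sum_list (map ?f bs) =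
        (\<Sum>c\<in>{1..<M}. ?w c * real (excess c ls)) - (\<Sum>c\<in>{1..<M}. ?w c * real (excess c bs))" using s by simp
    also have "\<dots> = (\<Sum>c\<in>{1..<M}. - ?w c * (real (excess c bs) - real (excess c ls)))"
      unfolding sum_subtractf[symmetric] by (intro sum.cong refl) (simp add: algebra_simps)
    finally show ?thesis .
  qed
  have nn: "0 \<le> - ?w c * (real (excess c bs) - real (excess c ls))" if "c \<in> {1..<M}" for c
    using w[of c] le[of c] that by (intro mult_nonneg_nonneg) auto
  have "0 \<le> (\<Sum>c\<in>{1..<M}. - ?w c * (real (excess c bs) - real (excess c ls)))" by (intro sum_nonneg nn)
  then show "sum_list (map ?f bs) \<le> sum_list (map ?f ls)" using sub by linarith
  assume z0: "0 \<notin> set ls" "0 \<notin> set bs" and ne: "mset ls \<noteq> mset bs"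
  have "\<exists>c. excess c ls \<noteq> excess c bs" using mset_eq_by_excess[OF _ z0] ne by blast
  then obtain c where c: "excess c ls \<noteq> excess c bs" by blast
  have "c \<noteq> 0"
  proof
    assume "c = 0"
    then show False using c s by (simp add: excess_0)
  qed
  moreover have "c < M"
  proof (rule ccontr)
    assume "\<not> c < M"
    then have "excess c ls = 0" "excess c bs = 0" using M by (intro excess_big; force)+
    then show False using c by simp
  qed
  ultimately have cM: "c \<in> {1..<M}" by simp
  have "0 < - ?w c * (real (excess c bs) - real (excess c ls))"
    using w[of c] le[of c] c cM by (intro mult_pos_pos) auto
  then have "0 < (\<Sum>c\<in>{1..<M}. - ?w c * (real (excess c bs) - real (excess c ls)))"
    by (intro sum_pos2[OF _ cM]) (use nn in auto)
  then show "sum_list (map ?f bs) < sum_list (map ?f ls)" using sub by linarith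
qed

text \<open>The excess over \<open>c\<close> when a total of \<open>S\<close> is cut greedily into
  parts of size \<open>k\<close> and one remainder.\<close>

definition packed_excess :: "nat \<Rightarrow> nat \<Rightarrow> nat \<Rightarrow> nat" where
  "packed_excess k c S = (S div k) * (k - c) + (S mod k - c)"

lemma div_mod_add_less:
  fixes S b k :: nat
  assumes "b \<le> k" "k > 0"
  shows "S mod k + b < k \<and> (S + b) div k = S div k \<and> (S + b) mod k = S mod k + b \<or>
    S mod k + b \<ge> k \<and> S mod k + b - k < k \<and> (S + b) div k = S div k + 1 \<and> (S + b) mod k = S mod k + b - k"
proof -
  have m: "S mod k < k" using assms by simp
  have dm: "(k * q + r) div k = q" "(k * q + r) mod k = r" if "r < k" for q r using that by simp_all
  have S: "S + b = k * (S div k) + (S mod k + b)" by simp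
  show ?thesis
  proof (cases "S mod k + b < k")
    case True
    have "(S + b) div k = S div k" "(S + b) mod k = S mod k + b" using dm[OF True, of "S div k"] S by argo+
    then show ?thesis using True by simp
  next
    case False
    then have r: "S mod k + b - k < k" using m assms by linarith
    have S': "S + b = k * (S div k + 1) + (S mod k + b - k)" using S False by simp
    have "(S + b) div k = S div k + 1" "(S + b) mod k = S mod k + b - k" using dm[OF r, of "S div k + 1"] S' by argo+
    then show ?thesis using False r by simp
  qed
qed

text \<open>Merging a part \<open>b\<close> into the remainder loses nothing: either the remainder
  stays below \<open>k\<close> and grows, or one full part is completed and the rest is carried
  over.\<close>

lemma packed_excess_add:
  assumes "b \<le> k" "k > 0" "c \<le> k"
  shows "packed_excess k c S + (b - c) \<le> packed_excess k c (S + b)"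
proof -
  have r: "S mod k < k" using assms by simp
  have d: "(S div k + 1) * (k - c) = (S div k) * (k - c) + (k - c)" by simp
  have "(S mod k - c) + (b - c) \<le> (S mod k + b) - c" if "S mod k + b < k" by linarith
  moreover have "(S mod k - c) + (b - c) \<le> (k - c) + (S mod k + b - k - c)" if "S mod k + b \<ge> k"
    using that r assms by linarith
  ultimately show ?thesis using div_mod_add_less[OF assms(1,2), of S] d unfolding packed_excess_def by auto
qed

lemma packed_excess_lipschitz:
  assumes "k > 0" "c < k"
  shows "packed_excess k c (S + x) \<le> packed_excess k c S + x"
proof (induction x)
  case (Suc x)
  have "packed_excess k c (S + x + 1) \<le> packed_excess k c (S + x) + 1"
    using div_mod_add_less[of 1 k "S + x"] assms unfolding packed_excess_def by auto
  then show ?case using Suc by simp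
qed simp

text \<open>Greedy packing is the most unequal way to split a total into parts of size at most
  \<open>k\<close>; the parts are merged one at a time.\<close>

lemma excess_le_packed:
  assumes "\<And>b. b \<in> set bs \<Longrightarrow> b \<le> k" "k > 0" "c \<le> k"
  shows "excess c bs \<le> packed_excess k c (sum_list bs)"
  using assms(1)
proof (induction bs)
  case (Cons b bs)
  have "packed_excess k c (sum_list bs) + (b - c) \<le> packed_excess k c (sum_list bs + b)"
    using packed_excess_add[of b k c "sum_list bs"] Cons.prems assms(2,3) by simp
  then show ?case using Cons by (simp add: add.commute)
qed (simp add: packed_excess_def)

section \<open>Packed lists are extremal\<close>

lemma excess_split: "c \<le> k \<Longrightarrow> excess c ls = excess k ls + excess c (map (min k) ls)"
  by (induction ls) auto

lemma sum_min: "sum_list ls = excess k ls + sum_list (map (min k) ls)"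
  by (induction ls) auto

definition packed :: "nat list \<Rightarrow> nat \<Rightarrow> nat \<Rightarrow> nat list" where
  "packed hs k s = hs @ replicate (s div k) k @ (if s mod k = 0 then [] else [s mod k])"

lemma sum_packed: "sum_list (packed hs k s) = sum_list hs + s"
  unfolding packed_def using div_mult_mod_eq[of s k] by (cases "s mod k = 0") (simp_all add: sum_list_replicate)

lemma excess_packed_ge:
  assumes "k > 0" "c \<ge> k"
  shows "excess c (packed hs k s) = excess c hs"
proof -
  have "s mod k - c = 0" using mod_less_divisor[OF assms(1), of s] assms(2) by simp
  then show ?thesis using assms(2) unfolding packed_def by simp
qed

text \<open>Cut every entry at \<open>k\<close>. Whatever \<open>ls\<close> lacks in excess over
  \<open>k\<close> reappears as additional length \<open>x\<close> in the truncated entries, where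
  it raises the packed excess by at most \<open>x\<close>; the two effects cancel.\<close>

lemma excess_below_bulk:
  assumes k: "k > 0" "c < k" and hs: "\<And>b. b \<in> set hs \<Longrightarrow> b \<ge> k"
    and s: "sum_list ls = sum_list hs + s" and ex: "excess k ls \<le> excess k hs"
  shows "excess c ls \<le> excess c (packed hs k s)"
proof -
  define x where "x = excess k hs - excess k ls"
  let ?S0 = "length hs * k + s"
  have h: "map (min k) hs = replicate (length hs) k" using hs by (induction hs) auto
  have "sum_list hs = excess k hs + length hs * k" using sum_min[of hs k] h by (simp add: sum_list_replicate)
  then have S: "sum_list (map (min k) ls) = ?S0 + x" using sum_min[of ls k] s ex unfolding x_def by simp
  have "excess c ls = excess k ls + excess c (map (min k) ls)" using k by (intro excess_split) simp
  also have "excess c (map (min k) ls) \<le> packed_excess k c (?S0 + x)"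
    unfolding S[symmetric] using k by (intro excess_le_packed) auto
  also have "packed_excess k c (?S0 + x) \<le> packed_excess k c ?S0 + x" using k by (rule packed_excess_lipschitz)
  also have "packed_excess k c ?S0 = (length hs + s div k) * (k - c) + (s mod k - c)"
    unfolding packed_excess_def using k by simp
  finally have "excess c ls \<le> excess k ls + ((length hs + s div k) * (k - c) + (s mod k - c) + x)" by simp
  also have "\<dots> = excess k hs + excess c (map (min k) hs) + (s div k) * (k - c) + (s mod k - c)"
    using ex unfolding x_def h by (simp add: algebra_simps)
  also have "\<dots> = excess c hs + (s div k) * (k - c) + (s mod k - c)" using excess_split[of c k hs] k by simp
  also have "\<dots> = excess c (packed hs k s)" unfolding packed_def by simp
  finally show ?thesis .
qed

text \<open>Only thresholds from \<open>k\<close> on have to be checked, and there the bulk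
  contributes nothing, so that \<open>hs\<close> alone is compared; smaller thresholds follow from
  \<open>excess_below_bulk\<close>.\<close>

lemma packed_optimal:
  assumes z: "0 < z" "z < 1" and k: "k > 0" and hs: "\<And>b. b \<in> set hs \<Longrightarrow> b \<ge> k"
    and s: "sum_list ls = sum_list hs + s" and ex: "\<And>c. c \<ge> k \<Longrightarrow> excess c ls \<le> excess c hs"
    and ls: "0 \<notin> set ls"
  shows "sum_list (map (path_weight z) ls) \<le> sum_list (map (path_weight z) (packed hs k s))"
    and "mset ls \<noteq> mset (packed hs k s) \<Longrightarrow>
      sum_list (map (path_weight z) ls) < sum_list (map (path_weight z) (packed hs k s))"
proof -
  have e: "excess c ls \<le> excess c (packed hs k s)" for c
  proof (cases "c < k")
    case True then show ?thesis using excess_below_bulk[OF k True hs s] ex[of k] by simp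
  next
    case False then show ?thesis using excess_packed_ge[OF k, of c hs s] ex[of c] by simp
  qed
  have s': "sum_list ls = sum_list (packed hs k s)" using s sum_packed by simp
  have "0 \<notin> set hs" using hs k by fastforce
  then have p0: "0 \<notin> set (packed hs k s)" unfolding packed_def using k by auto
  show "sum_list (map (path_weight z) ls) \<le> sum_list (map (path_weight z) (packed hs k s))"
    by (rule sum_path_weight_mono(1)[OF z s' majorization(1)[OF z s' e]])
  show "mset ls \<noteq> mset (packed hs k s) \<Longrightarrow>
      sum_list (map (path_weight z) ls) < sum_list (map (path_weight z) (packed hs k s))"
    by (rule sum_path_weight_mono(2)[OF z s' majorization(2)[OF z s' e ls p0]])
qed

text \<open>If only few entries reach the bulk length \<open>k\<close>, then the list is longer than the packed list
  by a constant factor, and every entry has nearly the same defect \<open>z\<close>.\<close>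
lemma few_long_worse:
  assumes z: "0 < z" "z < 1" and k: "k > 0" and hs: "length hs \<le> 2"
    and s: "sum_list ls = sum_list hs + s" and ls: "0 \<notin> set ls" "\<And>a. a \<in> set ls \<Longrightarrow> a \<le> L"
    and few: "length (filter (\<lambda>a. a \<ge> k) ls) \<le> B"
    and zk: "4 * z * real k \<le> 1" and big: "2 * (real k * real B * real L + 4 * real k ^ 2) < real (sum_list ls)"
  shows "sum_list (map (path_weight z) ls) < sum_list (map (path_weight z) (packed hs k s))"
proof -
  define N where "N = real (sum_list ls)"
  define m where "m = real (length ls)"
  define p where "p = real (length (packed hs k s))"
  have kr: "real k \<ge> 1" using k by simp
  have "sum_list ls \<le> length (filter (\<lambda>a. a \<ge> k) ls) * L + (k - 1) * length ls"
    using ls(2)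
  proof (induction ls)
    case (Cons a ls)
    obtain K where K: "k = Suc K" using k by (cases k) auto
    have "a \<le> L" using Cons.prems by simp
    moreover have "sum_list ls \<le> length (filter (\<lambda>a. k \<le> a) ls) * L + (k - 1) * length ls" using Cons by simp
    ultimately show ?case by (cases "k \<le> a") (simp_all add: K)
  qed simp
  also have "\<dots> \<le> B * L + (k - 1) * length ls" using few by (intro add_mono mult_right_mono) auto
  finally have "N \<le> real (B * L + (k - 1) * length ls)" unfolding N_def by (rule of_nat_mono)
  \<comment> \<open>Apart from the few long ones all entries are at most k - 1, which makes the
    number \<open>m\<close> of entries about N / (k - 1) or more.\<close>
  then have m1: "N \<le> real B * real L + (real k - 1) * m" unfolding m_def using k by (simp add: of_nat_diff)
  have "length (packed hs k s) \<le> 2 + s div k + 1" unfolding packed_def using hs by auto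
  then have "p \<le> 3 + real (s div k)" unfolding p_def by linarith
  then have "real k * p \<le> real k * (3 + real (s div k))" by (intro mult_left_mono) auto
  moreover have "real k * real (s div k) \<le> real s"
    unfolding of_nat_mult[symmetric] by (intro of_nat_mono) simp
  moreover have "real s \<le> N" unfolding N_def using s by simp
  ultimately have p1: "real k * p \<le> 3 * real k + N" by (simp add: distrib_left)
  have "sum_list (map (path_defect z) xs) \<le> real (length xs) * z" for xs
  proof (induction xs)
    case (Cons x xs)
    then show ?case using path_defect_bounds(1)[OF z, of x] by (simp add: distrib_right)
  qed simp
  then have d1: "sum_list (map (path_defect z) (packed hs k s)) \<le> p * z" unfolding p_def .
  have d2: "m * (z * (1 - 2 * z)) \<le> sum_list (map (path_defect z) ls)"
    unfolding m_def using ls(1)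
  proof (induction ls)
    case (Cons x xs)
    then show ?case using path_defect_bounds(2)[OF z, of x] by (simp add: distrib_right Suc_le_eq)
  qed simp
  have bg: "2 * (real k * real B * real L + 4 * real k ^ 2) < N" using big unfolding N_def .
  have km: "real k > 1"
  proof (rule ccontr)
    assume "\<not> real k > 1"
    then have "real k = 1" using kr by simp
    then have "N \<le> real B * real L" "2 * (real B * real L + 4) < N" using m1 bg by auto
    moreover have "0 \<le> real B * real L" by simp
    ultimately show False unfolding distrib_left by linarith
  qed
  \<comment> \<open>The packed list has about N / k entries. The gain by a factor k / (k - 1) in the
    number of entries outweighs the loss 1 - 2 * z in the defect because 4 * z * k \<le> 1;
    \<open>big\<close> covers the lower order terms.\<close>
  have "p < m * (1 - 2 * z)"
  proof (rule ccontr)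
    assume "\<not> p < m * (1 - 2 * z)"
    then have "m * (1 - 2 * z) \<le> p" by simp
    then have "real k * (real k - 1) * (m * (1 - 2 * z)) \<le> real k * (real k - 1) * p" using km by (intro mult_left_mono) auto
    also have "\<dots> = (real k - 1) * (real k * p)" by simp
    also have "\<dots> \<le> (real k - 1) * (3 * real k + N)" using p1 km by (intro mult_left_mono) auto
    finally have 1: "real k * (1 - 2 * z) * ((real k - 1) * m) \<le> (real k - 1) * (3 * real k + N)" by (simp add: mult_ac)
    have w: "0 \<le> 1 - 2 * z"
    proof -
      have "4 * z * 1 \<le> 4 * z * real k" using z kr by (intro mult_left_mono) auto
      then show ?thesis using zk by linarith
    qed
    have "real k * (1 - 2 * z) * (N - real B * real L) \<le> real k * (1 - 2 * z) * ((real k - 1) * m)"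
      using m1 w kr by (intro mult_left_mono mult_nonneg_nonneg) auto
    then have "real k * (1 - 2 * z) * (N - real B * real L) \<le> (real k - 1) * (3 * real k + N)" using 1 by linarith
    then have "real k * N - 2 * z * real k * N - (1 - 2 * z) * (real k * (real B * real L)) \<le> real k * N - N + 3 * real k ^ 2 - 3 * real k"
      by (simp add: algebra_simps power2_eq_square)
    moreover have "(1 - 2 * z) * (real k * (real B * real L)) \<le> 1 * (real k * (real B * real L))"
      using z by (intro mult_right_mono) auto
    moreover have "2 * z * real k * N \<le> 1 / 2 * N"
    proof (rule mult_right_mono)
      show "2 * z * real k \<le> 1 / 2" using zk by linarith
      show "0 \<le> N" unfolding N_def by simp
    qed
    ultimately have "N / 2 \<le> real k * (real B * real L) + 3 * real k ^ 2" using kr by linarith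
    then have "N \<le> 2 * (real k * real B * real L + 3 * real k ^ 2)" by (simp add: mult.assoc)
    moreover have "0 < real k ^ 2" using kr by simp
    ultimately show False using bg unfolding distrib_left by linarith
  qed
  then have "p * z < m * (1 - 2 * z) * z" using z by (intro mult_strict_right_mono) auto
  then have "sum_list (map (path_defect z) (packed hs k s)) < sum_list (map (path_defect z) ls)"
    using d1 d2 by (simp add: mult_ac)
  then show ?thesis using sum_path_weight_mono(2)[OF z] s sum_packed by simp
qed

section \<open>Disjoint paths in hub graphs\<close>

lemma HP2_packed: "HP2 n n1 n2 = packed [n1] n2 (n - 2 - n1)"
  unfolding HP2_def packed_def by (simp add: Let_def)

lemma HP3_packed: "HP3 n n1 n2 n3 = packed [n1, n2] n3 (n - 2 - n1 - n2)"
  unfolding HP3_def packed_def by (simp add: Let_def)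

lemma verts_tP: "verts (tP t l) = {0..<t * l}"
  unfolding tP_def paths_graph_def verts_def by (simp add: sum_list_replicate)

lemma edges_tP: "edges (tP t l) = {{i, Suc i} | i. Suc i < t * l \<and> Suc i \<notin> {k * l | k. k \<le> t}}"
proof -
  have "{sum_list (take k (replicate t l)) | k. k \<le> length (replicate t l)} = {k * l | k. k \<le> t}"
    by (auto simp: sum_list_replicate min_def)
  then show ?thesis unfolding tP_def paths_graph_def edges_def by (simp add: sum_list_replicate)
qed

lemma concat_nth_uniform:
  assumes "\<And>q. q \<in> set qs \<Longrightarrow> length q = l" "j < length qs" "r < l"
  shows "concat qs ! (j * l + r) = qs ! j ! r"
  using assms
proof (induction qs arbitrary: j)
  case (Cons q qs)
  have q: "length q = l" using Cons.prems(1) by simp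
  show ?case
  proof (cases j)
    case 0 then show ?thesis using Cons.prems(3) q by (simp add: nth_append)
  next
    case (Suc i)
    have "(q @ concat qs) ! (j * l + r) = concat qs ! (i * l + r)" using Suc q by (simp add: nth_append)
    then show ?thesis using Cons.IH[of i] Cons.prems Suc by simp
  qed
qed simp

lemma length_concat_uniform: "(\<And>q. q \<in> set qs \<Longrightarrow> length q = l) \<Longrightarrow> length (concat qs) = length qs * l"
  by (induction qs) auto

text \<open>Position j * l + r of the concatenation is entry r of path j, and an edge {i, Suc i} of
  \<open>tP\<close> never has Suc i at a multiple of \<open>l\<close>, so it stays inside one
  path.\<close>

lemma contains_tP:
  assumes qs: "length qs = t" "\<And>q. q \<in> set qs \<Longrightarrow> length q = l" "\<And>q. q \<in> set qs \<Longrightarrow> gpath (edges G) q"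
    and d: "distinct (concat qs)" "set (concat qs) \<subseteq> verts G" and l: "l > 0"
  shows "contains_subgraph G (tP t l)"
  unfolding contains_subgraph_def
proof (intro exI[of _ "\<lambda>i. concat qs ! i"] conjI ballI)
  have len: "length (concat qs) = t * l" using length_concat_uniform[of qs l] qs by simp
  show "inj_on ((!) (concat qs)) (verts (tP t l))" unfolding verts_tP
    using d(1) len by (intro inj_on_nth) auto
  have "concat qs ! i \<in> set (concat qs)" if "i < t * l" for i using that len by (intro nth_mem) simp
  then show "(!) (concat qs) ` verts (tP t l) \<subseteq> verts G" unfolding verts_tP using d(2) by auto
  fix e assume "e \<in> edges (tP t l)"
  then obtain i where i: "e = {i, Suc i}" "Suc i < t * l" "Suc i \<notin> {k * l | k. k \<le> t}" unfolding edges_tP by blast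
  define j where "j = i div l"
  define r where "r = i mod l"
  have ij: "i = j * l + r" "r < l" unfolding j_def r_def using l by simp_all
  have jt: "j < t" unfolding j_def using i(2) l by (simp add: less_mult_imp_div_less)
  have r: "Suc r < l"
  proof (rule ccontr)
    assume "\<not> Suc r < l"
    then have "Suc i = (j + 1) * l" using ij by simp
    then show False using i(3) jt by (metis (mono_tags, lifting) Suc_eq_plus1 Suc_leI mem_Collect_eq)
  qed
  have c: "concat qs ! i = qs ! j ! r" "concat qs ! Suc i = qs ! j ! Suc r"
    using concat_nth_uniform[of qs l j r] concat_nth_uniform[of qs l j "Suc r"] qs ij jt r by simp_all
  have "qs ! j \<in> set qs" using jt qs by simp
  then have "{qs ! j ! r, qs ! j ! Suc r} \<in> edges G" using qs(2,3)[of "qs ! j"] r unfolding gpath_nth by simp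
  then show "(!) (concat qs) ` e \<in> edges G" unfolding i(1) using c by simp
qed

section \<open>Hub graphs without the forbidden paths\<close>

context hub
begin

lemma component_edge:
  assumes "{x, y} \<in> edges G" "x \<in> set (pss ! k)" "k < length pss" "y \<noteq> u" "y \<noteq> v"
  shows "y \<in> set (pss ! k)"
proof -
  obtain j where j: "j < length (pss ! k)" "x = pss ! k ! j" using assms(2) by (auto simp: in_set_conv_nth)
  then show ?thesis using edge_path[OF assms(3) j(1), of y] assms j(1) by (auto intro!: nth_mem)
qed

text \<open>A path enters a new component only at its start and after each hub.\<close>
lemma path_components:
  assumes "a \<le> b" and f: "inj_on f {a..<b}" "f ` {a..<b} \<subseteq> V"
    and e: "\<And>i. a \<le> i \<Longrightarrow> Suc i < b \<Longrightarrow> {f i, f (Suc i)} \<in> edges G"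
  shows "\<exists>K. K \<subseteq> {..<length pss} \<and> f ` {a..<b} \<subseteq> {u, v} \<union> (\<Union>k\<in>K. set (pss ! k)) \<and>
    card K \<le> card (f ` {a..<b} \<inter> {u, v}) + (if a < b \<and> f (b - 1) \<notin> {u, v} then 1 else 0)"
  using assms
proof (induction b rule: dec_induct)
  case base then show ?case by (intro exI[of _ "{}"]) auto
next
  case (step b)
  have inj: "inj_on f {a..<b}" using step.prems(1) by (rule inj_on_subset) auto
  have "f ` {a..<b} \<subseteq> V" using step.prems(2) by auto
  from step.IH[OF inj this] step.prems(3) obtain K where K: "K \<subseteq> {..<length pss}"
    "f ` {a..<b} \<subseteq> {u, v} \<union> (\<Union>k\<in>K. set (pss ! k))"
    "card K \<le> card (f ` {a..<b} \<inter> {u, v}) + (if a < b \<and> f (b - 1) \<notin> {u, v} then 1 else 0)" by auto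
  have ins: "{a..<Suc b} = insert b {a..<b}" using step.hyps by auto
  have new: "f b \<notin> f ` {a..<b}" using step.prems(1) unfolding ins by (auto simp: inj_on_def)
  have im: "f ` {a..<Suc b} = insert (f b) (f ` {a..<b})" unfolding ins by simp
  have fK: "finite K" using K(1) finite_subset by blast
  show ?case
  \<comment> \<open>A hub removes the last summand of the bound but adds one to the number of hubs,
    which pays in advance for the component entered next.\<close>
  proof (cases "f b \<in> {u, v}")
    case True
    have "f ` {a..<Suc b} \<inter> {u, v} = insert (f b) (f ` {a..<b} \<inter> {u, v})" unfolding im using True by auto
    then have "card (f ` {a..<Suc b} \<inter> {u, v}) = Suc (card (f ` {a..<b} \<inter> {u, v}))" using new by simp
    then have "card K \<le> card (f ` {a..<Suc b} \<inter> {u, v})" using K(3) by (auto split: if_splits)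
    then show ?thesis using K(1,2) True unfolding im by (intro exI[of _ K]) auto
  next
    case False
    have h: "f ` {a..<Suc b} \<inter> {u, v} = f ` {a..<b} \<inter> {u, v}" unfolding im using False by auto
    have "f b \<in> V" using step.prems(2) unfolding im by blast
    then have "f b \<in> P" using False unfolding V_eq by simp
    then obtain k where k: "k < length pss" "f b \<in> set (pss ! k)" unfolding in_concat_nth by auto
    show ?thesis
    proof (cases "a < b \<and> f (b - 1) \<notin> {u, v}")
      case True
      then have "f (b - 1) \<in> f ` {a..<b}" by auto
      then obtain k' where k': "k' \<in> K" "f (b - 1) \<in> set (pss ! k')" using K(2) True by blast
      have "a \<le> b - 1" using True by auto
      then have "{f (b - 1), f b} \<in> edges G" using step.prems(3)[of "b - 1"] True by auto
      then have "f b \<in> set (pss ! k')" using component_edge[of "f (b - 1)" "f b" k'] k' K(1) False by auto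
      then have "f ` {a..<Suc b} \<subseteq> {u, v} \<union> (\<Union>k\<in>K. set (pss ! k))" using K(2) k'(1) unfolding im by blast
      moreover have "card K \<le> card (f ` {a..<Suc b} \<inter> {u, v}) + 1" using K(3) h by (auto split: if_splits)
      ultimately show ?thesis using K(1) False step.hyps by (intro exI[of _ K]) auto
    next
      case nh: False
      have "card (insert k K) \<le> card K + 1" using fK by (simp add: card_insert_if)
      also have "\<dots> \<le> card (f ` {a..<Suc b} \<inter> {u, v}) + 1" using K(3) nh h by (auto split: if_splits)
      finally have "card (insert k K) \<le> card (f ` {a..<Suc b} \<inter> {u, v}) + 1" .
      moreover have "f ` {a..<Suc b} \<subseteq> {u, v} \<union> (\<Union>k\<in>insert k K. set (pss ! k))" using K(2) k(2) unfolding im by blast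
      ultimately show ?thesis using K(1) k(1) False step.hyps by (intro exI[of _ "insert k K"]) auto
    qed
  qed
qed

lemma card_components: "finite K \<Longrightarrow> card (\<Union>k\<in>K. set (pss ! k)) \<le> (\<Sum>k\<in>K. length (pss ! k))"
  by (rule order_trans[OF card_UN_le]) (auto intro: sum_mono card_length)

text \<open>One copy of the path on \<open>l\<close> vertices that uses some hubs occupies at most
  one component more than it has hubs; these hubs and components must supply all its
  vertices.\<close>

lemma block_components:
  assumes f: "inj_on f {0..<t * l}" "f ` {0..<t * l} \<subseteq> V" "\<forall>e\<in>edges (tP t l). f ` e \<in> edges G"
    and j: "j < t"
  obtains K where "K \<subseteq> {..<length pss}" "f ` {j * l..<(j + 1) * l} \<subseteq> {u, v} \<union> (\<Union>k\<in>K. set (pss ! k))"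
    "card K \<le> card (f ` {j * l..<(j + 1) * l} \<inter> {u, v}) + 1"
    "l \<le> card (f ` {j * l..<(j + 1) * l} \<inter> {u, v}) + (\<Sum>k\<in>K. length (pss ! k))"
proof -
  let ?B = "{j * l..<(j + 1) * l}"
  have le: "(j + 1) * l \<le> t * l" using j by (intro mult_right_mono) auto
  have sub: "?B \<subseteq> {0..<t * l}" using le by auto
  have inj: "inj_on f ?B" using f(1) sub by (rule inj_on_subset)
  have V: "f ` ?B \<subseteq> V" using f(2) sub by blast
  have E: "{f i, f (Suc i)} \<in> edges G" if i: "j * l \<le> i" "Suc i < (j + 1) * l" for i
  proof -
    have "Suc i \<noteq> k * l" for k
    proof
      assume "Suc i = k * l"
      then have "j * l < k * l" "k * l < (j + 1) * l" using i by linarith+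
      then have "j < k" "k < j + 1" by (meson mult_less_cancel2)+
      then show False by simp
    qed
    then have "{i, Suc i} \<in> edges (tP t l)" unfolding edges_tP using i le by (intro CollectI exI[of _ i]) auto
    then show ?thesis using f(3) by force
  qed
  have "j * l \<le> (j + 1) * l" by simp
  from path_components[OF this inj V E] obtain K where K: "K \<subseteq> {..<length pss}"
    "f ` ?B \<subseteq> {u, v} \<union> (\<Union>k\<in>K. set (pss ! k))"
    "card K \<le> card (f ` ?B \<inter> {u, v}) + (if j * l < (j + 1) * l \<and> f ((j + 1) * l - 1) \<notin> {u, v} then 1 else 0)" by blast
  have fK: "finite K" using K(1) finite_subset by blast
  have "l = card (f ` ?B)" using card_image[OF inj] by simp
  also have "\<dots> \<le> card (f ` ?B \<inter> {u, v} \<union> (\<Union>k\<in>K. set (pss ! k)))" using K(2) fK by (intro card_mono) auto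
  also have "\<dots> \<le> card (f ` ?B \<inter> {u, v}) + card (\<Union>k\<in>K. set (pss ! k))" by (rule card_Un_le)
  also have "\<dots> \<le> card (f ` ?B \<inter> {u, v}) + (\<Sum>k\<in>K. length (pss ! k))" using card_components[OF fK] by simp
  finally show ?thesis using that[of K] K by (auto split: if_splits)
qed

lemma blocks_disjoint:
  fixes t l i j :: nat
  assumes "inj_on f {0..<t * l}" "i < t" "j < t" "i \<noteq> j"
  shows "f ` {i * l..<(i + 1) * l} \<inter> f ` {j * l..<(j + 1) * l} = {}"
proof -
  have sub: "{k * l..<(k + 1) * l} \<subseteq> {0..<t * l}" if "k < t" for k
  proof -
    have "(k + 1) * l \<le> t * l" using that by (intro mult_right_mono) auto
    then show ?thesis by auto
  qed
  have "{i * l..<(i + 1) * l} \<inter> {j * l..<(j + 1) * l} = {}"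
  proof -
    have "i + 1 \<le> j \<or> j + 1 \<le> i" using assms(4) by linarith
    then have "(i + 1) * l \<le> j * l \<or> (j + 1) * l \<le> i * l" by (meson mult_le_mono1)
    then show ?thesis by auto
  qed
  then show ?thesis using inj_on_image_Int[OF assms(1) sub[OF assms(2)] sub[OF assms(3)]] by (simp only: image_empty)
qed

text \<open>With at most two hubs a path meets at most three components, so it has at most A + 2 * m
  + 2 < l vertices.\<close>

lemma F_free_single:
  assumes l: "A + 2 * m \<le> l - 3" "l \<ge> 3" "m \<le> A"
    and len: "\<And>k. k < length pss \<Longrightarrow> length (pss ! k) \<le> (if k = 0 then A else m)"
  shows "F_free (tP 1 l) G"
  unfolding F_free_def contains_subgraph_def verts_tP
proof
  assume "\<exists>f. inj_on f {0..<1 * l} \<and> f ` {0..<1 * l} \<subseteq> V \<and> (\<forall>e\<in>edges (tP 1 l). f ` e \<in> edges G)"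
  then obtain f where f: "inj_on f {0..<1 * l}" "f ` {0..<1 * l} \<subseteq> V" "\<forall>e\<in>edges (tP 1 l). f ` e \<in> edges G" by blast
  let ?h = "card (f ` {0 * l..<(0 + 1) * l} \<inter> {u, v})"
  obtain K where K: "K \<subseteq> {..<length pss}" "card K \<le> ?h + 1" "l \<le> ?h + (\<Sum>k\<in>K. length (pss ! k))"
    by (rule block_components[OF f, of 0]) auto
  have h: "?h \<le> 2" using card_mono[of "{u, v}" "f ` {0 * l..<(0 + 1) * l} \<inter> {u, v}"] dist by simp
  have fK: "finite K" using K(1) finite_subset by blast
  have "(\<Sum>k\<in>K. length (pss ! k)) \<le> (\<Sum>k\<in>K. m + (if k = 0 then A - m else 0))"
    using K(1) len l(3) by (intro sum_mono) (fastforce split: if_splits)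
  also have "\<dots> = card K * m + (if 0 \<in> K then A - m else 0)" using fK by (simp add: sum.distrib)
  also have "\<dots> \<le> 3 * m + (A - m)" using K(2) h by (intro add_mono mult_right_mono) auto
  finally show False using K(3) h l by simp
qed

text \<open>No component has \<open>l\<close> vertices, so each of the two paths uses a hub, hence
  exactly one, and meets at most two components. Without component 0 these would give at most B + C
  + 1 < l vertices. So both paths use component 0 and meet at most three components together, with A
  + B + C + 2 < 2 * l vertices including the hubs.\<close>

lemma F_free_two:
  assumes l: "A + 1 \<le> l" "B + C + 2 \<le> l" "C \<le> B" "B \<le> A" "l > 0"
    and len: "\<And>k. k < length pss \<Longrightarrow> length (pss ! k) \<le> (if k = 0 then A else if k = 1 then B else C)"
  shows "F_free (tP 2 l) G"
  unfolding F_free_def contains_subgraph_def verts_tP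
proof
  assume "\<exists>f. inj_on f {0..<2 * l} \<and> f ` {0..<2 * l} \<subseteq> V \<and> (\<forall>e\<in>edges (tP 2 l). f ` e \<in> edges G)"
  then obtain f where f: "inj_on f {0..<2 * l}" "f ` {0..<2 * l} \<subseteq> V" "\<forall>e\<in>edges (tP 2 l). f ` e \<in> edges G" by blast
  let ?B = "\<lambda>j. f ` {j * l..<(j + 1) * l}"
  let ?h = "\<lambda>j. card (?B j \<inter> {u, v})"
  have bound: "(\<Sum>k\<in>K. length (pss ! k)) \<le> (if 0 \<in> K then A - C else 0) + (if 1 \<in> K then B - C else 0) + card K * C"
    if K: "K \<subseteq> {..<length pss}" for K
  proof -
    have fK: "finite K" using K finite_subset by blast
    have "(\<Sum>k\<in>K. length (pss ! k)) \<le> (\<Sum>k\<in>K. (if k = 0 then A - C else 0) + (if k = 1 then B - C else 0) + C)"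
    proof (intro sum_mono)
      fix k assume "k \<in> K"
      then have "k < length pss" using K by blast
      then have "length (pss ! k) \<le> (if k = 0 then A else if k = 1 then B else C)" by (rule len)
      then show "length (pss ! k) \<le> (if k = 0 then A - C else 0) + (if k = 1 then B - C else 0) + C"
        using l(3,4) by (auto split: if_splits)
    qed
    also have "\<dots> = (if 0 \<in> K then A - C else 0) + (if 1 \<in> K then B - C else 0) + card K * C"
      using fK by (simp add: sum.distrib)
    finally show ?thesis .
  qed
  obtain K0 where K0: "K0 \<subseteq> {..<length pss}" "?B 0 \<subseteq> {u, v} \<union> (\<Union>k\<in>K0. set (pss ! k))"
    "card K0 \<le> ?h 0 + 1" "l \<le> ?h 0 + (\<Sum>k\<in>K0. length (pss ! k))"
    by (rule block_components[OF f, of 0]) auto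
  obtain K1 where K1: "K1 \<subseteq> {..<length pss}" "?B 1 \<subseteq> {u, v} \<union> (\<Union>k\<in>K1. set (pss ! k))"
    "card K1 \<le> ?h 1 + 1" "l \<le> ?h 1 + (\<Sum>k\<in>K1. length (pss ! k))"
    by (rule block_components[OF f, of 1]) auto
  have fin: "finite K0" "finite K1" using K0(1) K1(1) finite_subset by blast+
  have dj: "?B 0 \<inter> ?B 1 = {}" using blocks_disjoint[OF f(1), of 0 1] by simp
  have "?h 0 + ?h 1 = card ((?B 0 \<inter> {u, v}) \<union> (?B 1 \<inter> {u, v}))" using dj by (intro card_Un_disjoint[symmetric]) auto
  also have "\<dots> \<le> card {u, v}" by (intro card_mono) auto
  finally have h: "?h 0 + ?h 1 \<le> 2" using dist by simp
  have pos: "?h j \<noteq> 0" if K: "K \<subseteq> {..<length pss}" "card K \<le> ?h j + 1" "l \<le> ?h j + (\<Sum>k\<in>K. length (pss ! k))" for K j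
  proof
    assume z: "?h j = 0"
    have fK: "finite K" using K finite_subset by blast
    have "card K \<le> 1" using K(2) unfolding z by simp
    then have "card K = 0 \<or> card K = 1" by linarith
    then have "K = {} \<or> (\<exists>x. K = {x})" using fK by (simp add: card_1_singleton_iff)
    then have "(\<Sum>k\<in>K. length (pss ! k)) \<le> A"
    proof (elim disjE exE)
      fix x assume "K = {x}"
      then show ?thesis using len[of x] K(1) l by (auto split: if_splits)
    qed simp
    then show False using K(3) z l by linarith
  qed
  have h1: "?h 0 = 1" "?h 1 = 1" using pos[OF K0(1,3,4)] pos[OF K1(1,3,4)] h by linarith+
  have in0: "0 \<in> K" if K: "K \<subseteq> {..<length pss}" "card K \<le> 2" "l \<le> 1 + (\<Sum>k\<in>K. length (pss ! k))" for K
  proof (rule ccontr)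
    assume "0 \<notin> K"
    then have "(\<Sum>k\<in>K. length (pss ! k)) \<le> (if 1 \<in> K then B - C else 0) + card K * C" using bound[OF K(1)] by simp
    also have "\<dots> \<le> (B - C) + 2 * C" using K(2) by (intro add_mono mult_right_mono) auto
    finally show False using K(3) l by linarith
  qed
  have c0: "card K0 \<le> 2" "l \<le> 1 + (\<Sum>k\<in>K0. length (pss ! k))" using K0(3,4) unfolding h1 by linarith+
  have c1: "card K1 \<le> 2" "l \<le> 1 + (\<Sum>k\<in>K1. length (pss ! k))" using K1(3,4) unfolding h1 by linarith+
  have z: "0 \<in> K0" "0 \<in> K1" using in0[OF K0(1) c0] in0[OF K1(1) c1] .
  let ?K = "K0 \<union> K1"
  have "card ?K + card (K0 \<inter> K1) = card K0 + card K1" using card_Un_Int[OF fin] by simp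
  moreover have "card (K0 \<inter> K1) \<ge> 1" using z fin card_mono[of "K0 \<inter> K1" "{0}"] by simp
  ultimately have cK: "card ?K \<le> 3" using K0(3) K1(3) h1 by linarith
  have KS: "?K \<subseteq> {..<length pss}" using K0 K1 by blast
  have "2 * l = card (?B 0 \<union> ?B 1)"
  proof -
    have "inj_on f {j * l..<(j + 1) * l}" if "j < 2" for j
    proof -
      have "(j + 1) * l \<le> 2 * l" using that by (intro mult_right_mono) auto
      then show ?thesis using f(1) by (intro inj_on_subset[OF f(1)]) auto
    qed
    from card_image[OF this[of 0]] card_image[OF this[of 1]]
    have "card (?B 0) = l" "card (?B 1) = l" by simp_all
    then show ?thesis using card_Un_disjoint[OF _ _ dj] by simp
  qed
  also have "\<dots> \<le> card ({u, v} \<union> (\<Union>k\<in>?K. set (pss ! k)))"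
    using K0(2) K1(2) fin by (intro card_mono) auto
  also have "\<dots> \<le> card {u, v} + card (\<Union>k\<in>?K. set (pss ! k))" by (rule card_Un_le)
  also have "\<dots> \<le> 2 + (\<Sum>k\<in>?K. length (pss ! k))" using card_components[of ?K] fin dist by simp
  also have "\<dots> \<le> 2 + ((A - C) + (B - C) + 3 * C)"
  proof -
    have "(\<Sum>k\<in>?K. length (pss ! k)) \<le> (if 0 \<in> ?K then A - C else 0) + (if 1 \<in> ?K then B - C else 0) + card ?K * C"
      by (rule bound[OF KS])
    also have "\<dots> \<le> (A - C) + (B - C) + 3 * C" using cK by (intro add_mono mult_right_mono) auto
    finally show ?thesis by simp
  qed
  finally show False using l by linarith
qed

text \<open>At most two of the disjoint paths contain a hub. The other t - 2 or more lie inside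
  single components, which can only be component 0, and that has fewer than (t - 2) * l
  vertices.\<close>

lemma F_free_many:
  assumes t: "t \<ge> 2" and len0: "length (pss ! 0) < (t - 2) * l" and l: "l > 0"
    and len: "\<And>k. 0 < k \<Longrightarrow> k < length pss \<Longrightarrow> length (pss ! k) < l"
  shows "F_free (tP t l) G"
  unfolding F_free_def contains_subgraph_def verts_tP
proof
  assume "\<exists>f. inj_on f {0..<t * l} \<and> f ` {0..<t * l} \<subseteq> V \<and> (\<forall>e\<in>edges (tP t l). f ` e \<in> edges G)"
  then obtain f where f: "inj_on f {0..<t * l}" "f ` {0..<t * l} \<subseteq> V" "\<forall>e\<in>edges (tP t l). f ` e \<in> edges G" by blast
  let ?B = "\<lambda>j. f ` {j * l..<(j + 1) * l}"
  define J where "J = {j. j < t \<and> ?B j \<inter> {u, v} = {}}"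
  have bd: "?B i \<inter> ?B j = {}" if "i < t" "j < t" "i \<noteq> j" for i j using blocks_disjoint[OF f(1) that] .
  have one: "card {j. j < t \<and> p \<in> ?B j} \<le> 1" for p
  proof (rule ccontr)
    assume "\<not> card {j. j < t \<and> p \<in> ?B j} \<le> 1"
    then have "card {j. j < t \<and> p \<in> ?B j} \<ge> 2" by simp
    then obtain T where "T \<subseteq> {j. j < t \<and> p \<in> ?B j}" "card T = 2" by (meson obtain_subset_with_card_n)
    then obtain i j where "i \<noteq> j" "i < t" "j < t" "p \<in> ?B i" "p \<in> ?B j" by (auto simp: card_2_iff)
    then show False using bd by blast
  qed
  have "{..<t} \<subseteq> J \<union> ({j. j < t \<and> u \<in> ?B j} \<union> {j. j < t \<and> v \<in> ?B j})" unfolding J_def by blast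
  then have "card {..<t} \<le> card (J \<union> ({j. j < t \<and> u \<in> ?B j} \<union> {j. j < t \<and> v \<in> ?B j}))"
    by (intro card_mono) (auto simp: J_def)
  also have "\<dots> \<le> card J + card ({j. j < t \<and> u \<in> ?B j} \<union> {j. j < t \<and> v \<in> ?B j})" by (rule card_Un_le)
  also have "\<dots> \<le> card J + (card {j. j < t \<and> u \<in> ?B j} + card {j. j < t \<and> v \<in> ?B j})" by (intro add_left_mono card_Un_le)
  also have "\<dots> \<le> card J + 2" using one[of u] one[of v] by linarith
  finally have cJ: "t - 2 \<le> card J" by simp
  have inc: "?B j \<subseteq> set (pss ! 0)" "card (?B j) = l" if j: "j \<in> J" for j
  proof -
    have jt: "j < t" and e: "?B j \<inter> {u, v} = {}" using j unfolding J_def by auto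
    obtain K where K: "K \<subseteq> {..<length pss}" "?B j \<subseteq> {u, v} \<union> (\<Union>k\<in>K. set (pss ! k))"
      "card K \<le> card (?B j \<inter> {u, v}) + 1" "l \<le> card (?B j \<inter> {u, v}) + (\<Sum>k\<in>K. length (pss ! k))"
      by (rule block_components[OF f jt])
    have fK: "finite K" using K finite_subset by blast
    have h0: "card (?B j \<inter> {u, v}) = 0" using e by simp
    have "K \<noteq> {}" using K(4) h0 l by auto
    then have "card K = 1" using K(3) h0 fK by (simp add: le_antisym Suc_le_eq card_gt_0_iff)
    then obtain k where k: "K = {k}" by (auto simp: card_1_singleton_iff)
    have "k = 0"
    proof (rule ccontr)
      assume "k \<noteq> 0"
      then have "length (pss ! k) < l" using len K(1) k by auto
      then show False using K(4) h0 k by simp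
    qed
    then show "?B j \<subseteq> set (pss ! 0)" using K(2) k e by auto
    have "(j + 1) * l \<le> t * l" using jt by (intro mult_right_mono) auto
    then have "inj_on f {j * l..<(j + 1) * l}" by (intro inj_on_subset[OF f(1)]) auto
    from card_image[OF this] show "card (?B j) = l" by simp
  qed
  have fJ: "finite J" unfolding J_def by simp
  have "(t - 2) * l \<le> card J * l" using cJ by (rule mult_right_mono) simp
  also have "\<dots> = (\<Sum>j\<in>J. card (?B j))" using inc(2) by simp
  also have "\<dots> = card (\<Union>j\<in>J. ?B j)"
    using fJ bd unfolding J_def by (intro card_UN_disjoint[symmetric]) auto
  also have "\<dots> \<le> card (set (pss ! 0))" using inc(1) by (intro card_mono) auto
  also have "\<dots> \<le> length (pss ! 0)" by (rule card_length)
  finally show False using len0 by simp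
qed

end

section \<open>Forbidden paths built from two hubs and long components\<close>

lemma gpath_take: "gpath E ps \<Longrightarrow> gpath E (take n ps)"
  unfolding gpath_nth by simp

lemma gpath_drop: "gpath E ps \<Longrightarrow> gpath E (drop n ps)"
  unfolding gpath_nth by (auto simp: add.commute)

lemma gpath_append:
  "gpath E (ps @ qs) \<longleftrightarrow> gpath E ps \<and> gpath E qs \<and> set ps \<inter> set qs = {} \<and>
    (ps \<noteq> [] \<longrightarrow> qs \<noteq> [] \<longrightarrow> {last ps, hd qs} \<in> E)"
  unfolding gpath_def by (auto simp: successively_append_iff)

lemma gpath_Cons:
  "gpath E (p # qs) \<longleftrightarrow> gpath E qs \<and> p \<notin> set qs \<and> (qs \<noteq> [] \<longrightarrow> {p, hd qs} \<in> E)"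
  unfolding gpath_def by (cases qs) auto

lemma gpath_chunks:
  assumes "l > 0" "gpath E ps"
  shows "\<exists>qs. length qs = length ps div l \<and> (\<forall>q\<in>set qs. length q = l \<and> gpath E q) \<and>
    distinct (concat qs) \<and> set (concat qs) \<subseteq> set ps"
  using assms(2)
proof (induction "length ps" arbitrary: ps rule: less_induct)
  case less
  show ?case
  proof (cases "length ps < l")
    case True
    then show ?thesis by (intro exI[of _ "[]"]) simp
  next
    case False
    have "length (drop l ps) < length ps" using False assms(1) by simp
    from less.hyps[OF this gpath_drop[OF less.prems]] obtain qs where qs:
      "length qs = length (drop l ps) div l" "\<forall>q\<in>set qs. length q = l \<and> gpath E q"
      "distinct (concat qs)" "set (concat qs) \<subseteq> set (drop l ps)" by blast
    have "length ps div l = Suc ((length ps - l) div l)" using False assms(1) by (simp add: le_div_geq)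
    moreover have "set (take l ps) \<inter> set (drop l ps) = {}" "distinct (take l ps)"
      using less.prems set_take_disj_set_drop_if_distinct[of ps l l] unfolding gpath_def by auto
    moreover have "set (take l ps) \<subseteq> set ps" "set (drop l ps) \<subseteq> set ps" by (rule set_take_subset, rule set_drop_subset)
    ultimately show ?thesis using qs False gpath_take[OF less.prems, of l]
      by (intro exI[of _ "take l ps # qs"]) auto
  qed
qed

lemma gpath_chunks_concat:
  assumes "l > 0" "distinct (concat pss)" "\<And>ps. ps \<in> set pss \<Longrightarrow> gpath E ps"
  shows "\<exists>qs. length qs = sum_list (map (\<lambda>ps. length ps div l) pss) \<and> (\<forall>q\<in>set qs. length q = l \<and> gpath E q) \<and>
    distinct (concat qs) \<and> set (concat qs) \<subseteq> set (concat pss)"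
  using assms(2,3)
proof (induction pss)
  case Nil then show ?case by (intro exI[of _ "[]"]) simp
next
  case (Cons ps pss)
  have g: "gpath E ps" using Cons.prems by simp
  obtain q1 where q1: "length q1 = length ps div l" "\<forall>q\<in>set q1. length q = l \<and> gpath E q"
    "distinct (concat q1)" "set (concat q1) \<subseteq> set ps" using gpath_chunks[OF assms(1) g] by blast
  have "distinct (concat pss)" "\<And>ps. ps \<in> set pss \<Longrightarrow> gpath E ps" using Cons.prems by auto
  then obtain q2 where q2: "length q2 = sum_list (map (\<lambda>ps. length ps div l) pss)" "\<forall>q\<in>set q2. length q = l \<and> gpath E q"
    "distinct (concat q2)" "set (concat q2) \<subseteq> set (concat pss)" using Cons.IH by blast
  have "set ps \<inter> set (concat pss) = {}" using Cons.prems(1) by simp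
  then have "distinct (concat (q1 @ q2))" using q1(3,4) q2(3,4) by (simp del: set_concat) blast
  moreover have "set (concat (q1 @ q2)) \<subseteq> set (concat (ps # pss))" using q1(4) q2(4) by (simp del: set_concat) blast
  moreover have "\<forall>q\<in>set (q1 @ q2). length q = l \<and> gpath E q" using q1(2) q2(2) by auto
  ultimately show ?case using q1(1) q2(1) by (intro exI[of _ "q1 @ q2"]) simp
qed

lemma distinct_concat_take: "distinct (concat qs) \<Longrightarrow> distinct (concat (take n qs))"
  by (metis append_take_drop_id concat_append distinct_append)

lemma set_concat_take: "set (concat (take n qs)) \<subseteq> set (concat qs)"
  using set_take_subset[of n qs] by auto

lemma F_free_no_long_path:
  assumes free: "F_free (tP t l) G" and l: "l > 0" and ps: "gpath (edges G) ps" "set ps \<subseteq> verts G"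
  shows "length ps < t * l"
proof (rule ccontr)
  assume "\<not> length ps < t * l"
  then have d: "t \<le> length ps div l" using l by (simp add: less_eq_div_iff_mult_less_eq)
  obtain qs where qs: "length qs = length ps div l" "\<forall>q\<in>set qs. length q = l \<and> gpath (edges G) q"
    "distinct (concat qs)" "set (concat qs) \<subseteq> set ps" using gpath_chunks[OF l ps(1)] by blast
  have "contains_subgraph G (tP t l)"
  proof (rule contains_tP[of "take t qs"])
    show "length (take t qs) = t" using d qs(1) by simp
    show "distinct (concat (take t qs))" using qs(3) by (rule distinct_concat_take)
    show "set (concat (take t qs)) \<subseteq> verts G" using set_concat_take[of t qs] qs(4) ps(2) by blast
  qed (use qs(2) l in \<open>auto dest: in_set_takeD\<close>)
  then show False using free unfolding F_free_def by simp
qed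

lemma contains_tP_two_more:
  assumes g: "gpath (edges G) ps" "gpath (edges G) ps'" "l \<le> length ps" "l \<le> length ps'" "l > 0"
    and qs: "t \<ge> 2" "t - 2 \<le> length qs" "\<forall>q\<in>set qs. length q = l \<and> gpath (edges G) q" "distinct (concat qs)"
    and dj: "set ps \<inter> set ps' = {}" "set ps \<inter> set (concat qs) = {}" "set ps' \<inter> set (concat qs) = {}"
    and V: "set ps \<subseteq> verts G" "set ps' \<subseteq> verts G" "set (concat qs) \<subseteq> verts G"
  shows "contains_subgraph G (tP t l)"
proof -
  define x y z where "x = take l ps" and "y = take l ps'" and "z = take (t - 2) qs"
  have s: "set x \<subseteq> set ps" "set y \<subseteq> set ps'" "set (concat z) \<subseteq> set (concat qs)"
    unfolding x_def y_def z_def by (rule set_take_subset, rule set_take_subset, rule set_concat_take)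
  have xy: "gpath (edges G) x" "gpath (edges G) y" "length x = l" "length y = l"
    unfolding x_def y_def using gpath_take g by simp_all
  have z: "\<And>q. q \<in> set z \<Longrightarrow> length q = l \<and> gpath (edges G) q" "distinct (concat z)" "length z = t - 2"
    unfolding z_def using qs distinct_concat_take by (auto dest: in_set_takeD)
  show ?thesis
  proof (rule contains_tP[of "x # y # z"])
    show "length (x # y # z) = t" using z qs by simp
    have "set x \<inter> set y = {}" "set x \<inter> set (concat z) = {}" "set y \<inter> set (concat z) = {}" using dj s by blast+
    then show "distinct (concat (x # y # z))" using z(2) xy unfolding gpath_def by auto
    show "set (concat (x # y # z)) \<subseteq> verts G" using s V by (simp del: set_concat) blast
  qed (use xy z g in auto)
qed

text \<open>In contrast to \<open>hub\<close>, further vertices and edges of \<open>G\<close> are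
  left open: only the edges needed to find paths in \<open>G\<close> are recorded. The lists are in
  order of decreasing length.\<close>

locale hub_paths =
  fixes G :: graph and u v :: nat and pss :: "nat list list"
  assumes dist: "distinct (u # v # concat pss)"
    and verts: "insert u (insert v (set (concat pss))) \<subseteq> verts G"
    and hubs: "\<And>w. w \<in> set (concat pss) \<Longrightarrow> {u, w} \<in> edges G \<and> {v, w} \<in> edges G"
    and paths: "\<And>ps. ps \<in> set pss \<Longrightarrow> gpath (edges G) ps \<and> ps \<noteq> []"
    and sorted: "\<And>i j. i \<le> j \<Longrightarrow> j < length pss \<Longrightarrow> length (pss ! j) \<le> length (pss ! i)"
begin

abbreviation "E \<equiv> edges G"

lemma nth_path: "i < length pss \<Longrightarrow> gpath E (pss ! i) \<and> pss ! i \<noteq> [] \<and> set (pss ! i) \<subseteq> set (concat pss)"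
proof -
  assume "i < length pss"
  then have i: "pss ! i \<in> set pss" by simp
  then have "set (pss ! i) \<subseteq> set (concat pss)" unfolding set_concat by blast
  then show ?thesis using paths[OF i] by blast
qed

lemma nth_disjoint: "i < length pss \<Longrightarrow> j < length pss \<Longrightarrow> i \<noteq> j \<Longrightarrow> set (pss ! i) \<inter> set (pss ! j) = {}"
proof -
  assume ij: "i < length pss" "j < length pss" "i \<noteq> j"
  have d: "distinct (concat pss)" using dist by simp
  show ?thesis
  proof (rule ccontr)
    assume "set (pss ! i) \<inter> set (pss ! j) \<noteq> {}"
    then obtain a b where "a < length (pss ! i)" "b < length (pss ! j)" "pss ! i ! a = pss ! j ! b"
      by (metis disjoint_iff in_set_conv_nth)
    then show False using concat_nth_inj[OF d ij(1) _ ij(2)] ij(3) by blast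
  qed
qed

lemma hub_nth: "i < length pss \<Longrightarrow> w \<in> set (pss ! i) \<Longrightarrow>
    {u, w} \<in> E \<and> {w, u} \<in> E \<and> {v, w} \<in> E \<and> {w, v} \<in> E \<and> w \<noteq> u \<and> w \<noteq> v"
proof -
  assume i: "i < length pss" "w \<in> set (pss ! i)"
  then have w: "w \<in> set (concat pss)" using nth_path[OF i(1)] by blast
  then have "w \<noteq> u" "w \<noteq> v" using dist by auto
  then show ?thesis using hubs[OF w] by (simp add: insert_commute)
qed

lemma hub_Cons:
  assumes "p = u \<or> p = v" "i < length pss"
  shows "gpath E (p # pss ! i)"
proof -
  have "hd (pss ! i) \<in> set (pss ! i)" using nth_path[OF assms(2)] by simp
  then show ?thesis using nth_path[OF assms(2)] hub_nth[OF assms(2)] assms(1) unfolding gpath_Cons by auto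
qed

lemma hub_join:
  assumes "p = u \<or> p = v" "i < length pss" "j < length pss" "i \<noteq> j"
  shows "gpath E (pss ! i @ p # pss ! j)"
proof -
  have "last (pss ! i) \<in> set (pss ! i)" using nth_path[OF assms(2)] by simp
  then show ?thesis
    using nth_path[OF assms(2)] hub_Cons[OF assms(1,3)] hub_nth[OF assms(2)] nth_disjoint[OF assms(2-4)] assms(1)
    unfolding gpath_append by auto
qed

lemma double_join:
  assumes "i < length pss" "j < length pss" "k < length pss" "i \<noteq> j" "i \<noteq> k" "j \<noteq> k"
  shows "gpath E (pss ! i @ u # pss ! j @ v # pss ! k)"
proof -
  have "last (pss ! i) \<in> set (pss ! i)" "hd (pss ! j) \<in> set (pss ! j)"
    using nth_path[OF assms(1)] nth_path[OF assms(2)] by simp_all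
  moreover have "gpath E (pss ! j @ v # pss ! k)" by (rule hub_join) (use assms in auto)
  ultimately show ?thesis
    using nth_path[OF assms(1)] nth_path[OF assms(2)] hub_nth[OF assms(1)] hub_nth[OF assms(2)] hub_nth[OF assms(3)]
      nth_disjoint[OF assms(1,2,4)] nth_disjoint[OF assms(1,3,5)] dist
    unfolding gpath_append gpath_Cons by auto
qed

lemma sub_verts: "i < length pss \<Longrightarrow> set (pss ! i) \<subseteq> verts G"
  using nth_path[of i] verts by auto

text \<open>Otherwise the three longest components, joined through the two hubs, contain a path on
  \<open>l\<close> vertices.\<close>

lemma free_three:
  assumes free: "F_free (tP 1 l) G" and l: "l > 0" and n: "length pss \<ge> 3"
  shows "length (pss ! 0) + length (pss ! 1) + length (pss ! 2) + 2 < l"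
proof -
  let ?p = "pss ! 0 @ u # pss ! 1 @ v # pss ! 2"
  have n0: "pss \<noteq> []" using n by auto
  have "gpath E ?p" by (rule double_join) (use n n0 in auto)
  moreover have "set ?p \<subseteq> verts G" using sub_verts[of 0] sub_verts[of 1] sub_verts[of 2] verts n n0 by auto
  ultimately have "length ?p < 1 * l" by (rule F_free_no_long_path[OF free l])
  then show ?thesis by simp
qed

text \<open>Otherwise the first and fourth components joined by \<open>u\<close>, and the second and
  third joined by \<open>v\<close>, give two disjoint paths on \<open>l\<close> vertices.\<close>

lemma free_four:
  assumes free: "F_free (tP 2 l) G" and l: "l > 0" and n: "length pss \<ge> 4"
  shows "length (pss ! 0) + length (pss ! 3) + 1 < l \<or> length (pss ! 1) + length (pss ! 2) + 1 < l"
proof (rule ccontr)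
  assume a: "\<not> ?thesis"
  have n0: "pss \<noteq> []" using n by auto
  have dj: "set (pss ! 0 @ u # pss ! 3) \<inter> set (pss ! 1 @ v # pss ! 2) = {}"
    using nth_disjoint[of 0 1] nth_disjoint[of 0 2] nth_disjoint[of 3 1] nth_disjoint[of 3 2]
      hub_nth[of 0 v] hub_nth[of 1 u] hub_nth[of 2 u] hub_nth[of 3 v] dist n n0 by auto
  have "contains_subgraph G (tP 2 l)"
  proof (rule contains_tP_two_more[where qs = "[]", OF _ _ _ _ l _ _ _ _ dj])
    show "gpath E (pss ! 0 @ u # pss ! 3)" "gpath E (pss ! 1 @ v # pss ! 2)" by (intro hub_join; use n n0 in auto)+
    show "set (pss ! 0 @ u # pss ! 3) \<subseteq> verts G" "set (pss ! 1 @ v # pss ! 2) \<subseteq> verts G"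
      using sub_verts[of 0] sub_verts[of 1] sub_verts[of 2] sub_verts[of 3] verts n n0 by auto
  qed (use a in auto)
  then show False using free unfolding F_free_def by simp
qed

text \<open>Otherwise the longest component is one path and the next three, joined by both hubs, are
  the other.\<close>

lemma free_long:
  assumes free: "F_free (tP 2 l) G" and l: "l > 0" and n: "length pss \<ge> 4"
    and big: "length (pss ! 1) + length (pss ! 2) + length (pss ! 3) + 2 \<ge> l"
  shows "length (pss ! 0) < l"
proof (rule ccontr)
  assume a: "\<not> ?thesis"
  have n0: "pss \<noteq> []" using n by auto
  let ?r = "pss ! 1 @ u # pss ! 2 @ v # pss ! 3"
  have dj: "set (pss ! 0) \<inter> set ?r = {}"
    using nth_disjoint[of 0 1] nth_disjoint[of 0 2] nth_disjoint[of 0 3] hub_nth[of 0 u] hub_nth[of 0 v] n n0 by auto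
  have "contains_subgraph G (tP 2 l)"
  proof (rule contains_tP_two_more[where qs = "[]", OF _ _ _ _ l _ _ _ _ dj])
    show "gpath E ?r" by (rule double_join) (use n in auto)
    show "gpath E (pss ! 0)" using nth_path[of 0] n0 by simp
    show "set (pss ! 0) \<subseteq> verts G" "set ?r \<subseteq> verts G"
      using sub_verts[of 0] sub_verts[of 1] sub_verts[of 2] sub_verts[of 3] verts n n0 by auto
  qed (use a big in auto)
  then show False using free unfolding F_free_def by simp
qed

text \<open>Components t - 2 and t - 1 have at least l - 1 vertices and become paths on at least
  \<open>l\<close> vertices by adding one hub each. Hence the remaining components must not supply t
  - 2 further disjoint paths.\<close>

lemma free_chunks:
  assumes free: "F_free (tP t l) G" and l: "l > 0" and t: "t \<ge> 2" "length pss \<ge> t" and bulk: "length (pss ! (t - 1)) \<ge> l - 1"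
  shows "sum_list (map (\<lambda>ps. length ps div l) pss) < t - 2"
proof (rule ccontr)
  assume a: "\<not> ?thesis"
  define f where "f = (\<lambda>ps :: nat list. length ps div l)"
  let ?A = "take (t - 2) pss"
  \<comment> \<open>The chunks can be taken from the first t - 2 components: either all of these
    have at least \<open>l\<close> vertices, or no later component has, and then every chunk comes
    from the first ones.\<close>
  have ge: "sum_list (map f ?A) \<ge> t - 2"
  proof -
    consider "t - 2 = 0" | "t - 2 > 0" "length (pss ! (t - 3)) \<ge> l" | "t - 2 > 0" "length (pss ! (t - 3)) < l" by linarith
    then show ?thesis
    proof cases
      case 1 then show ?thesis by simp
    next
      case 2
      have "1 \<le> f (pss ! i)" if "i < t - 2" for i
      proof -
        have "length (pss ! (t - 3)) \<le> length (pss ! i)" using that t by (intro sorted) auto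
        then have "l \<le> length (pss ! i)" using 2 by linarith
        then show ?thesis unfolding f_def using l by (simp add: Suc_le_eq div_greater_zero_iff)
      qed
      then have "(\<Sum>i<t - 2. 1) \<le> (\<Sum>i<t - 2. f (pss ! i))" by (intro sum_mono) auto
      then show ?thesis using t by (simp add: sum_list_sum_nth atLeast0LessThan)
    next
      case 3
      have "f ps = 0" if ps: "ps \<in> set (drop (t - 2) pss)" for ps
      proof -
        from ps[unfolded in_set_conv_nth] obtain m where m: "m < length (drop (t - 2) pss)" "drop (t - 2) pss ! m = ps" by blast
        have "ps = pss ! (t - 2 + m)" "t - 2 + m < length pss" using m by auto
        moreover have "length (pss ! (t - 2 + m)) \<le> length (pss ! (t - 3))" by (intro sorted) (use m in auto)
        ultimately show ?thesis using 3 unfolding f_def by simp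
      qed
      then have "sum_list (map f (drop (t - 2) pss)) = 0" by (simp add: sum_list_eq_0_iff)
      moreover have "sum_list (map f pss) = sum_list (map f ?A) + sum_list (map f (drop (t - 2) pss))"
        by (metis append_take_drop_id map_append sum_list_append)
      ultimately show ?thesis using a[folded f_def] by linarith
    qed
  qed
  have dA: "distinct (concat ?A)" using dist by (intro distinct_concat_take) simp
  have gA: "gpath E ps" if "ps \<in> set ?A" for ps using paths that by (auto dest: in_set_takeD)
  obtain qs where qs': "length qs = sum_list (map (\<lambda>ps. length ps div l) ?A)" "\<forall>q\<in>set qs. length q = l \<and> gpath E q"
    "distinct (concat qs)" "set (concat qs) \<subseteq> set (concat ?A)"
    using gpath_chunks_concat[OF l dA gA] by blast
  have "t - 2 \<le> length qs" using ge unfolding qs'(1) f_def .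
  note qs = this qs'(2-4)
  have i: "t - 2 < length pss" "t - 1 < length pss" "t - 2 \<noteq> t - 1" using t by auto
  have len2: "length (pss ! (t - 2)) \<ge> l - 1" using sorted[of "t - 2" "t - 1"] i bulk by linarith
  have Adj: "set (concat ?A) \<inter> set (pss ! j) = {}" if j: "t - 2 \<le> j" "j < length pss" for j
  proof (rule ccontr)
    assume "set (concat ?A) \<inter> set (pss ! j) \<noteq> {}"
    then obtain w where w: "w \<in> set (concat ?A)" "w \<in> set (pss ! j)" by blast
    then obtain k m where "k < length ?A" "m < length (?A ! k)" "w = ?A ! k ! m" unfolding in_concat_nth by blast
    then have "k < t - 2" "k < length pss" "w \<in> set (pss ! k)" by auto
    then show False using nth_disjoint[of k j] j w(2) by auto
  qed
  have "u \<notin> set (concat pss)" "v \<notin> set (concat pss)" using dist by simp_all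
  then have uvA: "u \<notin> set (concat ?A)" "v \<notin> set (concat ?A)" using set_concat_take[of "t - 2" pss] by blast+
  have "contains_subgraph G (tP t l)"
  proof (rule contains_tP_two_more[OF hub_Cons[OF _ i(1), of u] hub_Cons[OF _ i(2), of v] _ _ l t(1) qs(1-3)])
    show "set (u # pss ! (t - 2)) \<inter> set (v # pss ! (t - 1)) = {}"
      using nth_disjoint[OF i] hub_nth[OF i(1), of v] hub_nth[OF i(2), of u] dist by auto
    have "set (u # pss ! (t - 2)) \<inter> set (concat ?A) = {}" "set (v # pss ! (t - 1)) \<inter> set (concat ?A) = {}"
    proof -
      have "set (concat ?A) \<inter> set (pss ! (t - 2)) = {}" "set (concat ?A) \<inter> set (pss ! (t - 1)) = {}"
        by (rule Adj; use i t in simp)+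
      then show "set (u # pss ! (t - 2)) \<inter> set (concat ?A) = {}" "set (v # pss ! (t - 1)) \<inter> set (concat ?A) = {}"
        using uvA unfolding list.set by blast+
    qed
    then show "set (u # pss ! (t - 2)) \<inter> set (concat qs) = {}" "set (v # pss ! (t - 1)) \<inter> set (concat qs) = {}" using qs(4) by blast+
    show "set (u # pss ! (t - 2)) \<subseteq> verts G" "set (v # pss ! (t - 1)) \<subseteq> verts G" using sub_verts[OF i(1)] sub_verts[OF i(2)] verts by auto
    show "set (concat qs) \<subseteq> verts G" using qs(4) set_concat_take[of "t - 2" pss] verts by blast
  qed (use bulk len2 in auto)
  then show False using free unfolding F_free_def by simp
qed

end

section \<open>Planarity of the extremal graphs\<close>

text \<open>A straight-line drawing: the path vertices lie on the positive real axis and the two hubs at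
  \<open>\<plusminus> \<i>\<close>.\<close>
definition fan_point :: "nat \<Rightarrow> nat \<Rightarrow> complex" where
  "fan_point s i = (if i < s then Complex (real i + 1) 0 else if i = s then Complex 0 1 else Complex 0 (-1))"

lemma fan_point_inj: "inj_on (fan_point s) {0..<s + 2}"
  unfolding inj_on_def fan_point_def by (auto simp: complex_eq_iff split: if_splits)

lemma K2_join_edges:
  assumes "e \<in> edges (K2_join_paths ls)"
  obtains a where "e = {a, Suc a}" "Suc a < sum_list ls" | a where "e = {a, sum_list ls}" "a < sum_list ls"
    | a where "e = {a, sum_list ls + 1}" "a < sum_list ls" | "e = {sum_list ls, sum_list ls + 1}"
  using assms unfolding K2_join_paths_def paths_graph_def edges_def Let_def by auto

lemma segment_coords:
  assumes "z \<in> closed_segment (Complex a b) (Complex c d)"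
  obtains t where "0 \<le> t" "t \<le> 1" "Re z = (1 - t) * a + t * c" "Im z = (1 - t) * b + t * d"
  using assms unfolding closed_segment_def by (auto simp: scaleR_conv_of_real)

lemma path_segment:
  assumes "z \<in> closed_segment (Complex x 0) (Complex (x + 1) 0)"
  shows "Im z = 0 \<and> x \<le> Re z \<and> Re z \<le> x + 1"
  by (rule segment_coords[OF assms]) (auto simp: algebra_simps)

lemma upper_segment:
  assumes "z \<in> closed_segment (Complex x 0) (Complex 0 1)"
  shows "0 \<le> Im z \<and> Im z \<le> 1 \<and> Re z = (1 - Im z) * x"
  by (rule segment_coords[OF assms]) auto

lemma lower_segment:
  assumes "z \<in> closed_segment (Complex x 0) (Complex 0 (-1))"
  shows "-1 \<le> Im z \<and> Im z \<le> 0 \<and> Re z = (1 + Im z) * x"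
  by (rule segment_coords[OF assms]) auto

lemma hub_segment:
  assumes "z \<in> closed_segment (Complex 0 1) (Complex 0 (-1))"
  shows "Re z = 0"
  by (rule segment_coords[OF assms]) auto

text \<open>A superset of the segment of each kind of edge; the second component of the edge tells the kind.\<close>
definition on_edge :: "nat \<Rightarrow> nat \<Rightarrow> nat \<Rightarrow> complex \<Rightarrow> bool" where
  "on_edge s a b z \<longleftrightarrow>
    (if a = s then Re z = 0
     else if b = s then 0 \<le> Im z \<and> Im z \<le> 1 \<and> Re z = (1 - Im z) * (real a + 1)
     else if b = s + 1 then -1 \<le> Im z \<and> Im z \<le> 0 \<and> Re z = (1 + Im z) * (real a + 1)
     else Im z = 0 \<and> real a + 1 \<le> Re z \<and> Re z \<le> real a + 2)"

definition edge_kind :: "nat \<Rightarrow> nat \<Rightarrow> nat \<Rightarrow> bool" where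
  "edge_kind s a b \<longleftrightarrow> (b = Suc a \<and> b < s) \<or> (a < s \<and> b = s) \<or> (a < s \<and> b = s + 1) \<or> (a = s \<and> b = s + 1)"

lemma on_edge_segment:
  assumes "edge_kind s a b" "z \<in> closed_segment (fan_point s a) (fan_point s b)"
  shows "on_edge s a b z"
  using assms(1) unfolding edge_kind_def
proof (elim disjE conjE)
  assume "b = Suc a" "b < s"
  then show ?thesis using path_segment[of z "real a + 1"] assms(2) unfolding fan_point_def on_edge_def
    by (simp add: add.commute)
next
  assume "a < s" "b = s"
  then show ?thesis using upper_segment[of z "real a + 1"] assms(2) unfolding fan_point_def on_edge_def by simp
next
  assume "a < s" "b = s + 1"
  then show ?thesis using lower_segment[of z "real a + 1"] assms(2) unfolding fan_point_def on_edge_def by simp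
next
  assume "a = s" "b = s + 1"
  then show ?thesis using hub_segment[of z] assms(2) unfolding fan_point_def on_edge_def by simp
qed

lemma on_edge_vertex:
  assumes k: "edge_kind s a b" and w: "w < s + 2" and on: "on_edge s a b (fan_point s w)"
  shows "w = a \<or> w = b"
  using k unfolding edge_kind_def
proof (elim disjE conjE)
  assume ab: "b = Suc a" "b < s"
  show ?thesis
  proof (cases "w < s")
    case True
    then have "real a + 1 \<le> real w + 1" "real w + 1 \<le> real a + 2" using on ab unfolding on_edge_def fan_point_def by auto
    then show ?thesis using ab by linarith
  next
    case False then show ?thesis using on ab unfolding on_edge_def fan_point_def by (auto split: if_splits)
  qed
qed (use on w in \<open>auto simp: on_edge_def fan_point_def split: if_splits\<close>)

lemma on_edge_cross:
  assumes ab: "edge_kind s a b" and cd: "edge_kind s c d" and ne: "(a, b) \<noteq> (c, d)"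
    and z: "on_edge s a b z" "on_edge s c d z"
  shows "\<exists>w\<in>{a, b} \<inter> {c, d}. z = fan_point s w"
proof -
  \<comment> \<open>The four kinds of edges, numbered so that by symmetry only pairs in weakly
    increasing order have to be treated.\<close>
  define kind where "kind a b = (if a = s then 3 else if b = s then 1 else if b = s + 1 then 2 else 0 :: nat)" for a b
  have *: "\<exists>w\<in>{a, b} \<inter> {c, d}. z = fan_point s w"
    if ab: "edge_kind s a b" and cd: "edge_kind s c d" and ne: "(a, b) \<noteq> (c, d)"
      and z: "on_edge s a b z" "on_edge s c d z" and le: "kind a b < kind c d \<or> kind a b = kind c d \<and> a \<le> c" for a b c d
  proof -
    consider (p) "b = Suc a" "b < s" | (u) "a < s" "b = s" | (l) "a < s" "b = s + 1" | (h) "a = s" "b = s + 1"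
      using ab unfolding edge_kind_def by blast
    then show ?thesis
    proof cases
      case p
      then have z1: "Im z = 0" "real a + 1 \<le> Re z" "Re z \<le> real a + 2" using z(1) unfolding on_edge_def by auto
      consider (p') "d = Suc c" "d < s" | (u') "c < s" "d = s" | (l') "c < s" "d = s + 1" | (h') "c = s" "d = s + 1"
        using cd unfolding edge_kind_def by blast
      then show ?thesis
      proof cases
        case p'
        then have z2: "real c + 1 \<le> Re z" "Re z \<le> real c + 2" using z(2) unfolding on_edge_def by auto
        have "a \<le> c" using le p p' unfolding kind_def by auto
        moreover have "a \<noteq> c" using ne p p' by auto
        moreover have "c < a + 2"
        proof (rule ccontr)
          assume "\<not> c < a + 2"
          then have "real c \<ge> real a + 2" by linarith
          then show False using z1 z2 by linarith
        qed
        ultimately have c: "c = Suc a" by linarith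
        then have "Re z = real (Suc a) + 1" using z1 z2 by simp
        then have "z = fan_point s (Suc a)" using z1(1) p unfolding fan_point_def by (simp add: complex_eq_iff)
        then show ?thesis using c p p' by auto
      next
        case u'
        then have "Re z = real c + 1" using z(2) z1(1) unfolding on_edge_def by auto
        moreover from this have "c = a \<or> c = Suc a" using z1(2,3) by linarith
        ultimately show ?thesis using p u' z1(1) unfolding fan_point_def by (auto simp: complex_eq_iff)
      next
        case l'
        then have "Re z = real c + 1" using z(2) z1(1) unfolding on_edge_def by auto
        moreover from this have "c = a \<or> c = Suc a" using z1(2,3) by linarith
        ultimately show ?thesis using p l' z1(1) unfolding fan_point_def by (auto simp: complex_eq_iff)
      next
        case h'
        then have "Re z = 0" using z(2) unfolding on_edge_def by auto
        then show ?thesis using z1(2) by linarith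
      qed
    next
      case u
      then have z1: "0 \<le> Im z" "Im z \<le> 1" "Re z = (1 - Im z) * (real a + 1)" using z(1) unfolding on_edge_def by auto
      consider (p') "d = Suc c" "d < s" | (u') "c < s" "d = s" | (l') "c < s" "d = s + 1" | (h') "c = s" "d = s + 1"
        using cd unfolding edge_kind_def by blast
      then show ?thesis
      proof cases
        case p' then show ?thesis using le u unfolding kind_def by auto
      next
        case u'
        then have "Re z = (1 - Im z) * (real c + 1)" using z(2) unfolding on_edge_def by auto
        then have "(1 - Im z) * (real a - real c) = 0" using z1(3) by (simp add: algebra_simps)
        moreover have "real a \<noteq> real c" using ne u u' by auto
        ultimately have "Im z = 1" by simp
        then have "z = fan_point s s" using z1(3) unfolding fan_point_def by (simp add: complex_eq_iff)
        then show ?thesis using u u' by auto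
      next
        case l'
        then have z2: "Im z \<le> 0" "Re z = (1 + Im z) * (real c + 1)" using z(2) unfolding on_edge_def by auto
        then have i: "Im z = 0" using z1 by linarith
        then have "real a = real c" using z1 z2 by simp
        moreover have "z = fan_point s a" using i z1(3) u unfolding fan_point_def by (simp add: complex_eq_iff)
        ultimately show ?thesis using u l' by auto
      next
        case h'
        then have "Re z = 0" using z(2) unfolding on_edge_def by auto
        then have "Im z = 1" using z1(3) by simp
        then have "z = fan_point s s" using \<open>Re z = 0\<close> unfolding fan_point_def by (simp add: complex_eq_iff)
        then show ?thesis using u h' by auto
      qed
    next
      case l
      then have z1: "-1 \<le> Im z" "Im z \<le> 0" "Re z = (1 + Im z) * (real a + 1)" using z(1) unfolding on_edge_def by auto
      consider (p') "d = Suc c" "d < s" | (u') "c < s" "d = s" | (l') "c < s" "d = s + 1" | (h') "c = s" "d = s + 1"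
        using cd unfolding edge_kind_def by blast
      then show ?thesis
      proof cases
        case p' then show ?thesis using le l unfolding kind_def by auto
      next
        case u' then show ?thesis using le l unfolding kind_def by auto
      next
        case l'
        then have "Re z = (1 + Im z) * (real c + 1)" using z(2) unfolding on_edge_def by auto
        then have "(1 + Im z) * (real a - real c) = 0" using z1(3) by (simp add: algebra_simps)
        moreover have "real a \<noteq> real c" using ne l l' by auto
        ultimately have "Im z = -1" by (simp add: eq_neg_iff_add_eq_0 add.commute)
        then have "z = fan_point s (s + 1)" using z1(3) unfolding fan_point_def by (simp add: complex_eq_iff)
        then show ?thesis using l l' by auto
      next
        case h'
        then have "Re z = 0" using z(2) unfolding on_edge_def by auto
        then have "Im z = -1" using z1(3) by (simp add: eq_neg_iff_add_eq_0 add.commute)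
        then have "z = fan_point s (s + 1)" using \<open>Re z = 0\<close> unfolding fan_point_def by (simp add: complex_eq_iff)
        then show ?thesis using l h' by auto
      qed
    next
      case h
      then have "kind a b = 3" unfolding kind_def by simp
      then have "kind c d = 3" using le unfolding kind_def by (auto split: if_splits)
      then have "c = s" unfolding kind_def by (auto split: if_splits)
      then have "d = s + 1" using cd unfolding edge_kind_def by auto
      then show ?thesis using h ne \<open>c = s\<close> by simp
    qed
  qed
  show ?thesis
  proof (cases "kind a b < kind c d \<or> kind a b = kind c d \<and> a \<le> c")
    case True then show ?thesis using *[OF ab cd ne z] by simp
  next
    case False
    then have "kind c d < kind a b \<or> kind c d = kind a b \<and> c \<le> a" by linarith
    then have "\<exists>w\<in>{c, d} \<inter> {a, b}. z = fan_point s w" using *[OF cd ab _ z(2,1)] ne by blast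
    then show ?thesis by blast
  qed
qed

lemma planar_K2_join_paths: "planar (K2_join_paths ls)"
proof -
  let ?G = "K2_join_paths ls"
  define s where "s = sum_list ls"
  define p where "p = fan_point s"
  \<comment> \<open>The hubs carry the two largest numbers, so orienting edges from minimum to
    maximum puts the hub second in every edge from the path to a hub, as \<open>edge_kind\<close>
    expects.\<close>
  define \<gamma> where "\<gamma> e = linepath (p (Min e)) (p (Max e))" for e :: "nat set"
  have V: "verts ?G = {0..<s + 2}" unfolding K2_join_paths_def verts_def s_def by (simp add: Let_def)
  have kind: "\<exists>a b. e = {a, b} \<and> a < b \<and> b < s + 2 \<and> edge_kind s a b" if "e \<in> edges ?G" for e
    using that
  proof (rule K2_join_edges)
    fix a assume "e = {a, Suc a}" "Suc a < sum_list ls"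
    then show ?thesis unfolding edge_kind_def s_def by (intro exI[of _ a] exI[of _ "Suc a"]) auto
  next
    fix a assume "e = {a, sum_list ls}" "a < sum_list ls"
    then show ?thesis unfolding edge_kind_def s_def by (intro exI[of _ a] exI[of _ "sum_list ls"]) auto
  next
    fix a assume "e = {a, sum_list ls + 1}" "a < sum_list ls"
    then show ?thesis unfolding edge_kind_def s_def by (intro exI[of _ a] exI[of _ "sum_list ls + 1"]) auto
  next
    assume "e = {sum_list ls, sum_list ls + 1}"
    then show ?thesis unfolding edge_kind_def s_def by (intro exI[of _ "sum_list ls"] exI[of _ "sum_list ls + 1"]) auto
  qed
  have g: "\<gamma> {a, b} = linepath (p a) (p b)" if "a < b" for a b unfolding \<gamma>_def using that by simp
  have inj: "inj_on p {0..<s + 2}" unfolding p_def by (rule fan_point_inj)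
  show ?thesis
    unfolding planar_def V
  proof (intro exI[of _ p] exI[of _ \<gamma>] conjI ballI impI inj)
    fix e assume e: "e \<in> edges ?G"
    then obtain a b where ab: "e = {a, b}" "a < b" "b < s + 2" "edge_kind s a b" using kind by blast
    have ge: "\<gamma> e = linepath (p a) (p b)" using g ab by simp
    have "p a \<noteq> p b" using inj_onD[OF inj, of a b] ab by auto
    moreover have "closed_segment (p a) (p b) \<inter> p ` {0..<s + 2} = {p a, p b}"
    proof (intro equalityI subsetI)
      fix z assume z: "z \<in> closed_segment (p a) (p b) \<inter> p ` {0..<s + 2}"
      then obtain w where w: "w < s + 2" "z = p w" by auto
      have "on_edge s a b z" using on_edge_segment[OF ab(4)] z unfolding p_def by blast
      then have "w = a \<or> w = b" using on_edge_vertex[OF ab(4) w(1)] w(2) unfolding p_def by blast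
      then show "z \<in> {p a, p b}" using w by auto
    qed (use ab in auto)
    ultimately show "\<exists>u v. e = {u, v} \<and> arc (\<gamma> e) \<and> pathstart (\<gamma> e) = p u \<and> pathfinish (\<gamma> e) = p v \<and>
        path_image (\<gamma> e) \<inter> p ` {0..<s + 2} = {p u, p v}"
      using ab(1) ge by (intro exI[of _ a] exI[of _ b]) (simp add: arc_linepath)
  next
    fix e e' assume e: "e \<in> edges ?G" "e' \<in> edges ?G" "e \<noteq> e'"
    obtain a b where ab: "e = {a, b}" "a < b" "b < s + 2" "edge_kind s a b" using kind[OF e(1)] by blast
    obtain c d where cd: "e' = {c, d}" "c < d" "d < s + 2" "edge_kind s c d" using kind[OF e(2)] by blast
    have ne: "(a, b) \<noteq> (c, d)" using e(3) ab cd by auto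
    show "path_image (\<gamma> e) \<inter> path_image (\<gamma> e') \<subseteq> p ` (e \<inter> e')"
    proof
      fix z assume "z \<in> path_image (\<gamma> e) \<inter> path_image (\<gamma> e')"
      then have "z \<in> closed_segment (p a) (p b)" "z \<in> closed_segment (p c) (p d)" using g ab(1,2) cd(1,2) by auto
      then have "on_edge s a b z" "on_edge s c d z" using on_edge_segment[OF ab(4)] on_edge_segment[OF cd(4)] unfolding p_def by blast+
      then obtain w where "w \<in> {a, b} \<inter> {c, d}" "z = fan_point s w" using on_edge_cross[OF ab(4) cd(4) ne] by blast
      then show "z \<in> p ` (e \<inter> e')" unfolding p_def ab(1) cd(1) by blast
    qed
  qed
qed

section \<open>Extremal graphs\<close>

text \<open>At L = 55 both sides are about 4.6 * 10^16. From there on the right side doubles at each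
  step while the left grows by at most (56/55)^4 < 2.\<close>

lemma fourth_power_le_power:
  assumes "L \<ge> 55"
  shows "5000000000 * real L ^ 4 \<le> 10.2 * 2 ^ (L - 3)"
  using assms
proof (induction L rule: nat_induct_at_least)
  case base then show ?case by simp
next
  case (Suc L)
  have "real (Suc L) \<le> 56 / 55 * real L" using Suc.hyps by simp
  then have "real (Suc L) ^ 4 \<le> (56 / 55 * real L) ^ 4" by (intro power_mono) auto
  also have "\<dots> = (56 / 55) ^ 4 * real L ^ 4" by (rule power_mult_distrib)
  also have "\<dots> \<le> 2 * real L ^ 4" by (intro mult_right_mono) (simp_all add: power4_eq_xxxx)
  finally have "5000000000 * real (Suc L) ^ 4 \<le> 2 * (5000000000 * real L ^ 4)" by simp
  also have "\<dots> \<le> 2 * (10.2 * 2 ^ (L - 3))" using Suc.IH by (intro mult_left_mono) auto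
  also have "\<dots> = 10.2 * 2 ^ (Suc L - 3)"
  proof -
    have "Suc L - 3 = Suc (L - 3)" using Suc.hyps by simp
    then show ?thesis by (simp only: power_Suc)
  qed
  finally show ?case .
qed

text \<open>Up to L = 54 the constant 2.67 * 9^17, about 4.45 * 10^16, suffices for both. Beyond
  that the exponential term gives the fourth power, and L^2 \<ge> 2000 the square.\<close>

lemma order_bounds:
  assumes "x \<ge> max (2.67 * 9 ^ 17) (10.2 * 2 ^ (L - 3) + 2 :: real)"
  shows "x \<ge> 10000000000000 * real L ^ 2" "x \<ge> 5000000000 * real L ^ 4"
proof -
  have x: "x \<ge> 2.67 * 9 ^ 17" "x \<ge> 10.2 * 2 ^ (L - 3)" using assms by auto
  have "x \<ge> 10000000000000 * real L ^ 2 \<and> x \<ge> 5000000000 * real L ^ 4"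
  proof (cases "L \<le> 54")
    case True
    then have "real L ^ 2 \<le> 54 ^ 2" "real L ^ 4 \<le> 54 ^ 4" by (intro power_mono; simp)+
    then show ?thesis using x(1) by simp
  next
    case False
    then have L: "L \<ge> 55" by simp
    have 4: "x \<ge> 5000000000 * real L ^ 4" using fourth_power_le_power[OF L] x(2) by linarith
    have "(55::real) ^ 2 \<le> real L ^ 2" using L by (intro power_mono) auto
    then have "2000 * real L ^ 2 \<le> real L ^ 2 * real L ^ 2" by (intro mult_right_mono) auto
    then have "10000000000000 * real L ^ 2 \<le> 5000000000 * real L ^ 4" by (simp add: power4_eq_xxxx power2_eq_square)
    then show ?thesis using 4 by linarith
  qed
  then show "x \<ge> 10000000000000 * real L ^ 2" "x \<ge> 5000000000 * real L ^ 4" by auto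
qed

text \<open>The graph contains the complete bipartite graph between the two hubs and the p path
  vertices, whose spectral radius is sqrt (2 * p). The test vector is its Perron vector, with sqrt
  (p / 2) at the hubs and 1 elsewhere.\<close>

lemma (in hub) spectral_radius_ge_sqrt:
  assumes P: "concat pss \<noteq> []"
  shows "sqrt (2 * real (length (concat pss))) \<le> spectral_radius G"
proof -
  define p where "p = real (length (concat pss))"
  have p: "p > 0" "real (card P) = p" unfolding p_def using P distinct_card[OF dist(4)] by simp_all
  define al where "al = sqrt (p / 2)"
  have al: "al \<ge> 0" "al\<^sup>2 = p / 2" unfolding al_def using p by simp_all
  define y where "y w = (if w = u \<or> w = v then al else 1)" for w
  have y0: "y w \<ge> 0" for w unfolding y_def using al by simp
  have yP: "y w = 1" if "w \<in> P" for w unfolding y_def using that dist by auto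
  have yh: "y u = al" "y v = al" unfolding y_def by auto
  have sP: "(\<Sum>w\<in>P. y w) = p" using yP p by simp
  have split: "(\<Sum>w\<in>V. f w) = f u + (f v + (\<Sum>w\<in>P. f w))" for f :: "nat \<Rightarrow> real"
    unfolding V_eq using dist by (simp del: set_concat)
  have path: "(\<Sum>q\<in>V. adj G w q * y q) \<ge> 2 * al" if w: "w \<in> P" for w
  proof -
    have "adj G w u = 1" "adj G w v = 1" using edge_hub(1)[OF w] unfolding adj_def by (simp_all add: insert_commute)
    moreover have "0 \<le> (\<Sum>q\<in>P. adj G w q * y q)" using y0 adj_nonneg by (intro sum_nonneg) auto
    ultimately show ?thesis unfolding split yh by simp
  qed
  have "qform (adj G) V y = (\<Sum>w\<in>V. y w * (\<Sum>q\<in>V. adj G w q * y q))"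
    unfolding qform_def sum_distrib_left by (intro sum.cong refl) (simp only: mult_ac)
  also have "\<dots> = al * (al + p) + (al * (al + p) + (\<Sum>w\<in>P. y w * (\<Sum>q\<in>V. adj G w q * y q)))"
    using split[of "\<lambda>w. y w * (\<Sum>q\<in>V. adj G w q * y q)"] unfolding sum_adj_hub yh sP .
  also have "(\<Sum>w\<in>P. y w * (\<Sum>q\<in>V. adj G w q * y q)) = (\<Sum>w\<in>P. \<Sum>q\<in>V. adj G w q * y q)"
    using yP by (intro sum.cong refl) (simp only: mult_1)
  finally have q: "qform (adj G) V y = al * (al + p) + (al * (al + p) + (\<Sum>w\<in>P. \<Sum>q\<in>V. adj G w q * y q))" .
  have "(\<Sum>w\<in>P. 2 * al) \<le> (\<Sum>w\<in>P. \<Sum>q\<in>V. adj G w q * y q)" by (intro sum_mono path)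
  then have "p * (2 * al) \<le> (\<Sum>w\<in>P. \<Sum>q\<in>V. adj G w q * y q)" using p(2) by simp
  moreover have "0 \<le> al * al" using al by simp
  moreover have e: "al * (al + p) = al * al + al * p" "p * (2 * al) = 2 * (al * p)" "2 * al * (2 * p) = 4 * (al * p)"
    by (simp_all add: distrib_left)
  ultimately have "2 * al * (2 * p) \<le> qform (adj G) V y" unfolding q e by linarith
  also have "\<dots> \<le> spectral_radius G * nsq V y" by (rule spectral_radius_rayleigh(1)[OF finV neV])
  also have "nsq V y = 2 * p"
  proof -
    have "(\<Sum>w\<in>P. (y w)\<^sup>2) = p" using yP p by simp
    then show ?thesis unfolding nsq_def split yh using al by simp
  qed
  finally have "2 * al \<le> spectral_radius G" using p by simp
  moreover have "2 * al = sqrt (2 * p)"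
  proof -
    have "2 * al = sqrt (2\<^sup>2 * (p / 2))" unfolding al_def by (simp only: real_sqrt_mult real_sqrt_abs)
    then show ?thesis by (simp add: power2_eq_square)
  qed
  ultimately show ?thesis unfolding p_def by simp
qed

lemma planar_common_nbrs:
  assumes G: "simple_graph G" "planar G" and ne: "a \<noteq> c" "a \<noteq> d" "c \<noteq> d"
  shows "card (nbrs G a \<inter> nbrs G c \<inter> nbrs G d) \<le> 2"
proof (rule ccontr)
  assume "\<not> card (nbrs G a \<inter> nbrs G c \<inter> nbrs G d) \<le> 2"
  then have "3 \<le> card (nbrs G a \<inter> nbrs G c \<inter> nbrs G d)" by simp
  then obtain T where T: "T \<subseteq> nbrs G a \<inter> nbrs G c \<inter> nbrs G d" "card T = 3" by (meson obtain_subset_with_card_n)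
  then obtain x y z where xyz: "T = {x, y, z}" "x \<noteq> y" "x \<noteq> z" "y \<noteq> z" by (auto simp: card_3_iff)
  define b :: "nat \<Rightarrow> nat" where "b i = (if i = 0 then x else if i = 1 then y else z)" for i
  obtain p g where "drawing (verts G) (edges G) p g" by (rule planar_drawing[OF G])
  then interpret drawing "verts G" "edges G" p g .
  show False
  proof (rule no_K33[of a c d b])
    fix i :: nat
    have "b i \<in> T" unfolding b_def xyz by auto
    then show "{a, b i} \<in> edges G \<and> {b i, c} \<in> edges G \<and> {d, b i} \<in> edges G"
      using T unfolding nbrs_def by (auto simp: insert_commute)
    show "inj_on b {..<3}" using xyz unfolding inj_on_def b_def by auto
  qed (use ne in auto)
qed

lemma exists_reordering:
  assumes "mset (map f xs) = mset ys"
  shows "\<exists>xs'. mset xs' = mset xs \<and> map f xs' = ys"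
  using assms
proof (induction ys arbitrary: xs)
  case Nil then show ?case by (intro exI[of _ "[]"]) simp
next
  case (Cons y ys)
  have "y \<in> set (map f xs)" using Cons.prems by (metis list.set_intros(1) set_mset_mset)
  then obtain x where x: "x \<in> set xs" "f x = y" by auto
  have m: "mset xs = add_mset x (mset (remove1 x xs))" using x(1) by simp
  have "add_mset y (mset (map f (remove1 x xs))) = mset (map f xs)" unfolding mset_map m using x(2) by simp
  then have "mset (map f (remove1 x xs)) = mset ys" using Cons.prems by simp
  from Cons.IH[OF this] obtain xs' where xs': "mset xs' = mset (remove1 x xs)" "map f xs' = ys" by blast
  show ?case
  proof (intro exI conjI)
    show "mset (x # xs') = mset xs" unfolding mset.simps xs'(1) m[symmetric] ..
    show "map f (x # xs') = y # ys" unfolding list.map xs'(2) x(2) ..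
  qed
qed

lemma sorted_desc_nth:
  fixes f :: "'a \<Rightarrow> nat"
  assumes "i \<le> j" "j < length xs"
  shows "f (rev (sort_key f xs) ! j) \<le> f (rev (sort_key f xs) ! i)"
proof -
  let ?s = "sort_key f xs"
  have r: "rev ?s ! m = ?s ! (length xs - Suc m)" if "m < length xs" for m using that by (simp add: rev_nth)
  have "map f ?s ! (length xs - Suc j) \<le> map f ?s ! (length xs - Suc i)"
    using assms by (intro sorted_nth_mono sorted_sort_key) auto
  then show ?thesis using assms r[of i] r[of j] by simp
qed

lemma length_filter_sorted:
  assumes "\<And>i j. i \<le> j \<Longrightarrow> j < length ls \<Longrightarrow> ls ! j \<le> (ls ! i :: nat)" and "length ls \<le> B \<or> ls ! B < k"
  shows "length (filter (\<lambda>a. k \<le> a) ls) \<le> B"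
proof -
  have "{i. i < length ls \<and> k \<le> ls ! i} \<subseteq> {..<B}"
  proof
    fix i assume i: "i \<in> {i. i < length ls \<and> k \<le> ls ! i}"
    show "i \<in> {..<B}"
    proof (rule ccontr)
      assume "i \<notin> {..<B}"
      then have "B \<le> i" by simp
      then show False using assms(1)[of B i] assms(2) i by auto
    qed
  qed
  then have "card {i. i < length ls \<and> k \<le> ls ! i} \<le> card {..<B}" by (intro card_mono) auto
  then show ?thesis by (simp add: length_filter_conv_card)
qed

text \<open>The lists \<open>pss\<close> are paths of \<open>G\<close> itself, the components of the
  common neighbourhood of the hubs, while \<open>zs\<close> are the exceptional vertices, isolated
  apart from the hubs in \<open>H\<close>. Restrictions on lengths come from \<open>G\<close>
  through \<open>hub_paths\<close>, the eigenvalue equation from \<open>H\<close> through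
  \<open>hub_graph\<close>.\<close>

lemma planar_free_structure:
  fixes t l n :: nat
  assumes G: "simple_graph G" "card (verts G) = n" "planar G" "F_free (tP t l) G"
    and tl: "t \<ge> 1" "l \<ge> 1" "t * l \<ge> 2"
    and n1: "real n \<ge> 10000000000000 * real (t * l) ^ 2" and n2: "real n \<ge> 5000000000 * real (t * l) ^ 4"
    and rho: "spectral_radius G \<ge> 1414 / 1000 * sqrt n"
  obtains H u v pss zs where "hub_paths G u v pss" "hub_graph H u v (pss @ map (\<lambda>z. [z]) zs)"
    "card (verts H) = n" "real (length zs) \<le> 23 / 1000 * n" "\<And>ps. ps \<in> set pss \<Longrightarrow> length ps < t * l"
    "G = H \<or> spectral_radius G < spectral_radius H"
proof -
  let ?L = "t * l" and ?V = "verts G" and ?E = "edges G" and ?N = "nbrs G"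
  have fin: "finite ?V" using G(1) unfolding simple_graph_def by simp
  have path_bound: "length ps < ?L" if "gpath ?E ps" "set ps \<subseteq> ?V" for ps
    using F_free_no_long_path[OF G(4) _ that] tl(2) by simp
  have "\<exists>anc. dfs_ancestors ?E ?V (?L - 1) anc"
    by (rule dfs_ancestors_exist[OF fin]) (use simple_graph_edge[OF G(1)] path_bound in auto)
  then obtain anc where anc: "dfs_ancestors ?E ?V (?L - 1) anc" by blast
  have Lr: "real (?L - 1) \<le> real ?L" by (rule of_nat_mono) simp
  interpret B: big_sparse_graph G "?L - 1" anc
  proof
    show "simple_graph G" by fact
    show "dfs_ancestors ?E ?V (?L - 1) anc" by fact
    show "1 \<le> ?L - 1" using tl by simp
    have "10000000000000 * real (?L - 1) ^ 2 \<le> 10000000000000 * real ?L ^ 2"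
      using Lr by (intro mult_left_mono power_mono) auto
    then show "10000000000000 * real (?L - 1) ^ 2 \<le> real (card ?V)" using n1 G(2) by linarith
    have "5000000000 * real (?L - 1) ^ 4 \<le> 5000000000 * real ?L ^ 4"
      using Lr by (intro mult_left_mono power_mono) auto
    then show "5000000000 * real (?L - 1) ^ 4 \<le> real (card ?V)" using n2 G(2) by linarith
  qed (rule planar_common_nbrs[OF G(1,3)])
  obtain u v where uv: "u \<in> ?V" "v \<in> ?V" "u \<noteq> v" "card (?V - (?N u \<inter> ?N v)) \<le> 23 / 1000 * real n"
    "G = hub_completion G u v (?N u \<inter> ?N v) \<or> spectral_radius G < spectral_radius (hub_completion G u v (?N u \<inter> ?N v))"
    by (rule B.hub_structure[unfolded G(2), OF rho])
  define W where "W = ?N u \<inter> ?N v"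
  define Z where "Z = ?V - {u, v} - W"
  define H where "H = hub_completion G u v W"
  have WV: "W \<subseteq> ?V" unfolding W_def nbrs_def by auto
  have uW: "u \<notin> W" "v \<notin> W" unfolding W_def nbrs_def using B.edgeD by blast+
  have hubW: "{u, w} \<in> ?E" "{w, v} \<in> ?E" "{v, w} \<in> ?E" if "w \<in> W" for w
    using that unfolding W_def nbrs_def by (auto simp: insert_commute)
  have VWZ: "?V = insert u (insert v (W \<union> Z))" unfolding Z_def using uv WV by auto
  have finW: "finite W" "finite Z" using WV fin finite_subset unfolding Z_def by auto
  have "card (?V - W) + card W = n"
    using card_Diff_subset[OF finW(1) WV] card_mono[OF fin WV] G(2) by simp
  then have "real n = real (card (?V - W)) + real (card W)" by (simp flip: of_nat_add)
  then have cW: "real (card W) \<ge> 977 / 1000 * real n" using uv(4) unfolding W_def by linarith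
  have nL: "real n \<ge> 2 * real ?L"
  proof -
    have "1 \<le> real ?L" by (rule order_trans[of 1 "real 1"]) (simp, rule of_nat_mono, use tl in linarith)
    then have "real ?L * 1 \<le> real ?L * real ?L" by (intro mult_left_mono) auto
    then show ?thesis using n1 by (simp add: power2_eq_square)
  qed
  have cWL: "card W > ?L"
  proof -
    have "real ?L > 0" using tl by simp
    then have "real (card W) > real ?L" using cW nL by linarith
    then show ?thesis by (simp only: of_nat_less_iff)
  qed
  obtain p g where dr: "drawing ?V ?E p g" by (rule planar_drawing[OF G(1,3)])
  have "\<exists>pss. distinct (concat pss) \<and> set (concat pss) = W \<and> [] \<notin> set pss \<and>
     (\<forall>a\<in>W. \<forall>b\<in>W. {a, b} \<in> ?E \<longleftrightarrow> (\<exists>ps\<in>set pss. {a, b} \<in> pedges ps))"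
  proof (rule linear_forest[OF finW(1)])
    show "a \<noteq> b" if "{a, b} \<in> ?E" for a b using B.edgeD[OF that] by simp
    fix w assume w: "w \<in> W"
    have "{x \<in> W. {w, x} \<in> ?E} = ?N u \<inter> ?N v \<inter> ?N w" unfolding W_def nbrs_def by auto
    moreover have "u \<noteq> w" "v \<noteq> w" using w uW by auto
    ultimately show "card {x \<in> W. {w, x} \<in> ?E} \<le> 2" using B.K33[of u v w] uv(3) by simp
  next
    fix cs assume cs: "gpath ?E cs" "length cs \<ge> 3" "set cs \<subseteq> W"
    show "{last cs, hd cs} \<notin> ?E"
    proof
      assume c: "{last cs, hd cs} \<in> ?E"
      \<comment> \<open>A cycle is shorter than \<open>?L\<close>, which is below the size of
        \<open>W\<close>; so \<open>W\<close> has a vertex off the cycle to serve as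
        \<open>w\<close> in \<open>no_cycle\<close>.\<close>
      have "length cs < ?L" using path_bound[OF cs(1)] cs(3) WV by blast
      then have "card (set cs) < card W" using cWL card_length[of cs] by linarith
      then have "\<not> W \<subseteq> set cs" using card_mono[of "set cs" W] by auto
      then obtain w where w: "w \<in> W" "w \<notin> set cs" by blast
      show False
      proof (rule drawing.no_cycle[OF dr, of cs u v w])
        show "distinct cs" "\<And>i. Suc i < length cs \<Longrightarrow> {cs ! i, cs ! Suc i} \<in> ?E" using cs(1) unfolding gpath_nth by auto
        show "u \<notin> set cs" "v \<notin> set cs" using cs(3) uW by blast+
        show "{u, c} \<in> ?E \<and> {c, v} \<in> ?E" if "c \<in> set cs" for c using hubW cs(3) that by blast
      qed (use cs c uv w hubW in auto)
    qed
  qed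
  then obtain qss where q: "distinct (concat qss)" "set (concat qss) = W" "[] \<notin> set qss"
    "\<forall>a\<in>W. \<forall>b\<in>W. {a, b} \<in> ?E \<longleftrightarrow> (\<exists>ps\<in>set qss. {a, b} \<in> pedges ps)" by (elim exE conjE)
  define pss where "pss = rev (sort_key length qss)"
  have mp: "mset pss = mset qss" unfolding pss_def by simp
  have sp: "set pss = set qss" unfolding pss_def by simp
  have cp: "distinct (concat pss)" "set (concat pss) = W"
  proof -
    have "mset (map mset pss) = mset (map mset qss)" using mp by simp
    then have "mset (concat pss) = mset (concat qss)" unfolding mset_concat by (metis sum_mset_sum_list)
    then show "distinct (concat pss)" using q(1) mset_eq_imp_distinct_iff by blast
    show "set (concat pss) = W" using q(2) sp by simp
  qed
  have edge_in: "{ps ! i, ps ! Suc i} \<in> ?E \<and> {ps ! i, ps ! Suc i} \<subseteq> W" if "ps \<in> set pss" "Suc i < length ps" for ps i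
  proof -
    have "set ps \<subseteq> W" using that(1) cp(2) by auto
    then have w: "ps ! i \<in> W" "ps ! Suc i \<in> W" using that(2) by auto
    moreover have "{ps ! i, ps ! Suc i} \<in> pedges ps" unfolding pedges_def using that(2) by blast
    ultimately show ?thesis using q(4) that(1) sp by auto
  qed
  have gp: "gpath ?E ps \<and> ps \<noteq> []" if "ps \<in> set pss" for ps
  proof -
    have "distinct ps" using cp(1) that by (simp add: distinct_concat_iff)
    then show ?thesis using edge_in[OF that] q(3) that sp unfolding gpath_nth by auto
  qed
  have hp: "hub_paths G u v pss"
  proof
    show "distinct (u # v # concat pss)" using uv(3) uW cp by simp
    show "insert u (insert v (set (concat pss))) \<subseteq> ?V" using uv WV cp(2) by simp
    show "{u, w} \<in> ?E \<and> {v, w} \<in> ?E" if "w \<in> set (concat pss)" for w using hubW that cp(2) by blast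
    show "gpath ?E ps \<and> ps \<noteq> []" if "ps \<in> set pss" for ps by (rule gp[OF that])
    show "length (pss ! j) \<le> length (pss ! i)" if "i \<le> j" "j < length pss" for i j
      using sorted_desc_nth[of i j qss length] that unfolding pss_def by simp
  qed
  define zs where "zs = sorted_list_of_set Z"
  have zs: "set zs = Z" "distinct zs" "length zs = card Z" unfolding zs_def using finW by simp_all
  have "card Z \<le> card (?V - W)" unfolding Z_def using fin by (intro card_mono) auto
  then have cz: "real (length zs) \<le> 23 / 1000 * real n" using uv(4) zs(3) unfolding W_def by linarith
  have hg: "hub_graph H u v (pss @ map (\<lambda>z. [z]) zs)"
    unfolding hub_graph_def
  proof (intro conjI)
    have cc: "concat (pss @ map (\<lambda>z. [z]) zs) = concat pss @ zs" by simp
    have "Z \<inter> W = {}" "u \<notin> Z" "v \<notin> Z" unfolding Z_def by auto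
    then show "distinct (u # v # concat (pss @ map (\<lambda>z. [z]) zs))" unfolding cc using cp zs uv(3) uW by auto
    have S: "set (concat (pss @ map (\<lambda>z. [z]) zs)) = W \<union> Z" unfolding cc using cp zs by simp
    show "verts H = insert u (insert v (set (concat (pss @ map (\<lambda>z. [z]) zs))))"
      unfolding S H_def using VWZ by simp
    have D: "?V - {u, v} = W \<union> Z" unfolding Z_def using WV uW by auto
    have "pedges [z] = {}" for z unfolding pedges_def by simp
    then have "(\<Union>ps\<in>set (pss @ map (\<lambda>z. [z]) zs). pedges ps) = (\<Union>ps\<in>set pss. pedges ps)" by auto
    also have "\<dots> = {e \<in> ?E. e \<subseteq> W}"
    proof (intro set_eqI iffI)
      fix e assume "e \<in> (\<Union>ps\<in>set pss. pedges ps)"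
      then obtain ps where "ps \<in> set pss" "e \<in> pedges ps" by blast
      then show "e \<in> {e \<in> ?E. e \<subseteq> W}" using edge_in[of ps] unfolding pedges_def by blast
    next
      fix e assume e: "e \<in> {e \<in> ?E. e \<subseteq> W}"
      then obtain a b where ab: "e = {a, b}" using G(1) unfolding simple_graph_def by blast
      then have "a \<in> W" "b \<in> W" "{a, b} \<in> ?E" using e by auto
      then obtain ps where "ps \<in> set qss" "{a, b} \<in> pedges ps" using q(4) by auto
      then show "e \<in> (\<Union>ps\<in>set pss. pedges ps)" using sp ab by auto
    qed
    finally have P: "(\<Union>ps\<in>set (pss @ map (\<lambda>z. [z]) zs). pedges ps) = {e \<in> ?E. e \<subseteq> W}" .
    have rot: "A \<union> B \<union> C \<union> D = B \<union> C \<union> D \<union> A" for A B C D :: "nat set set" by blast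
    show "edges H = {{u, v}} \<union> {{u, w} | w. w \<in> set (concat (pss @ map (\<lambda>z. [z]) zs))} \<union>
        {{v, w} | w. w \<in> set (concat (pss @ map (\<lambda>z. [z]) zs))} \<union> (\<Union>ps\<in>set (pss @ map (\<lambda>z. [z]) zs). pedges ps)"
      unfolding P S H_def edges_hub_completion D by (rule rot)
  qed
  show ?thesis
  proof (rule that[OF hp hg _ cz])
    show "card (verts H) = n" unfolding H_def using G(2) by simp
    show "G = H \<or> spectral_radius G < spectral_radius H" using uv(5) unfolding H_def W_def .
    fix ps assume ps: "ps \<in> set pss"
    then have "set ps \<subseteq> ?V" using cp(2) WV by auto
    then show "length ps < ?L" using path_bound gp[OF ps] by simp
  qed
qed

text \<open>If some entry exceeds \<open>c\<close>, raising the threshold from \<open>k\<close> to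
  \<open>c\<close> takes c - k from that entry alone.\<close>

lemma excess_superadditive:
  assumes "k \<le> c"
  shows "excess c ls + (if excess c ls > 0 then c - k else 0) \<le> excess k ls"
proof (induction ls)
  case (Cons a ls)
  then show ?case using assms by (cases "a \<le> c") (auto split: if_splits)
qed simp

lemma (in hub_paths) excess_take:
  assumes "j \<le> length pss" "j < length pss \<Longrightarrow> length (pss ! j) \<le> c"
  shows "excess c (map length pss) = (\<Sum>i<j. length (pss ! i) - c)"
proof -
  have "excess c (map length pss) = (\<Sum>i<length pss. length (pss ! i) - c)"
    unfolding excess_def by (simp add: sum_list_sum_nth atLeast0LessThan)
  also have "\<dots> = (\<Sum>i<j. length (pss ! i) - c)"
  proof (rule sum.mono_neutral_right)
    show "\<forall>i\<in>{..<length pss} - {..<j}. length (pss ! i) - c = 0"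
    proof
      fix i assume "i \<in> {..<length pss} - {..<j}"
      then have "j \<le> i" "i < length pss" by auto
      then show "length (pss ! i) - c = 0" using sorted[of j i] assms(2) by simp
    qed
  qed (use assms(1) in auto)
  finally show ?thesis .
qed

section \<open>Comparison of extremal graphs with the packed graph\<close>

lemma packed_nth_le:
  assumes "k > 0" "length hs \<le> i" "i < length (packed hs k s)"
  shows "packed hs k s ! i \<le> k"
proof -
  let ?R = "replicate (s div k) k @ (if s mod k = 0 then [] else [s mod k])"
  have p: "packed hs k s = hs @ ?R" by (simp add: packed_def)
  have "packed hs k s ! i = ?R ! (i - length hs)" unfolding p nth_append using assms(2) by simp
  moreover have "i - length hs < length ?R" using assms(2,3) unfolding p length_append by linarith
  ultimately have "packed hs k s ! i \<in> set ?R" by (simp only: nth_mem)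
  moreover have "s mod k \<le> k" using assms(1) by (simp add: less_imp_le)
  ultimately show ?thesis by (auto split: if_splits)
qed

lemma hub_K2_join_paths: "hub (K2_join_paths ls) (sum_list ls) (sum_list ls + 1) (blocks 0 ls)"
  by unfold_locales (rule hub_graph_K2_join_paths)

lemma length_blocks_nth: "i < length (blocks a ls) \<Longrightarrow> i < length ls \<and> length (blocks a ls ! i) = ls ! i"
  by (metis length_blocks length_map nth_map)

lemma verts_K2_join_paths: "verts (K2_join_paths ls) = {0..<sum_list ls + 2}"
  unfolding K2_join_paths_def verts_def by (simp add: Let_def)

text \<open>With \<open>z\<close> taken from the spectral radius of \<open>H\<close>, the lengths of
  \<open>H\<close> satisfy the weight equation exactly. If many components have at least
  \<open>k\<close> vertices, \<open>cond\<close> bounds the excesses and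
  \<open>packed_optimal\<close> applies; otherwise \<open>few_long_worse\<close> does. The index t *
  l + 6 lies beyond the components, numbered up to 3 or t - 1, from which forbidden paths are
  built.\<close>

lemma extremal_packed:
  fixes t l n k :: nat and hs :: "nat list"
  assumes tl: "t \<ge> 1" "l \<ge> 1" "t * l \<ge> 2"
    and n1: "real n \<ge> 10000000000000 * real (t * l) ^ 2" and n2: "real n \<ge> 5000000000 * real (t * l) ^ 4"
    and k: "1 \<le> k" "k \<le> t * l" and hs: "length hs \<le> 2" "\<And>b. b \<in> set hs \<Longrightarrow> k \<le> b" "sum_list hs \<le> 2 * (t * l)"
    and Xfree: "F_free (tP t l) (K2_join_paths (packed hs k (n - 2 - sum_list hs)))"
    and cond: "\<And>G u v pss c. hub_paths G u v pss \<Longrightarrow> F_free (tP t l) G \<Longrightarrow> t * l + 6 < length pss \<Longrightarrow>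
      k \<le> length (pss ! (t * l + 6)) \<Longrightarrow> k \<le> c \<Longrightarrow> excess c (map length pss) \<le> excess c hs"
  shows "extremal_planar n (tP t l) (K2_join_paths (packed hs k (n - 2 - sum_list hs)))"
proof -
  define L where "L = t * l"
  define s where "s = n - 2 - sum_list hs"
  define bs where "bs = packed hs k s"
  define X where "X = K2_join_paths bs"
  have Lr: "real L \<ge> 2" using tl(3) unfolding L_def by linarith
  have m1: "real n \<ge> 10000000000000 * real L ^ 2" "real n \<ge> 5000000000 * real L ^ 4" using n1 n2 unfolding L_def .
  have L2: "real L ^ 2 \<ge> 2 * real L" using Lr unfolding power2_eq_square by (intro mult_right_mono) auto
  have nL: "real n \<ge> 10000000000000 * real L" using m1(1) L2 Lr by linarith
  have sh: "sum_list hs \<le> 2 * L" using hs(3) unfolding L_def .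
  have "real (2 * L + 2) \<le> real n" using nL Lr by simp
  then have nn: "2 * L + 2 \<le> n" by (simp only: of_nat_le_iff)
  have sb: "sum_list bs = n - 2" unfolding bs_def sum_packed s_def using sh nn by simp
  interpret X: hub X "sum_list bs" "sum_list bs + 1" "blocks 0 bs" unfolding X_def by (rule hub_K2_join_paths)
  have Xcard: "card (verts X) = n" unfolding X_def verts_K2_join_paths sb using nn by simp
  have Xcon: "length (concat (blocks 0 bs)) = n - 2" unfolding concat_blocks sb by simp
  have rX: "1414 / 1000 * sqrt n \<le> spectral_radius X"
  proof -
    have "0 < length (concat (blocks 0 bs))" unfolding Xcon using nn Lr by simp
    then have "concat (blocks 0 bs) \<noteq> []" by (rule length_greater_0_conv[THEN iffD1])
    from X.spectral_radius_ge_sqrt[OF this] have "sqrt (2 * real (n - 2)) \<le> spectral_radius X" unfolding Xcon .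
    moreover have "1414 / 1000 * sqrt n \<le> sqrt (2 * real (n - 2))"
    proof (rule real_le_rsqrt)
      have "(1414 / 1000 * sqrt n)\<^sup>2 = (1414 / 1000)\<^sup>2 * n"
        by (simp only: power_mult_distrib real_sqrt_pow2[OF of_nat_0_le_iff])
      also have "\<dots> \<le> 2 * (real n - 2)" using nL Lr by (simp add: power2_eq_square)
      also have "\<dots> = 2 * real (n - 2)" using nn by simp
      finally show "(1414 / 1000 * sqrt n)\<^sup>2 \<le> 2 * real (n - 2)" .
    qed
    ultimately show ?thesis by linarith
  qed
  have Xf: "F_free (tP t l) X" using Xfree unfolding X_def bs_def s_def .
  have "isomorphic G X" if G: "simple_graph G" "card (verts G) = n" "planar G" "F_free (tP t l) G"
    and GX: "spectral_radius X \<le> spectral_radius G" for G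
  proof -
    obtain H u v pss zs where hp: "hub_paths G u v pss" and hg: "hub_graph H u v (pss @ map (\<lambda>z. [z]) zs)"
      and cH: "card (verts H) = n" and zs: "real (length zs) \<le> 23 / 1000 * n"
      and short: "\<And>ps. ps \<in> set pss \<Longrightarrow> length ps < t * l"
      and GH: "G = H \<or> spectral_radius G < spectral_radius H"
      by (rule planar_free_structure[OF G tl n1 n2 order_trans[OF rX GX]]) (rule that)
    interpret H: hub H u v "pss @ map (\<lambda>z. [z]) zs" by unfold_locales (rule hg)
    interpret HP: hub_paths G u v pss by (rule hp)
    define ls where "ls = map length (pss @ map (\<lambda>z. [z]) zs)"
    have lsr: "ls = map length pss @ replicate (length zs) 1"
      unfolding ls_def by (simp add: comp_def map_replicate_const)
    have sl: "sum_list ls = n - 2"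
    proof -
      have "card (verts H) = Suc (Suc (card (set (concat (pss @ map (\<lambda>z. [z]) zs)))))"
        unfolding H.V_eq using H.dist by (simp del: set_concat)
      also have "card (set (concat (pss @ map (\<lambda>z. [z]) zs))) = length (concat (pss @ map (\<lambda>z. [z]) zs))"
        by (rule distinct_card[OF H.dist(4)])
      also have "\<dots> = sum_list ls" unfolding ls_def by (rule length_concat)
      finally show ?thesis using cH by simp
    qed
    have ss: "sum_list ls = sum_list hs + s" unfolding sl s_def using sh nn by simp
    have entries: "0 < a \<and> a \<le> L" if "a \<in> set ls" for a
    proof -
      from that consider ps where "ps \<in> set pss" "a = length ps" | "a = 1" unfolding lsr by auto
      then show ?thesis
      proof cases
        case 1 then show ?thesis using short[of ps] HP.paths[of ps] unfolding L_def by simp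
      next
        case 2 then show ?thesis using Lr by simp
      qed
    qed
    have ls0: "0 \<notin> set ls" using entries by blast
    let ?r = "spectral_radius H"
    have rG: "spectral_radius G \<le> ?r" using GH by auto
    \<comment> \<open>The summand 1 covers \<open>z\<close> in 1 / z = ?r - z, which gives 1 / z
      \<ge> 4 * k.\<close>
    have r: "?r \<ge> 4 * real L + 1"
    proof -
      have "(1000000 * real L)\<^sup>2 \<le> n" using m1(1) by (simp add: power_mult_distrib)
      then have "1000000 * real L \<le> sqrt n" by (rule real_le_rsqrt)
      then show ?thesis using rX GX rG Lr by linarith
    qed
    have "?r > 2" using r Lr by linarith
    then obtain z where z: "0 < z" "z < 1" "?r = z + 1 / z" by (rule reciprocal_sum_exists)
    have W: "z + 1 / z = 1 + 2 * sum_list (map (path_weight z) ls)" unfolding ls_def by (rule H.spectral_radius_hub[OF z])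
    have kr: "real k \<le> real L" "real k \<ge> 1"
      using of_nat_mono[OF k(1), where 'a = real] of_nat_mono[OF k(2), where 'a = real] unfolding L_def by simp_all
    have zk: "4 * z * real k \<le> 1"
    proof -
      have "4 * real k \<le> 1 / z" using r z kr by linarith
      then have "z * (4 * real k) \<le> z * (1 / z)" using z by (intro mult_left_mono) auto
      then show ?thesis using z by (simp add: mult_ac)
    qed
    have k0: "k > 0" using k by simp
    have cmp: "sum_list (map (path_weight z) ls) \<le> sum_list (map (path_weight z) bs) \<and>
       (mset ls \<noteq> mset bs \<longrightarrow> sum_list (map (path_weight z) ls) < sum_list (map (path_weight z) bs))"
    proof (cases "L + 6 < length pss \<and> k \<le> length (pss ! (L + 6))")
      case True
      have ex: "excess c ls \<le> excess c hs" if "c \<ge> k" for c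
      proof -
        have "excess c ls = excess c (map length pss)" unfolding lsr using that k by simp
        then show ?thesis using cond[OF hp G(4) _ _ that] True unfolding L_def by simp
      qed
      show ?thesis unfolding bs_def using packed_optimal[OF z(1,2) k0 hs(2) ss ex ls0] by blast
    next
      case False
      \<comment> \<open>For k = 1 every path in \<open>pss\<close> reaches the bulk length, so there
        are at most L + 6 of them with at most L vertices each, and the exceptional vertices are too
        few to fill n - 2. For k \<ge> 2 the exceptional vertices do not count as long.\<close>
      have k2: "k \<ge> 2"
      proof (rule ccontr)
        assume "\<not> k \<ge> 2"
        then have k1: "k = 1" using k by simp
        have lp: "length pss \<le> L + 6"
        proof (rule ccontr)
          assume "\<not> length pss \<le> L + 6"
          then have i: "L + 6 < length pss" by simp
          then have "pss ! (L + 6) \<noteq> []" using HP.nth_path by blast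
          then have "k \<le> length (pss ! (L + 6))" unfolding k1 by (cases "pss ! (L + 6)") auto
          then show False using False i by blast
        qed
        have "sum_list (map length pss) \<le> sum_list (map (\<lambda>_. L) pss)"
          using short unfolding L_def by (intro sum_list_mono) (simp add: less_imp_le)
        also have "\<dots> = length pss * L" by (simp add: sum_list_triv)
        also have "\<dots> \<le> (L + 6) * L" using lp by (rule mult_right_mono) simp
        finally have "sum_list ls \<le> (L + 6) * L + length zs" unfolding lsr by (simp add: sum_list_replicate)
        then have "real (n - 2) \<le> real ((L + 6) * L + length zs)" unfolding sl by (rule of_nat_mono)
        then have "real n - 2 \<le> real L * real L + 6 * real L + real (length zs)" using nn by (simp add: distrib_right)
        then show False using zs m1(1) nL Lr by (simp add: power2_eq_square)
      qed
      have few: "length (filter (\<lambda>a. k \<le> a) ls) \<le> L + 6"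
      proof -
        have "filter (\<lambda>a. k \<le> a) ls = filter (\<lambda>a. k \<le> a) (map length pss)" unfolding lsr using k2 by simp
        moreover have "length (filter (\<lambda>a. k \<le> a) (map length pss)) \<le> L + 6"
        proof (rule length_filter_sorted)
          show "map length pss ! j \<le> map length pss ! i" if "i \<le> j" "j < length (map length pss)" for i j
            using HP.sorted[of i j] that by simp
          show "length (map length pss) \<le> L + 6 \<or> map length pss ! (L + 6) < k"
            using False by (cases "L + 6 < length pss") auto
        qed
        ultimately show ?thesis by simp
      qed
      have big: "2 * (real k * real (L + 6) * real L + 4 * real k ^ 2) < real (sum_list ls)"
      proof -
        have p: "real L ^ 3 \<le> real L ^ 4" "real L ^ 2 \<le> real L ^ 4" using Lr by (intro power_increasing; simp)+
        have "real k * real (L + 6) * real L \<le> real L * (4 * real L) * real L"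
          using kr Lr by (intro mult_mono) auto
        also have "\<dots> = 4 * real L ^ 3" by (simp add: power3_eq_cube)
        finally have a: "real k * real (L + 6) * real L \<le> 4 * real L ^ 3" .
        have b: "real k ^ 2 \<le> real L ^ 2" using kr by (intro power_mono) auto
        have "real (sum_list ls) = real n - 2" unfolding sl using nn by simp
        moreover have "2 * (q + 4 * real k ^ 2) < real n - 2" if "q \<le> 4 * real L ^ 3" for q
        proof -
          have "2 * (q + 4 * real k ^ 2) = 2 * q + 8 * real k ^ 2" by (simp add: distrib_left)
          also have "\<dots> \<le> 16 * real L ^ 4" using that b p by linarith
          also have "\<dots> \<le> real n / 2" using m1(2) by simp
          also have "\<dots> < real n - 2" using nL Lr by simp
          finally show ?thesis .
        qed
        ultimately show ?thesis using a by simp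
      qed
      have "sum_list (map (path_weight z) ls) < sum_list (map (path_weight z) bs)" unfolding bs_def
        by (rule few_long_worse[OF z(1,2) k0 hs(1) ss ls0 _ few zk big]) (use entries in blast)
      then show ?thesis by simp
    qed
    have le: "z + 1 / z \<le> 1 + 2 * sum_list (map (path_weight z) (map length (blocks 0 bs)))"
      unfolding length_blocks using W cmp by simp
    \<comment> \<open>Together with the maximality of \<open>G\<close> this closes a circle of
      inequalities between \<open>G\<close>, \<open>H\<close> and \<open>X\<close>, so that all are
      equalities; strictness for different multisets then fixes the lengths.\<close>
    have rHX: "?r \<le> spectral_radius X" unfolding z(3) by (rule X.spectral_radius_hub_ge(1)[OF z(1,2) le])
    then have eqG: "G = H" using GH GX by auto
    have ms: "mset ls = mset bs"
    proof (rule ccontr)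
      assume "mset ls \<noteq> mset bs"
      then have "z + 1 / z < 1 + 2 * sum_list (map (path_weight z) (map length (blocks 0 bs)))"
        unfolding length_blocks using W cmp by simp
      then have "?r < spectral_radius X" unfolding z(3) by (rule X.spectral_radius_hub_ge(2)[OF z(1,2) le])
      then show False using rG GX by linarith
    qed
    from exists_reordering[OF ms[unfolded ls_def]]
    obtain qss where q: "mset qss = mset (pss @ map (\<lambda>z. [z]) zs)" "map length qss = bs" by (elim exE conjE)
    have "hub_graph G u v qss" unfolding eqG by (rule hub_graph_perm[OF hg q(1)[symmetric]])
    then show ?thesis by (rule hub_graph_isomorphic[OF _ X.hub]) (simp only: q(2) length_blocks)
  qed
  then have "extremal_planar n (tP t l) X"
    unfolding extremal_planar_def using X.simple Xcard Xf planar_K2_join_paths[of bs, folded X_def] by blast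
  then show ?thesis unfolding X_def bs_def s_def .
qed

text \<open>By \<open>free_three\<close> the three longest components have at most l - 3 = A + 2 * m
  vertices together. The third has at least \<open>m\<close>, hence exactly \<open>m\<close>, so the
  first two share at most A + m, and the most unequal split is A and m.\<close>

lemma extremal_single:
  fixes l n :: nat
  assumes l: "l \<ge> 6"
    and n: "real n \<ge> 10000000000000 * real (1 * l) ^ 2" "real n \<ge> 5000000000 * real (1 * l) ^ 4"
  shows "extremal_planar n (tP 1 l) (K2_join_paths (HP2 n (l - 3 - 2 * ((l - 3) div 3)) ((l - 3) div 3)))"
proof -
  define m where "m = (l - 3) div 3"
  have m: "1 \<le> m" "3 * m \<le> l - 3" "l - 3 < 3 * m + 3" unfolding m_def using l by linarith+
  define A where "A = l - 3 - 2 * m"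
  have A: "m \<le> A" "A + 2 * m = l - 3" unfolding A_def using m by linarith+
  have "extremal_planar n (tP 1 l) (K2_join_paths (packed [A] m (n - 2 - sum_list [A])))"
  proof (rule extremal_packed[OF _ _ _ n])
    let ?bs = "packed [A] m (n - 2 - sum_list [A])"
    show "F_free (tP 1 l) (K2_join_paths ?bs)"
    proof (rule hub.F_free_single[OF hub_K2_join_paths])
      fix i assume "i < length (blocks 0 ?bs)"
      then have i: "i < length ?bs" "length (blocks 0 ?bs ! i) = ?bs ! i" using length_blocks_nth by blast+
      have "?bs ! 0 = A" unfolding packed_def by simp
      moreover have "?bs ! i \<le> m" if "i \<noteq> 0" using that packed_nth_le[of m "[A]" i] m i(1) by simp
      ultimately show "length (blocks 0 ?bs ! i) \<le> (if i = 0 then A else m)" unfolding i(2) by auto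
    qed (use A l in auto)
    fix G u v pss c
    assume "hub_paths G u v pss" and f: "F_free (tP 1 l) G" "1 * l + 6 < length pss" "m \<le> length (pss ! (1 * l + 6))" "m \<le> c"
    then interpret hub_paths G u v pss by simp
    have "length (pss ! 0) + length (pss ! 1) + length (pss ! 2) + 2 < l"
      by (rule free_three) (use f l in auto)
    moreover have "length (pss ! (1 * l + 6)) \<le> length (pss ! 2)" "length (pss ! 2) \<le> length (pss ! 1)" "length (pss ! 1) \<le> length (pss ! 0)"
      by (rule sorted; use f in simp)+
    moreover have "excess c (map length pss) = (\<Sum>i<2. length (pss ! i) - c)"
      by (rule excess_take) (use f calculation m in linarith)+
    then have "excess c (map length pss) = (length (pss ! 0) - c) + (length (pss ! 1) - c)"
      by (simp only: numeral_2_eq_2 sum.lessThan_Suc lessThan_0 sum.empty One_nat_def)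
    moreover have "excess c [A] = A - c" by simp
    ultimately show "excess c (map length pss) \<le> excess c [A]" using f(3,4) A m by linarith
  qed (use l m A in auto)
  then show ?thesis unfolding HP2_packed A_def m_def by simp
qed

text \<open>The lengths k and k' are the lower and upper halves of l - 2. Each alternative of
  \<open>free_four\<close> gives the excess bound, the second one together with
  \<open>free_long\<close>.\<close>

lemma extremal_two:
  fixes l n :: nat
  assumes l: "l \<ge> 4"
    and n: "real n \<ge> 10000000000000 * real (2 * l) ^ 2" "real n \<ge> 5000000000 * real (2 * l) ^ 4"
  shows "extremal_planar n (tP 2 l) (K2_join_paths (HP3 n (l - 1) ((l - 2 + 1) div 2) ((l - 2) div 2)))"
proof -
  define k where "k = (l - 2) div 2"
  define k' where "k' = (l - 2 + 1) div 2"
  have k: "1 \<le> k" "k \<le> k'" "k' \<le> k + 1" "k + k' + 2 = l" unfolding k_def k'_def using l by linarith+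
  let ?hs = "[l - 1, k']"
  have "extremal_planar n (tP 2 l) (K2_join_paths (packed ?hs k (n - 2 - sum_list ?hs)))"
  proof (rule extremal_packed[OF _ _ _ n])
    let ?bs = "packed ?hs k (n - 2 - sum_list ?hs)"
    show "F_free (tP 2 l) (K2_join_paths ?bs)"
    proof (rule hub.F_free_two[OF hub_K2_join_paths])
      fix i assume "i < length (blocks 0 ?bs)"
      then have i: "i < length ?bs" "length (blocks 0 ?bs ! i) = ?bs ! i" using length_blocks_nth by blast+
      have "?bs ! 0 = l - 1" "?bs ! 1 = k'" unfolding packed_def by simp_all
      moreover have "?bs ! i \<le> k" if "i \<noteq> 0" "i \<noteq> 1" using that packed_nth_le[of k ?hs i] k i(1) by simp
      ultimately show "length (blocks 0 ?bs ! i) \<le> (if i = 0 then l - 1 else if i = 1 then k' else k)" unfolding i(2) by auto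
    qed (use k in auto)
    fix G u v pss c
    assume "hub_paths G u v pss" and f: "F_free (tP 2 l) G" "2 * l + 6 < length pss" "k \<le> length (pss ! (2 * l + 6))" "k \<le> c"
    then interpret hub_paths G u v pss by simp
    let ?a = "\<lambda>i. length (pss ! i)"
    have s: "?a (2 * l + 6) \<le> ?a 3" "?a 3 \<le> ?a 2" "?a 2 \<le> ?a 1" "?a 1 \<le> ?a 0"
      by (rule sorted; use f in simp)+
    \<comment> \<open>The next three components, joined by both hubs, already have at least 3 * k +
      2 \<ge> l vertices.\<close>
    have a0: "?a 0 < l" by (rule free_long[OF f(1)]) (use f s k in linarith)+
    have e: "excess c ?hs = (l - 1 - c) + (k' - c)" by simp
    have "?a 0 + ?a 3 + 1 < l \<or> ?a 1 + ?a 2 + 1 < l" by (rule free_four[OF f(1)]) (use f k in linarith)+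
    then show "excess c (map length pss) \<le> excess c ?hs"
    proof
      \<comment> \<open>As \<open>?a 3\<close> is at least k, all lengths are at most k' \<le> k +
        1: the excess is at most 3 at c = k and vanishes above.\<close>
      assume b: "?a 0 + ?a 3 + 1 < l"
      have "excess c (map length pss) = (\<Sum>i<3. ?a i - c)"
        by (rule excess_take) (use b f s k in linarith)+
      then have "excess c (map length pss) = (?a 0 - c) + (?a 1 - c) + (?a 2 - c)"
        by (simp only: numeral_3_eq_3 numeral_2_eq_2 sum.lessThan_Suc lessThan_0 sum.empty One_nat_def)
      then show ?thesis unfolding e using b s k f(3,4) by linarith
    next
      \<comment> \<open>Now \<open>?a 2\<close> equals k and \<open>?a 1\<close> is at most k', so
        the two long entries are bounded one by one by \<open>?hs\<close>.\<close>
      assume b: "?a 1 + ?a 2 + 1 < l"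
      have "excess c (map length pss) = (\<Sum>i<2. ?a i - c)"
        by (rule excess_take) (use b f s k in linarith)+
      then have "excess c (map length pss) = (?a 0 - c) + (?a 1 - c)"
        by (simp only: numeral_2_eq_2 sum.lessThan_Suc lessThan_0 sum.empty One_nat_def)
      then show ?thesis unfolding e using a0 b s k f(3,4) by linarith
    qed
  qed (use l k in auto)
  then show ?thesis unfolding HP3_packed k_def k'_def by simp
qed

text \<open>By \<open>free_chunks\<close> the components contain at most d = t - 3 disjoint chunks
  of \<open>l\<close> vertices, which bounds the excess over l - 1 by d * l. A single long component
  with d * l + (l - 1) vertices attains this, and by \<open>excess_superadditive\<close> it is also
  best at every larger threshold.\<close>

lemma extremal_many:
  fixes t l n :: nat
  assumes t: "t \<ge> 3" and l: "l \<ge> 3"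
    and n: "real n \<ge> 10000000000000 * real (t * l) ^ 2" "real n \<ge> 5000000000 * real (t * l) ^ 4"
  shows "extremal_planar n (tP t l) (K2_join_paths (HP2 n (t * l - 2 * l - 1) (l - 1)))"
proof -
  define A where "A = t * l - 2 * l - 1"
  obtain d where d: "t = d + 3" using t by (metis le_add_diff_inverse2)
  have tl: "t * l = d * l + 3 * l" unfolding d by (rule distrib_right)
  have A: "A = d * l + (l - 1)" unfolding A_def tl using l by simp
  have "extremal_planar n (tP t l) (K2_join_paths (packed [A] (l - 1) (n - 2 - sum_list [A])))"
  proof (rule extremal_packed[OF _ _ _ n])
    let ?bs = "packed [A] (l - 1) (n - 2 - sum_list [A])"
    have bs: "length (blocks 0 ?bs ! 0) = A \<and> (0 < i \<longrightarrow> i < length (blocks 0 ?bs) \<longrightarrow> length (blocks 0 ?bs ! i) \<le> l - 1)" for i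
    proof -
      have "?bs ! 0 = A" "0 < length ?bs" unfolding packed_def by simp_all
      moreover have "length (blocks 0 ?bs) = length ?bs" by (metis length_blocks length_map)
      ultimately have "length (blocks 0 ?bs ! 0) = A" using length_blocks_nth[of 0 0 ?bs] by simp
      moreover have "?bs ! i \<le> l - 1" if "0 < i" "i < length ?bs" using that packed_nth_le[of "l - 1" "[A]" i] l by simp
      ultimately show ?thesis using length_blocks_nth[of i 0 ?bs] by simp
    qed
    show "F_free (tP t l) (K2_join_paths ?bs)"
    proof (rule hub.F_free_many[OF hub_K2_join_paths])
      show "length (blocks 0 ?bs ! 0) < (t - 2) * l" using bs l unfolding A d by simp
      show "length (blocks 0 ?bs ! i) < l" if "0 < i" "i < length (blocks 0 ?bs)" for i using bs[of i] that l by linarith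
    qed (use t l in auto)
    fix G u v pss c
    assume "hub_paths G u v pss" and f: "F_free (tP t l) G" "t * l + 6 < length pss" "l - 1 \<le> length (pss ! (t * l + 6))" "l - 1 \<le> c"
    then interpret hub_paths G u v pss by simp
    have tt: "t \<le> t * l" using l by simp
    have "length (pss ! (t * l + 6)) \<le> length (pss ! (t - 1))" by (rule sorted) (use f tt in linarith)+
    then have "sum_list (map (\<lambda>ps. length ps div l) pss) < t - 2"
      by (intro free_chunks[OF f(1)]) (use f l t tt in linarith)+
    then have "sum_list (map (\<lambda>ps. length ps div l) pss) * l \<le> d * l" unfolding d by (intro mult_right_mono) auto
    \<comment> \<open>A component with a * l + r vertices, where r \<le> l - 1, exceeds l - 1 by at
      most a * l.\<close>
    moreover have "excess (l - 1) (map length qss) \<le> sum_list (map (\<lambda>ps. length ps div l) qss) * l" for qss :: "nat list list"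
    proof (induction qss)
      case (Cons q qss)
      have "length q = (length q div l) * l + length q mod l" by simp
      moreover have "length q mod l \<le> l - 1" using l mod_less_divisor[of l "length q"] by linarith
      ultimately have "length q - (l - 1) \<le> (length q div l) * l" by linarith
      then show ?case using Cons by (simp add: distrib_right)
    qed simp
    ultimately have e: "excess (l - 1) (map length pss) \<le> d * l" using order_trans by blast
    have h: "excess c [A] = d * l + (l - 1) - c" unfolding A by simp
    show "excess c (map length pss) \<le> excess c [A]"
    proof (cases "excess c (map length pss) > 0")
      case True
      then have "excess c (map length pss) + (c - (l - 1)) \<le> excess (l - 1) (map length pss)"
        using excess_superadditive[OF f(4), of "map length pss"] by (simp only: if_True)
      then show ?thesis unfolding h using e f(4) by linarith
    qed simp
  next
    show "sum_list [A] \<le> 2 * (t * l)" unfolding A tl by simp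
    show "2 \<le> t * l" "l - 1 \<le> t * l" unfolding tl using l by simp_all
  qed (use l t A in auto)
  then show ?thesis unfolding HP2_packed A_def by simp
qed

lemma threshold_ge:
  fixes a b x :: real
  assumes "x \<ge> max a b + 3 / 2 * sqrt (2 * max a b - 6)" "a \<ge> 3"
  shows "x \<ge> a"
proof -
  have "0 \<le> 2 * max a b - 6" using assms(2) by linarith
  then have "0 \<le> sqrt (2 * max a b - 6)" by (rule real_sqrt_ge_zero)
  then show ?thesis using assms(1) by linarith
qed

theorem theorem4:
  fixes t l n :: nat
  defines "N0 \<equiv> max (2.67 * 9 ^ 17) (10.2 * 2 ^ (t * l - 3) + 2 :: real)"
  shows
   "(t = 1 \<and> l \<ge> 6 \<longrightarrow>
      (let N = max N0 (625 / 32 * real ((l - 3) div 3) ^ 2 + 2) in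
       real n \<ge> N + 3 / 2 * sqrt (2 * N - 6) \<longrightarrow>
       extremal_planar n (tP t l)
         (K2_join_paths (HP2 n (l - 3 - 2 * ((l - 3) div 3)) ((l - 3) div 3))))) \<and>
    (t = 2 \<and> l \<ge> 4 \<longrightarrow>
      (let N = max N0 (625 / 32 * real ((l - 2) div 2) ^ 2 + 2) in
       real n \<ge> N + 3 / 2 * sqrt (2 * N - 6) \<longrightarrow>
       extremal_planar n (tP t l)
         (K2_join_paths (HP3 n (l - 1) ((l - 2 + 1) div 2) ((l - 2) div 2))))) \<and>
    (t \<ge> 3 \<and> l \<ge> 3 \<longrightarrow>
      (let N = max N0 (625 / 32 * (real ((l - 2) div 2) + 1) ^ 2 + 2) in
       real n \<ge> N + 3 / 2 * sqrt (2 * N - 6) \<longrightarrow>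
       extremal_planar n (tP t l)
         (K2_join_paths (HP2 n (t * l - 2 * l - 1) (l - 1)))))"
proof -
  have N0: "N0 \<ge> 3" unfolding N0_def by simp
  have bounds: "real n \<ge> 10000000000000 * real (t * l) ^ 2" "real n \<ge> 5000000000 * real (t * l) ^ 4"
    if "real n \<ge> max N0 M + 3 / 2 * sqrt (2 * max N0 M - 6)" for M
    using order_bounds[OF threshold_ge[OF that N0, unfolded N0_def]] by blast+
  show ?thesis unfolding Let_def
  proof (intro conjI impI; elim conjE)
    assume "t = 1" "6 \<le> l" "max N0 (625 / 32 * real ((l - 3) div 3) ^ 2 + 2) +
      3 / 2 * sqrt (2 * max N0 (625 / 32 * real ((l - 3) div 3) ^ 2 + 2) - 6) \<le> real n"
    then show "extremal_planar n (tP t l) (K2_join_paths (HP2 n (l - 3 - 2 * ((l - 3) div 3)) ((l - 3) div 3)))"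
      using extremal_single[of l n] bounds by blast
  next
    assume "t = 2" "4 \<le> l" "max N0 (625 / 32 * real ((l - 2) div 2) ^ 2 + 2) +
      3 / 2 * sqrt (2 * max N0 (625 / 32 * real ((l - 2) div 2) ^ 2 + 2) - 6) \<le> real n"
    then show "extremal_planar n (tP t l) (K2_join_paths (HP3 n (l - 1) ((l - 2 + 1) div 2) ((l - 2) div 2)))"
      using extremal_two[of l n] bounds by blast
  next
    assume "3 \<le> t" "3 \<le> l" "max N0 (625 / 32 * (real ((l - 2) div 2) + 1) ^ 2 + 2) +
      3 / 2 * sqrt (2 * max N0 (625 / 32 * (real ((l - 2) div 2) + 1) ^ 2 + 2) - 6) \<le> real n"
    then show "extremal_planar n (tP t l) (K2_join_paths (HP2 n (t * l - 2 * l - 1) (l - 1)))"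
      using extremal_many[of t l n] bounds by blast
  qed
qed

end
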